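(* Let $(X,\varphi,g)$ be a Riemannian $7$-manifold with holonomy contained in $G_2$, let $(\Sigma,h)$ be an oriented Riemannian surface, and let $f:\Sigma\to X$ be an immersion such that the second fundamental form of $f(\Sigma)$ in $(X,g)$ takes values orthogonal to the vector $\eta=\eta(\xi)$, where $\xi=f_*(T_p\Sigma)$, at every point $p\in\Sigma$. Then the $7$-dimensional Gauss lift $\tilde f_7:\Sigma\to Z_7$ is holomorphic with respect to the Hermitian structure on the distribution $\mathcal{E}$ (that is, $\tilde f_{7*}:T_\Sigma\to\mathcal{E}$ is complex linear) if and only if $f:\Sigma\to X$ is conformal and harmonic.
   Context: Let $\varphi_0=\varepsilon^{123}+\varepsilon^1\wedge(\varepsilon^{45}-\varepsilon^{67})+\varepsilon^2\wedge(\varepsilon^{46}-\varepsilon^{75})+\varepsilon^3\wedge(\varepsilon^{47}-\varepsilon^{56})$ on $\mathbb{R}^7$, where $\{\varepsilon^i\}$ is the dual of the standard basis and $\varepsilon^{ij}=\varepsilon^i\wedge\varepsilon^j$, etc. A Riemannian $7$-manifold $(X,\varphi,g)$ with holonomy contained in $G_2$ is a $7$-manifold with a smooth $3$-form $\varphi$ such that at each point there is a basis $\{e_i\}$ of the tangent space with dual coframe $\{\varepsilon^i\}$ in which $\varphi$ has the form $\varphi_0$; $g$ is the metric determined by $\varphi$ (for which such bases $\{e_i\}$ are orthonormal), and $\varphi$ is parallel for the Levi-Civita connection of $g$. The vector cross product on each tangent space is defined by $g(u,v\times w)=\varphi(u,v,w)$. For an oriented $2$-plane $\xi\subseteq T_xX$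 with oriented orthonormal basis $\{u,v\}$, put $\eta(\xi)=u\times v$; this is a unit vector orthogonal to $\xi$ and independent of the chosen oriented orthonormal basis. $Z_7$ is the unit sphere bundle of $TX$, with projection $\pi:Z_7\to X$. The Levi-Civita connection of $g$ splits $T_\eta Z_7=V_\eta\oplus H_\eta$ into the vertical space $V_\eta=\ker\pi_*$ and the horizontal space $H_\eta$ (generated by parallel translates of $\eta$). For $\eta\in Z_7$ with $\pi(\eta)=x$ let $E_\eta=\langle\eta\rangle^\perp\subseteq T_xX$, with complex structure $\mathcal{J}:E_\eta\to E_\eta$ defined by $g(\mathcal{J}v,w)=\varphi(\eta,v,w)$, i.e. $\mathcal{J}v=\eta\times v$. The distribution $\mathcal{E}_\eta=\pi_*^{-1}(E_\eta)\subseteq T_\eta Z_7$ decomposes as $\mathcal{E}_\eta=E^V_\eta\oplus E^H_\eta$, with $E^V_\eta=V_\eta$ and $E^H_\eta=\pi_*^{-1}(E_\eta)\cap H_\eta$. Both are canonically identified with $E_\eta$ ($E^H_\eta$ via $\pi_*$, and $V_\eta$ as the tangent space at $\eta$ of the unit sphere in $T_xX$). The Hermitian (complex) structure on $\mathcal{E}$ is $\mathcal{J}$ on each of the two summands under these identifications. For an immersion $f:\Sigma\to X$ of an oriented surface, the $7$-dimensional Gauss lift is $\tilde f_7:\Sigma\to Z_7$, $\tilde f_7(p)=\eta(f_*(T_p\Sigma))\in T_{f(p)}X$, where $f_*(T_p\Sigma)$ carries the orientation induced from $\Sigma$. Its derivative always takes values in $\mathcal{E}$. $T_\Sigma$ carries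 the complex structure determined by $h$ and the orientation of $\Sigma$ (rotation by $+90^\circ$). The map $f$ is conformal if $f^*g=\lambda h$ for some positive function $\lambda$ on $\Sigma$. It is harmonic if its tension field $\tau_f=\operatorname{tr}_h(\nabla df)\in\Gamma(\Sigma,f^*TX)$ vanishes, where $\nabla$ is the connection on $T^*\Sigma\otimes f^*TX$ induced by the Levi-Civita connections of $h$ and $g$. The second fundamental form is $B(v,w)=(\nabla_vw)^N$, the component normal to $f_*(T_\Sigma)$ of the Levi-Civita derivative of $g$. *)

theory Defs
  imports "HOL-Analysis.Analysis" "HOL-Library.Function_Algebras"
begin

section \<open>Smooth manifolds\<close>

text \<open>\<^term>\<open>smooth_on S f\<close> is meant for open \<^term>\<open>S\<close>.\<close>

primrec diff_order_on :: "nat \<Rightarrow> 'b::real_normed_vector set \<Rightarrow> ('b \<Rightarrow> 'c::real_normed_vector) \<Rightarrow> bool" where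
  "diff_order_on 0 S f \<longleftrightarrow> continuous_on S f"
| "diff_order_on (Suc k) S f \<longleftrightarrow>
     (\<forall>x\<in>S. f differentiable (at x)) \<and>
     (\<forall>v. diff_order_on k S (\<lambda>x. frechet_derivative f (at x) v))"

definition smooth_on :: "'b::real_normed_vector set \<Rightarrow> ('b \<Rightarrow> 'c::real_normed_vector) \<Rightarrow> bool" where
  "smooth_on S f \<longleftrightarrow> (\<forall>k. diff_order_on k S f)"

text \<open>A chart is a pair of its domain and its coordinate map; the coordinate map is only
  relevant on the domain. A manifold is represented by an atlas, not assumed maximal; its
  underlying set and its topology are determined by the atlas.\<close>

type_synonym ('a, 'b) chart = "'a set \<times> ('a \<Rightarrow> 'b)"

definition chart_inv :: "('a, 'b) chart \<Rightarrow> 'b \<Rightarrow> 'a" where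
  "chart_inv c = inv_into (fst c) (snd c)"

definition chart_image :: "('a, 'b) chart \<Rightarrow> 'b set" where
  "chart_image c = snd c ` fst c"

definition carrier :: "('a, 'b) chart set \<Rightarrow> 'a set" where
  "carrier M = (\<Union>c\<in>M. fst c)"

definition chart_at :: "('a, 'b) chart set \<Rightarrow> 'a \<Rightarrow> ('a, 'b) chart" where
  "chart_at M p = (SOME c. c \<in> M \<and> p \<in> fst c)"

definition atlas_topology :: "('a, 'b::topological_space) chart set \<Rightarrow> 'a topology" where
  "atlas_topology M =
     topology_generated_by {{p \<in> fst c. snd c p \<in> V} | c V. c \<in> M \<and> open V}"

definition smooth_manifold :: "('a, 'b::euclidean_space) chart set \<Rightarrow> bool" where
  "smooth_manifold M \<longleftrightarrow>
     (\<forall>c\<in>M. inj_on (snd c) (fst c) \<and> open (chart_image c)) \<and>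
     (\<forall>c\<in>M. \<forall>d\<in>M. open (snd c ` (fst c \<inter> fst d)) \<and>
        smooth_on (snd c ` (fst c \<inter> fst d)) (snd d \<circ> chart_inv c)) \<and>
     Hausdorff_space (atlas_topology M) \<and> second_countable (atlas_topology M)"

definition smooth_map ::
  "('a, 'b::euclidean_space) chart set \<Rightarrow> ('c, 'd::euclidean_space) chart set \<Rightarrow> ('a \<Rightarrow> 'c) \<Rightarrow> bool" where
  "smooth_map M N f \<longleftrightarrow>
     (\<forall>p\<in>carrier M. \<exists>c\<in>M. \<exists>d\<in>N. \<exists>U. p \<in> fst c \<and> open U \<and> snd c p \<in> U \<and> U \<subseteq> chart_image c \<and>
        f ` (chart_inv c ` U) \<subseteq> fst d \<and> smooth_on U (snd d \<circ> f \<circ> chart_inv c))"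

definition interval_manifold :: "real \<Rightarrow> (real, real) chart set" where
  "interval_manifold e = {({-e<..<e}, \<lambda>t. t)}"


section \<open>Tangent vectors\<close>

text \<open>A tangent vector at \<^term>\<open>p\<close> is the family of its components in all charts around \<^term>\<open>p\<close>,
  related by the Jacobians of the transition maps; the components are set to \<^term>\<open>0\<close> in the charts
  not containing \<^term>\<open>p\<close>, so that each tangent space is a linear subspace of a function space.\<close>

type_synonym ('a, 'b) tvec = "('a, 'b) chart \<Rightarrow> 'b"

definition tangent_space :: "('a, 'b::euclidean_space) chart set \<Rightarrow> 'a \<Rightarrow> ('a, 'b) tvec set" where
  "tangent_space M p =
     {v. (\<forall>c\<in>M. \<forall>d\<in>M. p \<in> fst c \<and> p \<in> fst d \<longrightarrow>
            v d = frechet_derivative (snd d \<circ> chart_inv c) (at (snd c p)) (v c)) \<and>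
         (\<forall>c. \<not> (c \<in> M \<and> p \<in> fst c) \<longrightarrow> v c = 0)}"

definition tv_scale :: "real \<Rightarrow> ('a, 'b::euclidean_space) tvec \<Rightarrow> ('a, 'b) tvec" where
  "tv_scale r v = (\<lambda>c. r *\<^sub>R v c)"

text \<open>The tangent vector at \<^term>\<open>p\<close> with components \<^term>\<open>a\<close> in the chart \<^term>\<open>c\<close>.\<close>

definition tangent_of ::
  "('a, 'b::euclidean_space) chart set \<Rightarrow> ('a, 'b) chart \<Rightarrow> 'a \<Rightarrow> 'b \<Rightarrow> ('a, 'b) tvec" where
  "tangent_of M c p a =
     (\<lambda>d. if d \<in> M \<and> p \<in> fst d
          then frechet_derivative (snd d \<circ> chart_inv c) (at (snd c p)) a else 0)"

definition differential ::
  "('a, 'b::euclidean_space) chart set \<Rightarrow> ('c, 'd::euclidean_space) chart set \<Rightarrow> ('a \<Rightarrow> 'c) \<Rightarrow>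
     'a \<Rightarrow> ('a, 'b) tvec \<Rightarrow> ('c, 'd) tvec" where
  "differential M N f p v =
     (\<lambda>d. if d \<in> N \<and> f p \<in> fst d
          then frechet_derivative (snd d \<circ> f \<circ> chart_inv (chart_at M p))
                 (at (snd (chart_at M p) p)) (v (chart_at M p))
          else 0)"

definition velocity ::
  "('c, 'd::euclidean_space) chart set \<Rightarrow> (real \<Rightarrow> 'c) \<Rightarrow> real \<Rightarrow> ('c, 'd) tvec" where
  "velocity N \<gamma> t =
     (\<lambda>d. if d \<in> N \<and> \<gamma> t \<in> fst d then vector_derivative (snd d \<circ> \<gamma>) (at t) else 0)"

definition tangent_bundle ::
  "('a, 'b::euclidean_space) chart set \<Rightarrow> ('a \<times> ('a, 'b) tvec, 'b \<times> 'b) chart set" where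
  "tangent_bundle M =
     (\<lambda>c. ({(p, v). p \<in> fst c \<and> v \<in> tangent_space M p}, \<lambda>(p, v). (snd c p, v c))) ` M"

definition smooth_field_near ::
  "('a, 'b::euclidean_space) chart set \<Rightarrow> 'a \<Rightarrow> ('a \<Rightarrow> ('a, 'b) tvec) \<Rightarrow> bool" where
  "smooth_field_near M p W \<longleftrightarrow>
     (\<exists>c\<in>M. \<exists>U. p \<in> fst c \<and> open U \<and> snd c p \<in> U \<and> U \<subseteq> chart_image c \<and>
        (\<forall>y\<in>U. W (chart_inv c y) \<in> tangent_space M (chart_inv c y)) \<and>
        smooth_on U (\<lambda>y. W (chart_inv c y) c))"

definition immersion ::
  "('a, 'b::euclidean_space) chart set \<Rightarrow> ('c, 'd::euclidean_space) chart set \<Rightarrow> ('a \<Rightarrow> 'c) \<Rightarrow> bool" where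
  "immersion M N f \<longleftrightarrow>
     smooth_map M N f \<and> (\<forall>p\<in>carrier M. inj_on (differential M N f p) (tangent_space M p))"


section \<open>Riemannian metrics and the Levi-Civita connection\<close>

type_synonym ('a, 'b) metric_tensor = "'a \<Rightarrow> ('a, 'b) tvec \<Rightarrow> ('a, 'b) tvec \<Rightarrow> real"

definition metric_coord ::
  "('a, 'b::euclidean_space) chart set \<Rightarrow> ('a, 'b) metric_tensor \<Rightarrow> ('a, 'b) chart \<Rightarrow>
     'b \<Rightarrow> 'b \<Rightarrow> 'b \<Rightarrow> real" where
  "metric_coord M g c y a b =
     g (chart_inv c y) (tangent_of M c (chart_inv c y) a) (tangent_of M c (chart_inv c y) b)"

definition riemannian_metric ::
  "('a, 'b::euclidean_space) chart set \<Rightarrow> ('a, 'b) metric_tensor \<Rightarrow> bool" where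
  "riemannian_metric M g \<longleftrightarrow>
     (\<forall>p\<in>carrier M. \<forall>u\<in>tangent_space M p. \<forall>v\<in>tangent_space M p. g p u v = g p v u) \<and>
     (\<forall>p\<in>carrier M. \<forall>u\<in>tangent_space M p. u \<noteq> 0 \<longrightarrow> g p u u > 0) \<and>
     (\<forall>c\<in>M. \<forall>y\<in>chart_image c. bilinear (metric_coord M g c y)) \<and>
     (\<forall>c\<in>M. \<forall>a b. smooth_on (chart_image c) (\<lambda>y. metric_coord M g c y a b))"

text \<open>The Christoffel symbols, as a bilinear map, of the unique torsion-free metric
  connection: \<open>\<nabla>\<^sub>a b = \<Gamma> a b\<close> for fields \<open>a\<close>, \<open>b\<close> with constant components in the chart \<^term>\<open>c\<close>.\<close>

definition levi_civita ::
  "('a, 'b::euclidean_space) chart set \<Rightarrow> ('a, 'b) metric_tensor \<Rightarrow> ('a, 'b) chart \<Rightarrow>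
     'b \<Rightarrow> 'b \<Rightarrow> 'b \<Rightarrow> 'b" where
  "levi_civita M g c y =
     (THE \<Gamma>. bilinear \<Gamma> \<and> (\<forall>a b. \<Gamma> a b = \<Gamma> b a) \<and>
        (\<forall>a b k. frechet_derivative (\<lambda>z. metric_coord M g c z b k) (at y) a =
           metric_coord M g c y (\<Gamma> a b) k + metric_coord M g c y b (\<Gamma> a k)))"

text \<open>The pull-back of the Levi-Civita connection of \<^term>\<open>(N, g)\<close> along \<^term>\<open>f\<close>, applied to a section
  \<^term>\<open>s\<close> of the pulled-back tangent bundle, so \<^term>\<open>s q \<in> tangent_space N (f q)\<close>, in the
  direction \<^term>\<open>v \<in> tangent_space M p\<close>.\<close>

definition nabla_along ::
  "('a, 'b::euclidean_space) chart set \<Rightarrow> ('c, 'd::euclidean_space) chart set \<Rightarrow>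
     ('c, 'd) metric_tensor \<Rightarrow> ('a \<Rightarrow> 'c) \<Rightarrow> ('a \<Rightarrow> ('c, 'd) tvec) \<Rightarrow> 'a \<Rightarrow> ('a, 'b) tvec \<Rightarrow>
     ('c, 'd) tvec" where
  "nabla_along M N g f s p v =
     (\<lambda>d. if d \<in> N \<and> f p \<in> fst d
          then frechet_derivative (\<lambda>y. s (chart_inv (chart_at M p) y) d)
                 (at (snd (chart_at M p) p)) (v (chart_at M p))
               + levi_civita N g d (snd d (f p)) (differential M N f p v d) (s p d)
          else 0)"

definition parallel_along ::
  "('a, 'b::euclidean_space) chart set \<Rightarrow> ('a, 'b) metric_tensor \<Rightarrow> real set \<Rightarrow> (real \<Rightarrow> 'a) \<Rightarrow>
     (real \<Rightarrow> ('a, 'b) tvec) \<Rightarrow> bool" where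
  "parallel_along M g I \<gamma> w \<longleftrightarrow>
     (\<forall>t\<in>I. w t \<in> tangent_space M (\<gamma> t) \<and>
        (\<forall>d\<in>M. \<gamma> t \<in> fst d \<longrightarrow>
           ((\<lambda>s. w s d) has_vector_derivative
              - levi_civita M g d (snd d (\<gamma> t)) (velocity M \<gamma> t d) (w t d)) (at t)))"


section \<open>Maps between Riemannian manifolds\<close>

definition conformal ::
  "('a, 'b::euclidean_space) chart set \<Rightarrow> ('a, 'b) metric_tensor \<Rightarrow>
   ('c, 'd::euclidean_space) chart set \<Rightarrow> ('c, 'd) metric_tensor \<Rightarrow> ('a \<Rightarrow> 'c) \<Rightarrow> bool" where
  "conformal M h N g f \<longleftrightarrow>
     (\<exists>l :: 'a \<Rightarrow> real. \<forall>p\<in>carrier M. l p > 0 \<and>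
        (\<forall>u\<in>tangent_space M p. \<forall>v\<in>tangent_space M p.
           g (f p) (differential M N f p u) (differential M N f p v) = l p * h p u v))"

text \<open>\<open>(\<nabla>df)(v, w) = \<nabla>\<^sub>v (df W) - df (\<nabla>\<^sub>v W)\<close> for any local extension \<open>W\<close> of \<^term>\<open>w\<close>; this does not
  depend on the extension. The same holds for the second fundamental form below.\<close>

definition nabla_differential ::
  "('a, 'b::euclidean_space) chart set \<Rightarrow> ('a, 'b) metric_tensor \<Rightarrow>
   ('c, 'd::euclidean_space) chart set \<Rightarrow> ('c, 'd) metric_tensor \<Rightarrow> ('a \<Rightarrow> 'c) \<Rightarrow>
     'a \<Rightarrow> ('a, 'b) tvec \<Rightarrow> ('a, 'b) tvec \<Rightarrow> ('c, 'd) tvec" where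
  "nabla_differential M h N g f p v w =
     (THE b. \<forall>W. smooth_field_near M p W \<and> W p = w \<longrightarrow>
        b = nabla_along M N g f (\<lambda>q. differential M N f q (W q)) p v
            - differential M N f p (nabla_along M M h (\<lambda>q. q) W p v))"

definition normal_part ::
  "('a, 'b::euclidean_space) chart set \<Rightarrow> ('c, 'd::euclidean_space) chart set \<Rightarrow>
     ('c, 'd) metric_tensor \<Rightarrow> ('a \<Rightarrow> 'c) \<Rightarrow> 'a \<Rightarrow> ('c, 'd) tvec \<Rightarrow> ('c, 'd) tvec" where
  "normal_part M N g f p u =
     (THE n. n \<in> tangent_space N (f p) \<and>
        (\<forall>v\<in>tangent_space M p. g (f p) n (differential M N f p v) = 0) \<and>
        (\<exists>v\<in>tangent_space M p. u = n + differential M N f p v))"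

definition second_fundamental_form ::
  "('a, 'b::euclidean_space) chart set \<Rightarrow> ('c, 'd::euclidean_space) chart set \<Rightarrow>
     ('c, 'd) metric_tensor \<Rightarrow> ('a \<Rightarrow> 'c) \<Rightarrow> 'a \<Rightarrow> ('a, 'b) tvec \<Rightarrow> ('a, 'b) tvec \<Rightarrow> ('c, 'd) tvec" where
  "second_fundamental_form M N g f p v w =
     (THE b. \<forall>W. smooth_field_near M p W \<and> W p = w \<longrightarrow>
        b = normal_part M N g f p (nabla_along M N g f (\<lambda>q. differential M N f q (W q)) p v))"


section \<open>Oriented surfaces\<close>

text \<open>The orientation is the one for which all charts of the atlas are positively oriented.\<close>

definition oriented_surface :: "('a, real^2) chart set \<Rightarrow> bool" where
  "oriented_surface M \<longleftrightarrow> smooth_manifold M \<and>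
     (\<forall>c\<in>M. \<forall>d\<in>M. \<forall>p\<in>fst c \<inter> fst d.
        det (matrix (frechet_derivative (snd d \<circ> chart_inv c) (at (snd c p)))) > 0)"

definition positive_basis ::
  "('a, real^2) chart set \<Rightarrow> 'a \<Rightarrow> ('a, real^2) tvec \<Rightarrow> ('a, real^2) tvec \<Rightarrow> bool" where
  "positive_basis M p u v \<longleftrightarrow>
     u \<in> tangent_space M p \<and> v \<in> tangent_space M p \<and>
     (\<forall>c\<in>M. p \<in> fst c \<longrightarrow> det (vector [u c, v c] :: real^2^2) > 0)"

definition rotate90 ::
  "('a, real^2) chart set \<Rightarrow> ('a, real^2) metric_tensor \<Rightarrow> 'a \<Rightarrow> ('a, real^2) tvec \<Rightarrow>
     ('a, real^2) tvec" where
  "rotate90 M h p v =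
     (THE w. w \<in> tangent_space M p \<and> h p v w = 0 \<and> h p w w = h p v v \<and>
        (v \<noteq> 0 \<longrightarrow> positive_basis M p v w))"

definition tension_field ::
  "('a, real^2) chart set \<Rightarrow> ('a, real^2) metric_tensor \<Rightarrow>
   ('c, 'd::euclidean_space) chart set \<Rightarrow> ('c, 'd) metric_tensor \<Rightarrow> ('a \<Rightarrow> 'c) \<Rightarrow>
     'a \<Rightarrow> ('c, 'd) tvec" where
  "tension_field M h N g f p =
     (THE t. \<forall>e1\<in>tangent_space M p. \<forall>e2\<in>tangent_space M p.
        h p e1 e1 = 1 \<and> h p e2 e2 = 1 \<and> h p e1 e2 = 0 \<longrightarrow>
        t = nabla_differential M h N g f p e1 e1 + nabla_differential M h N g f p e2 e2)"

definition harmonic ::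
  "('a, real^2) chart set \<Rightarrow> ('a, real^2) metric_tensor \<Rightarrow>
   ('c, 'd::euclidean_space) chart set \<Rightarrow> ('c, 'd) metric_tensor \<Rightarrow> ('a \<Rightarrow> 'c) \<Rightarrow> bool" where
  "harmonic M h N g f \<longleftrightarrow> (\<forall>p\<in>carrier M. tension_field M h N g f p = 0)"


section \<open>Riemannian 7-manifolds with holonomy contained in G2\<close>

definition eps3 :: "7 \<Rightarrow> 7 \<Rightarrow> 7 \<Rightarrow> real^7 \<Rightarrow> real^7 \<Rightarrow> real^7 \<Rightarrow> real" where
  "eps3 i j k u v w =
     det (vector [vector [u$i, u$j, u$k], vector [v$i, v$j, v$k], vector [w$i, w$j, w$k]] :: real^3^3)"

definition phi0 :: "real^7 \<Rightarrow> real^7 \<Rightarrow> real^7 \<Rightarrow> real" where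
  "phi0 u v w = eps3 1 2 3 u v w + (eps3 1 4 5 u v w - eps3 1 6 7 u v w)
     + (eps3 2 4 6 u v w - eps3 2 7 5 u v w) + (eps3 3 4 7 u v w - eps3 3 5 6 u v w)"

type_synonym ('a, 'b) three_form =
  "'a \<Rightarrow> ('a, 'b) tvec \<Rightarrow> ('a, 'b) tvec \<Rightarrow> ('a, 'b) tvec \<Rightarrow> real"

definition form_coord ::
  "('a, 'b::euclidean_space) chart set \<Rightarrow> ('a, 'b) three_form \<Rightarrow> ('a, 'b) chart \<Rightarrow>
     'b \<Rightarrow> 'b \<Rightarrow> 'b \<Rightarrow> 'b \<Rightarrow> real" where
  "form_coord M \<phi> c y a b k =
     \<phi> (chart_inv c y) (tangent_of M c (chart_inv c y) a) (tangent_of M c (chart_inv c y) b)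
       (tangent_of M c (chart_inv c y) k)"

definition smooth_three_form ::
  "('a, 'b::euclidean_space) chart set \<Rightarrow> ('a, 'b) three_form \<Rightarrow> bool" where
  "smooth_three_form M \<phi> \<longleftrightarrow>
     (\<forall>c\<in>M. \<forall>y\<in>chart_image c. \<forall>a b. linear (form_coord M \<phi> c y a b)) \<and>
     (\<forall>c\<in>M. \<forall>y\<in>chart_image c. \<forall>a b k.
        form_coord M \<phi> c y a b k = - form_coord M \<phi> c y b a k \<and>
        form_coord M \<phi> c y a b k = - form_coord M \<phi> c y a k b) \<and>
     (\<forall>c\<in>M. \<forall>a b k. smooth_on (chart_image c) (\<lambda>y. form_coord M \<phi> c y a b k))"

definition parallel_three_form ::
  "('a, 'b::euclidean_space) chart set \<Rightarrow> ('a, 'b) metric_tensor \<Rightarrow> ('a, 'b) three_form \<Rightarrow> bool" where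
  "parallel_three_form M g \<phi> \<longleftrightarrow>
     (\<forall>c\<in>M. \<forall>y\<in>chart_image c. \<forall>x a b k.
        frechet_derivative (\<lambda>z. form_coord M \<phi> c z a b k) (at y) x
        - form_coord M \<phi> c y (levi_civita M g c y x a) b k
        - form_coord M \<phi> c y a (levi_civita M g c y x b) k
        - form_coord M \<phi> c y a b (levi_civita M g c y x k) = 0)"

definition frame_comb :: "(7 \<Rightarrow> ('a, real^7) tvec) \<Rightarrow> real^7 \<Rightarrow> ('a, real^7) tvec" where
  "frame_comb e u = (\<lambda>c. \<Sum>i\<in>UNIV. u$i *\<^sub>R e i c)"

definition adapted_frame ::
  "('a, real^7) chart set \<Rightarrow> ('a, real^7) three_form \<Rightarrow> 'a \<Rightarrow> (7 \<Rightarrow> ('a, real^7) tvec) \<Rightarrow> bool" where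
  "adapted_frame X \<phi> x e \<longleftrightarrow>
     bij_betw (frame_comb e) UNIV (tangent_space X x) \<and>
     (\<forall>u v w. \<phi> x (frame_comb e u) (frame_comb e v) (frame_comb e w) = phi0 u v w)"

definition g2_manifold ::
  "('a, real^7) chart set \<Rightarrow> ('a, real^7) three_form \<Rightarrow> ('a, real^7) metric_tensor \<Rightarrow> bool" where
  "g2_manifold X \<phi> g \<longleftrightarrow>
     smooth_manifold X \<and> smooth_three_form X \<phi> \<and> riemannian_metric X g \<and>
     (\<forall>x\<in>carrier X. \<exists>e. adapted_frame X \<phi> x e) \<and>
     (\<forall>x\<in>carrier X. \<forall>e. adapted_frame X \<phi> x e \<longrightarrow>
        (\<forall>i j. g x (e i) (e j) = (if i = j then 1 else 0))) \<and>
     parallel_three_form X g \<phi>"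

definition cross ::
  "('a, real^7) chart set \<Rightarrow> ('a, real^7) three_form \<Rightarrow> ('a, real^7) metric_tensor \<Rightarrow> 'a \<Rightarrow>
     ('a, real^7) tvec \<Rightarrow> ('a, real^7) tvec \<Rightarrow> ('a, real^7) tvec" where
  "cross X \<phi> g x v w =
     (THE z. z \<in> tangent_space X x \<and> (\<forall>u\<in>tangent_space X x. g x u z = \<phi> x u v w))"


section \<open>The unit sphere bundle and its distribution\<close>

type_synonym 'a tpoint = "'a \<times> ('a, real^7) tvec"
type_synonym 'a ttvec = "('a tpoint, (real^7) \<times> (real^7)) tvec"

definition Z7 :: "('a, real^7) chart set \<Rightarrow> ('a, real^7) metric_tensor \<Rightarrow> 'a tpoint set" where
  "Z7 X g = {(x, n). x \<in> carrier X \<and> n \<in> tangent_space X x \<and> g x n n = 1}"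

text \<open>The tangent spaces of \<^term>\<open>Z7 X g\<close> are taken inside those of the tangent bundle of \<^term>\<open>X\<close>.\<close>

definition TZ7 ::
  "('a, real^7) chart set \<Rightarrow> ('a, real^7) metric_tensor \<Rightarrow> 'a tpoint \<Rightarrow> 'a ttvec set" where
  "TZ7 X g z =
     {velocity (tangent_bundle X) \<zeta> 0 | \<zeta> e. e > 0 \<and>
        smooth_map (interval_manifold e) (tangent_bundle X) \<zeta> \<and>
        (\<forall>t\<in>{-e<..<e}. \<zeta> t \<in> Z7 X g) \<and> \<zeta> 0 = z}"

definition proj_push :: "('a, real^7) chart set \<Rightarrow> 'a tpoint \<Rightarrow> 'a ttvec \<Rightarrow> ('a, real^7) tvec" where
  "proj_push X z = differential (tangent_bundle X) X fst z"

definition vertical_space ::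
  "('a, real^7) chart set \<Rightarrow> ('a, real^7) metric_tensor \<Rightarrow> 'a tpoint \<Rightarrow> 'a ttvec set" where
  "vertical_space X g z = {\<xi> \<in> TZ7 X g z. proj_push X z \<xi> = 0}"

definition horizontal_space ::
  "('a, real^7) chart set \<Rightarrow> ('a, real^7) metric_tensor \<Rightarrow> 'a tpoint \<Rightarrow> 'a ttvec set" where
  "horizontal_space X g z =
     {velocity (tangent_bundle X) (\<lambda>t. (\<gamma> t, w t)) 0 | \<gamma> w e. e > 0 \<and>
        smooth_map (interval_manifold e) X \<gamma> \<and> parallel_along X g {-e<..<e} \<gamma> w \<and>
        (\<gamma> 0, w 0) = z}"

definition E_space ::
  "('a, real^7) chart set \<Rightarrow> ('a, real^7) metric_tensor \<Rightarrow> 'a tpoint \<Rightarrow> ('a, real^7) tvec set" where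
  "E_space X g z = {v \<in> tangent_space X (fst z). g (fst z) (snd z) v = 0}"

definition E_complex ::
  "('a, real^7) chart set \<Rightarrow> ('a, real^7) three_form \<Rightarrow> ('a, real^7) metric_tensor \<Rightarrow> 'a tpoint \<Rightarrow>
     ('a, real^7) tvec \<Rightarrow> ('a, real^7) tvec" where
  "E_complex X \<phi> g z v = cross X \<phi> g (fst z) (snd z) v"

definition distribution ::
  "('a, real^7) chart set \<Rightarrow> ('a, real^7) metric_tensor \<Rightarrow> 'a tpoint \<Rightarrow> 'a ttvec set" where
  "distribution X g z = {\<xi> \<in> TZ7 X g z. proj_push X z \<xi> \<in> E_space X g z}"

definition E_horizontal ::
  "('a, real^7) chart set \<Rightarrow> ('a, real^7) metric_tensor \<Rightarrow> 'a tpoint \<Rightarrow> 'a ttvec set" where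
  "E_horizontal X g z = distribution X g z \<inter> horizontal_space X g z"

text \<open>The identification of \<^term>\<open>E_space X g z\<close>, the tangent space at \<^term>\<open>snd z\<close> of the unit sphere
  in \<^term>\<open>tangent_space X (fst z)\<close>, with the vertical space.\<close>

definition vertical_lift ::
  "('a, real^7) chart set \<Rightarrow> 'a tpoint \<Rightarrow> ('a, real^7) tvec \<Rightarrow> 'a ttvec" where
  "vertical_lift X z u = velocity (tangent_bundle X) (\<lambda>t. (fst z, snd z + tv_scale t u)) 0"

definition distribution_complex ::
  "('a, real^7) chart set \<Rightarrow> ('a, real^7) three_form \<Rightarrow> ('a, real^7) metric_tensor \<Rightarrow> 'a tpoint \<Rightarrow>
     'a ttvec \<Rightarrow> 'a ttvec" where
  "distribution_complex X \<phi> g z \<xi> =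
     (THE \<zeta>. \<exists>u\<in>E_space X g z. \<exists>v\<in>vertical_space X g z. \<exists>v'\<in>vertical_space X g z.
        \<exists>a\<in>E_horizontal X g z. \<exists>a'\<in>E_horizontal X g z.
          \<xi> = v + a \<and> \<zeta> = v' + a' \<and>
          v = vertical_lift X z u \<and> v' = vertical_lift X z (E_complex X \<phi> g z u) \<and>
          proj_push X z a' = E_complex X \<phi> g z (proj_push X z a))"


section \<open>The Gauss lift\<close>

definition gauss_lift ::
  "('s, real^2) chart set \<Rightarrow> ('x, real^7) chart set \<Rightarrow> ('x, real^7) three_form \<Rightarrow>
     ('x, real^7) metric_tensor \<Rightarrow> ('s \<Rightarrow> 'x) \<Rightarrow> 's \<Rightarrow> 'x tpoint" where
  "gauss_lift S X \<phi> g f p =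
     (f p, THE n. \<exists>u v a b. positive_basis S p u v \<and>
        a = differential S X f p u \<and> b = differential S X f p v \<and>
        g (f p) a a = 1 \<and> g (f p) b b = 1 \<and> g (f p) a b = 0 \<and>
        n = cross X \<phi> g (f p) a b)"

definition holomorphic_into_distribution ::
  "('s, real^2) chart set \<Rightarrow> ('s, real^2) metric_tensor \<Rightarrow> ('x, real^7) chart set \<Rightarrow>
     ('x, real^7) three_form \<Rightarrow> ('x, real^7) metric_tensor \<Rightarrow> ('s \<Rightarrow> 'x tpoint) \<Rightarrow> bool" where
  "holomorphic_into_distribution S h X \<phi> g F \<longleftrightarrow>
     (\<forall>p\<in>carrier S. \<forall>v\<in>tangent_space S p.
        differential S (tangent_bundle X) F p v \<in> distribution X g (F p) \<and>
        differential S (tangent_bundle X) F p (rotate90 S h p v) =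
          distribution_complex X \<phi> g (F p) (differential S (tangent_bundle X) F p v))"

end

theory Submission
  imports Defs
begin

text \<open>
  Let \<open>\<eta> = e\<^sub>1 \<times> e\<^sub>2\<close> for an oriented orthonormal basis \<open>e\<^sub>1, e\<^sub>2\<close> of the image of a tangent plane of the
  surface. A tangent vector of the tangent bundle at \<open>(x, n)\<close> amounts to a pair of tangent vectors of \<open>X\<close>,
  its projection and its vertical part for the Levi-Civita connection, and in these terms
  the derivative of the Gauss lift in the direction \<open>v\<close> is the pair \<open>df v, \<nabla>\<^sub>v\<eta>\<close>
  (\<open>gauss_lift_derivative\<close>), while the complex structure of the distribution is \<open>\<eta> \<times>\<close> on
  both parts (\<open>distribution_complex_lift\<close>). So the lift is holomorphic if and only if both \<open>df\<close> and
  \<open>\<nabla>\<eta>\<close> intertwine the rotation \<open>j\<close> of the surface with \<open>\<eta> \<times>\<close>.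

  On the tangent plane, \<open>\<eta> \<times>\<close> is the rotation of the induced metric, since
  \<open>(e\<^sub>1 \<times> e\<^sub>2) \<times> e\<^sub>1 = e\<^sub>2\<close>. Rotations by \<open>90\<close> degrees agree for two metrics if and only if the metrics are
  proportional, so the condition on \<open>df\<close> is conformality (\<open>horizontal_complex_linear_iff\<close>).

  As \<open>\<phi>\<close> is parallel, \<open>\<nabla>\<^sub>v\<eta> = B(v, e\<^sub>1) \<times> e\<^sub>2 + e\<^sub>1 \<times> B(v, e\<^sub>2)\<close> up to multiples of \<open>\<eta>\<close>
  (\<open>gauss_derivative\<close>). By hypothesis \<open>B\<close> takes values in the complement of \<open>e\<^sub>1, e\<^sub>2, \<eta>\<close>, where
  \<open>I = e\<^sub>1 \<times>\<close> and \<open>J = e\<^sub>2 \<times>\<close> are anticommuting complex structures and \<open>\<eta> \<times>\<close> is \<open>-I J\<close>. Thus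
  \<open>\<nabla>\<^sub>v\<eta> = I B(v, e\<^sub>2) - J B(v, e\<^sub>1)\<close>, and for \<open>j e\<^sub>1 = e\<^sub>2\<close> the equation \<open>\<nabla>\<^bsub>j v\<^esub>\<eta> = \<eta> \<times> \<nabla>\<^sub>v\<eta>\<close> becomes
  \<open>B(e\<^sub>1, e\<^sub>1) + B(e\<^sub>2, e\<^sub>2) = 0\<close> (\<open>derivative_complex_linear_iff\<close>). For a conformal immersion this trace is
  the normal part of a positive multiple of the tension field, whose tangential part vanishes because
  the dimension of the surface is two (\<open>conformal_tension_normal\<close>). Hence the condition on \<open>\<nabla>\<eta>\<close> is harmonicity.

  The rest relates the coordinate-free notions to computations in charts. The key fact is the
  transformation law of the Christoffel symbols (\<open>levi_civita_transition\<close>), by which covariant derivatives are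
  tangent vectors. Horizontal vectors exist because parallel transport does, which is a linear
  differential equation (\<open>linear_ode_exists\<close>).
\<close>

section \<open>Calculus of smooth maps\<close>

lemma frechet_derivative_worksI:
  "f differentiable net \<Longrightarrow> (f has_derivative frechet_derivative f net) net"
  by (simp add: frechet_derivative_works)

lemma diff_order_on_subset:
  "diff_order_on k S f \<Longrightarrow> T \<subseteq> S \<Longrightarrow> diff_order_on k T f"
  by (induction k arbitrary: f) (auto intro: continuous_on_subset)

lemma frechet_derivative_cong_open:
  assumes "open S" "x \<in> S" "\<And>y. y \<in> S \<Longrightarrow> f y = g y"
  shows "frechet_derivative f (at x) = frechet_derivative g (at x)"
proof -
  have "(f has_derivative D) (at x) \<longleftrightarrow> (g has_derivative D) (at x)" for D
    using has_derivative_transform_within_open[OF _ assms(1,2), of f D UNIV g]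
      has_derivative_transform_within_open[OF _ assms(1,2), of g D UNIV f] assms(3) by auto
  then show ?thesis by (simp add: frechet_derivative_def)
qed

lemma differentiable_cong_open:
  assumes "open S" "x \<in> S" "\<And>y. y \<in> S \<Longrightarrow> f y = g y"
  shows "f differentiable (at x) \<longleftrightarrow> g differentiable (at x)"
  using has_derivative_transform_within_open[OF _ assms(1,2), of f _ UNIV g]
    has_derivative_transform_within_open[OF _ assms(1,2), of g _ UNIV f] assms(3)
  unfolding differentiable_def by metis

lemma diff_order_on_cong:
  assumes "open S" "\<And>x. x \<in> S \<Longrightarrow> f x = g x"
  shows "diff_order_on k S f \<longleftrightarrow> diff_order_on k S g"
  using assms(2)
proof (induction k arbitrary: f g)
  case 0
  then show ?case by (simp cong: continuous_on_cong)
next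
  case (Suc k)
  have "diff_order_on k S (\<lambda>x. frechet_derivative f (at x) v) \<longleftrightarrow>
        diff_order_on k S (\<lambda>x. frechet_derivative g (at x) v)" for v
    by (rule Suc.IH) (metis frechet_derivative_cong_open[OF assms(1)] Suc.prems)
  moreover have "f differentiable (at x) \<longleftrightarrow> g differentiable (at x)" if "x \<in> S" for x
    using differentiable_cong_open[OF assms(1) that] Suc.prems by blast
  ultimately show ?case by auto
qed

lemma diff_order_on_Suc_imp:
  "diff_order_on (Suc k) S f \<Longrightarrow> diff_order_on k S f"
proof (induction k arbitrary: f)
  case 0
  then show ?case
    by (auto intro!: continuous_at_imp_continuous_on differentiable_imp_continuous_within)
next
  case (Suc k)
  then show ?case by (metis diff_order_on.simps(2))
qed

lemma diff_order_on_const: "diff_order_on k S (\<lambda>x. c)"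
  by (induction k arbitrary: c) auto

lemma frechet_derivative_eqI: "(f has_derivative f') (at x) \<Longrightarrow> frechet_derivative f (at x) = f'"
  by (metis frechet_derivative_at)

lemma diff_order_on_SucI:
  assumes "open S" and D: "\<And>x. x \<in> S \<Longrightarrow> (f has_derivative f' x) (at x)"
    and "\<And>v. diff_order_on k S (\<lambda>x. f' x v)"
  shows "diff_order_on (Suc k) S f"
proof -
  have "diff_order_on k S (\<lambda>x. frechet_derivative f (at x) v)" for v
    using assms(3)[of v] diff_order_on_cong[OF assms(1), of "\<lambda>x. frechet_derivative f (at x) v"]
      frechet_derivative_eqI[OF D] by simp
  then show ?thesis using D by (auto simp: differentiable_def)
qed

lemma diff_order_on_linear:
  assumes "bounded_linear f"
  shows "diff_order_on k S f"
proof (cases k)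
  case 0
  then show ?thesis by (simp add: assms linear_continuous_on)
next
  case (Suc m)
  have *: "(f has_derivative f) (at x)" for x
    using assms by (rule bounded_linear_imp_has_derivative)
  show ?thesis
    unfolding Suc using * frechet_derivative_eqI[OF *]
    by (auto simp: diff_order_on_const differentiable_def)
qed

lemma diff_order_on_add:
  assumes "open S" "diff_order_on k S f" "diff_order_on k S g"
  shows "diff_order_on k S (\<lambda>x. f x + g x)"
  using assms(2,3)
proof (induction k arbitrary: f g)
  case 0
  then show ?case by (simp add: continuous_on_add)
next
  case (Suc k)
  have D: "((\<lambda>x. f x + g x) has_derivative
      (\<lambda>v. frechet_derivative f (at x) v + frechet_derivative g (at x) v)) (at x)" if "x \<in> S" for x
    using Suc.prems that by (auto intro!: has_derivative_add simp: frechet_derivative_worksI)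
  show ?case
    by (rule diff_order_on_SucI[OF assms(1) D]) (use Suc in auto)
qed

lemma diff_order_on_sum:
  assumes "open S" "finite I" "\<And>i. i \<in> I \<Longrightarrow> diff_order_on k S (f i)"
  shows "diff_order_on k S (\<lambda>x. \<Sum>i\<in>I. f i x)"
  using assms(2,3)
  by (induction I rule: finite_induct)
     (auto simp: diff_order_on_const intro!: diff_order_on_add assms(1))

lemma diff_order_on_bilinear:
  assumes "bounded_bilinear B" "open S" "diff_order_on k S f" "diff_order_on k S g"
  shows "diff_order_on k S (\<lambda>x. B (f x) (g x))"
  using assms(3,4)
proof (induction k arbitrary: f g)
  case 0
  then show ?case using bounded_bilinear.continuous_on[OF assms(1)] by simp
next
  case (Suc k)
  have D: "((\<lambda>x. B (f x) (g x)) has_derivative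
      (\<lambda>v. B (f x) (frechet_derivative g (at x) v) + B (frechet_derivative f (at x) v) (g x))) (at x)"
    if "x \<in> S" for x
    using Suc.prems that
    by (auto intro!: bounded_bilinear.FDERIV[OF assms(1)] simp: frechet_derivative_worksI)
  have "diff_order_on k S f" "diff_order_on k S g"
    using Suc.prems diff_order_on_Suc_imp by blast+
  then show ?case
    using Suc.prems
    by (intro diff_order_on_SucI[OF assms(2) D] diff_order_on_add Suc.IH assms(2)) auto
qed

text \<open>By the chain rule \<open>D(f \<circ> g)(x) v = \<Sum>\<^sub>b (D g(x) v \<bullet> b) D f(g x) b\<close>, a sum of products in which
  the order has dropped by one; this is where the domain of the outer map must be Euclidean.\<close>

lemma diff_order_on_compose:
  fixes f :: "'a::euclidean_space \<Rightarrow> 'b::real_normed_vector" and g :: "'c::real_normed_vector \<Rightarrow> 'a"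
  assumes "open S" "open T" "diff_order_on k T f" "diff_order_on k S g" "g ` S \<subseteq> T"
  shows "diff_order_on k S (\<lambda>x. f (g x))"
  using assms(3,4)
proof (induction k arbitrary: f)
  case 0
  then show ?case using assms(5) by (auto intro: continuous_on_compose2)
next
  case (Suc k)
  have g: "(g has_derivative frechet_derivative g (at x)) (at x)" if "x \<in> S" for x
    using Suc.prems that by (auto simp: frechet_derivative_worksI)
  have f: "(f has_derivative frechet_derivative f (at y)) (at y)" if "y \<in> T" for y
    using Suc.prems that by (auto simp: frechet_derivative_worksI)
  have lin: "linear (frechet_derivative f (at y))" if "y \<in> T" for y
    using f[OF that] has_derivative_linear by blast
  have D: "((\<lambda>x. f (g x)) has_derivative
      (\<lambda>v. frechet_derivative f (at (g x)) (frechet_derivative g (at x) v))) (at x)"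
    if "x \<in> S" for x
    using has_derivative_compose[OF g[OF that] f] assms(5) that by auto
  have "diff_order_on k S (\<lambda>x. frechet_derivative f (at (g x)) (frechet_derivative g (at x) v))" for v
  proof -
    have eq: "frechet_derivative f (at (g x)) (frechet_derivative g (at x) v) =
       (\<Sum>b\<in>Basis. (frechet_derivative g (at x) v \<bullet> b) *\<^sub>R frechet_derivative f (at (g x)) b)"
      if "x \<in> S" for x
    proof -
      have "frechet_derivative f (at (g x)) (frechet_derivative g (at x) v) =
        frechet_derivative f (at (g x)) (\<Sum>b\<in>Basis. (frechet_derivative g (at x) v \<bullet> b) *\<^sub>R b)"
        by (simp add: euclidean_representation)
      also have "\<dots> = (\<Sum>b\<in>Basis. (frechet_derivative g (at x) v \<bullet> b) *\<^sub>R frechet_derivative f (at (g x)) b)"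
        using lin[of "g x"] that assms(5)
        by (simp add: linear_sum linear_scale image_subset_iff)
      finally show ?thesis .
    qed
    have gk: "diff_order_on k S (\<lambda>x. frechet_derivative g (at x) v)" and gk': "diff_order_on k S g"
      using Suc.prems(2) diff_order_on_Suc_imp by auto
    have "diff_order_on k S (\<lambda>x. frechet_derivative g (at x) v \<bullet> b)" for b
      using diff_order_on_bilinear[OF bounded_bilinear_inner assms(1) gk diff_order_on_const] .
    moreover have "diff_order_on k S (\<lambda>x. frechet_derivative f (at (g x)) b)" for b
      using Suc.IH[of "\<lambda>y. frechet_derivative f (at y) b"] Suc.prems(1) gk' by auto
    ultimately have "diff_order_on k S (\<lambda>x. \<Sum>b\<in>Basis. (frechet_derivative g (at x) v \<bullet> b) *\<^sub>R frechet_derivative f (at (g x)) b)"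
      by (intro diff_order_on_sum assms(1) diff_order_on_bilinear[OF bounded_bilinear_scaleR]) auto
    then show ?thesis
      using diff_order_on_cong[OF assms(1) eq] by simp
  qed
  then show ?case by (intro diff_order_on_SucI[OF assms(1) D]) auto
qed

text \<open>The exponent varies in the induction, because differentiation lowers it.\<close>

lemma diff_order_on_powr: "diff_order_on k {0<..} (\<lambda>x::real. x powr r)"
proof (induction k arbitrary: r)
  case 0
  then show ?case by (auto intro!: continuous_intros)
next
  case (Suc k)
  have D: "((\<lambda>x. x powr r) has_derivative (\<lambda>v. v * (r * x powr (r - 1)))) (at x)"
    if "x \<in> {0<..}" for x :: real
    using has_real_derivative_powr[of x r] that
    by (simp add: has_field_derivative_def mult.commute[of _ "r * _"])
  show ?case
    by (intro diff_order_on_SucI[OF open_greaterThan D]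
        diff_order_on_bilinear[OF bounded_bilinear_mult] diff_order_on_const Suc.IH) auto
qed

lemma smooth_on_subset: "smooth_on S f \<Longrightarrow> T \<subseteq> S \<Longrightarrow> smooth_on T f"
  unfolding smooth_on_def using diff_order_on_subset by blast

lemma smooth_on_cong:
  "open S \<Longrightarrow> (\<And>x. x \<in> S \<Longrightarrow> f x = g x) \<Longrightarrow> smooth_on S f \<longleftrightarrow> smooth_on S g"
  unfolding smooth_on_def using diff_order_on_cong by metis

lemma smooth_on_const: "smooth_on S (\<lambda>x. c)"
  by (simp add: smooth_on_def diff_order_on_const)

lemma smooth_on_linear: "bounded_linear f \<Longrightarrow> smooth_on S f"
  by (simp add: smooth_on_def diff_order_on_linear)

lemma smooth_on_add:
  "open S \<Longrightarrow> smooth_on S f \<Longrightarrow> smooth_on S g \<Longrightarrow> smooth_on S (\<lambda>x. f x + g x)"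
  by (simp add: smooth_on_def diff_order_on_add)

lemma smooth_on_sum:
  "open S \<Longrightarrow> finite I \<Longrightarrow> (\<And>i. i \<in> I \<Longrightarrow> smooth_on S (f i)) \<Longrightarrow> smooth_on S (\<lambda>x. \<Sum>i\<in>I. f i x)"
  by (simp add: smooth_on_def diff_order_on_sum)

lemma smooth_on_bilinear:
  "bounded_bilinear B \<Longrightarrow> open S \<Longrightarrow> smooth_on S f \<Longrightarrow> smooth_on S g \<Longrightarrow>
   smooth_on S (\<lambda>x. B (f x) (g x))"
  by (simp add: smooth_on_def diff_order_on_bilinear)

lemma smooth_on_compose:
  fixes f :: "'a::euclidean_space \<Rightarrow> 'b::real_normed_vector"
  assumes "open S" "open T" "smooth_on T f" "smooth_on S g" "g ` S \<subseteq> T"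
  shows "smooth_on S (\<lambda>x. f (g x))"
  using assms diff_order_on_compose unfolding smooth_on_def by blast

lemma smooth_on_powr: "smooth_on {0<..} (\<lambda>x::real. x powr r)"
  by (simp add: smooth_on_def diff_order_on_powr)

lemma smooth_on_Pair:
  fixes f :: "'a::euclidean_space \<Rightarrow> 'b::real_normed_vector" and g :: "'a \<Rightarrow> 'c::real_normed_vector"
  assumes "open S" "smooth_on S f" "smooth_on S g"
  shows "smooth_on S (\<lambda>x. (f x, g x))"
proof -
  have "diff_order_on k S (\<lambda>x. (f x, g x))" if "diff_order_on k S f" "diff_order_on k S g" for k
    using that
  proof (induction k arbitrary: f g)
    case 0
    then show ?case by (simp add: continuous_on_Pair)
  next
    case (Suc k)
    have D: "((\<lambda>x. (f x, g x)) has_derivative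
        (\<lambda>v. (frechet_derivative f (at x) v, frechet_derivative g (at x) v))) (at x)" if "x \<in> S" for x
      using Suc.prems that by (auto intro!: has_derivative_Pair simp: frechet_derivative_worksI)
    show ?case
      by (rule diff_order_on_SucI[OF assms(1) D]) (use Suc in auto)
  qed
  then show ?thesis using assms by (simp add: smooth_on_def)
qed

lemma smooth_on_differentiable: "smooth_on S f \<Longrightarrow> x \<in> S \<Longrightarrow> f differentiable (at x)"
  unfolding smooth_on_def by (metis diff_order_on.simps(2))

lemma smooth_on_has_derivative:
  "smooth_on S f \<Longrightarrow> x \<in> S \<Longrightarrow> (f has_derivative frechet_derivative f (at x)) (at x)"
  using smooth_on_differentiable frechet_derivative_worksI by blast

lemma smooth_on_derivative:
  "smooth_on S f \<Longrightarrow> smooth_on S (\<lambda>x. frechet_derivative f (at x) v)"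
  unfolding smooth_on_def by (metis diff_order_on.simps(2))

lemma smooth_on_continuous_on: "smooth_on S f \<Longrightarrow> continuous_on S f"
  unfolding smooth_on_def by (metis diff_order_on.simps(1))

lemma smooth_on_linear_derivative:
  "smooth_on S f \<Longrightarrow> x \<in> S \<Longrightarrow> linear (frechet_derivative f (at x))"
  using smooth_on_has_derivative has_derivative_linear by blast

lemma bilinear_linear_left: "bilinear B \<Longrightarrow> linear (\<lambda>x. B x y)"
  and bilinear_linear_right: "bilinear B \<Longrightarrow> linear (B x)"
  by (simp_all add: bilinear_def)

text \<open>Expanding the vector in a basis reduces this to the product rule for scalar multiples. Fields of
  bilinear and trilinear forms are covered too, by moving arguments into the parameter one at a time.\<close>

lemma has_derivative_linear_family:
  fixes L :: "'p::real_normed_vector \<Rightarrow> 'a::euclidean_space \<Rightarrow> 'b::real_normed_vector"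
  assumes "open S" "Y p \<in> S" and lin: "\<And>y. y \<in> S \<Longrightarrow> linear (L y)"
    and L: "\<And>a. ((\<lambda>y. L y a) has_derivative L' a) (at (Y p))"
    and Y: "(Y has_derivative Y') (at p)" and s: "(s has_derivative s') (at p)"
  shows "((\<lambda>x. L (Y x) (s x)) has_derivative (\<lambda>v. L' (s p) (Y' v) + L (Y p) (s' v))) (at p)"
proof -
  have exp: "L y a = (\<Sum>b\<in>Basis. (a \<bullet> b) *\<^sub>R L y b)" if "y \<in> S" for y a
  proof -
    have "L y a = L y (\<Sum>b\<in>Basis. (a \<bullet> b) *\<^sub>R b)" by (simp add: euclidean_representation)
    then show ?thesis using lin[OF that] by (simp add: linear_sum linear_scale)
  qed
  have ev: "\<forall>\<^sub>F x in nhds p. Y x \<in> S"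
  proof -
    have "(Y \<longlongrightarrow> Y p) (nhds p)"
      using has_derivative_continuous[OF Y] by (simp add: isCont_def tendsto_at_iff_tendsto_nhds)
    then show ?thesis using assms(1,2) by (simp add: topological_tendstoD)
  qed
  obtain T where T: "open T" "p \<in> T" "\<And>x. x \<in> T \<Longrightarrow> Y x \<in> S"
    using ev unfolding eventually_nhds by blast
  have LY: "((\<lambda>x. L (Y x) b) has_derivative (\<lambda>v. L' b (Y' v))) (at p)" for b
    using has_derivative_compose[OF Y L] by simp
  have "((\<lambda>x. (s x \<bullet> b) *\<^sub>R L (Y x) b) has_derivative
     (\<lambda>v. (s p \<bullet> b) *\<^sub>R L' b (Y' v) + (s' v \<bullet> b) *\<^sub>R L (Y p) b)) (at p)" for b
    by (rule has_derivative_scaleR[OF has_derivative_inner_left[OF s] LY])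
  then have "((\<lambda>x. \<Sum>b\<in>Basis. (s x \<bullet> b) *\<^sub>R L (Y x) b) has_derivative
     (\<lambda>v. \<Sum>b\<in>Basis. (s p \<bullet> b) *\<^sub>R L' b (Y' v) + (s' v \<bullet> b) *\<^sub>R L (Y p) b)) (at p)"
    by (intro has_derivative_sum)
  then have 1: "((\<lambda>x. L (Y x) (s x)) has_derivative
     (\<lambda>v. \<Sum>b\<in>Basis. (s p \<bullet> b) *\<^sub>R L' b (Y' v) + (s' v \<bullet> b) *\<^sub>R L (Y p) b)) (at p)"
    by (rule has_derivative_transform_within_open[OF _ T(1,2)]) (rule exp[OF T(3), symmetric])
  have L'exp: "L' a = (\<lambda>w. \<Sum>b\<in>Basis. (a \<bullet> b) *\<^sub>R L' b w)" for a
  proof -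
    have "((\<lambda>y. \<Sum>b\<in>Basis. (a \<bullet> b) *\<^sub>R L y b) has_derivative (\<lambda>w. \<Sum>b\<in>Basis. (a \<bullet> b) *\<^sub>R L' b w)) (at (Y p))"
      by (intro has_derivative_sum has_derivative_scaleR_right L)
    then have "((\<lambda>y. L y a) has_derivative (\<lambda>w. \<Sum>b\<in>Basis. (a \<bullet> b) *\<^sub>R L' b w)) (at (Y p))"
      by (rule has_derivative_transform_within_open[OF _ assms(1,2)]) (metis exp)
    then show ?thesis using has_derivative_unique[OF L] by blast
  qed
  have "(\<Sum>b\<in>Basis. (s p \<bullet> b) *\<^sub>R L' b (Y' v) + (s' v \<bullet> b) *\<^sub>R L (Y p) b)
      = L' (s p) (Y' v) + L (Y p) (s' v)" for v
    by (simp add: sum.distrib exp[OF assms(2), of "s' v"] L'exp[of "s p"])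
  then show ?thesis using 1 by simp
qed

lemma has_derivative_bilinear_family:
  fixes B :: "'p::real_normed_vector \<Rightarrow> 'a::euclidean_space \<Rightarrow> 'a \<Rightarrow> 'b::real_normed_vector"
  assumes "open S" "Y p \<in> S" and lin: "\<And>y. y \<in> S \<Longrightarrow> bilinear (B y)"
    and B: "\<And>a b. ((\<lambda>y. B y a b) has_derivative B' a b) (at (Y p))"
    and Y: "(Y has_derivative Y') (at p)" and s: "(s has_derivative s') (at p)"
    and t: "(t has_derivative t') (at p)"
  shows "((\<lambda>x. B (Y x) (s x) (t x)) has_derivative
     (\<lambda>v. B' (s p) (t p) (Y' v) + B (Y p) (s' v) (t p) + B (Y p) (s p) (t' v))) (at p)"
proof -
  have 1: "((\<lambda>z. B (fst z) (snd z) b) has_derivative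
      (\<lambda>w. B' (s p) b (fst w) + B (Y p) (snd w) b)) (at (Y p, s p))" for b
    using has_derivative_linear_family[where L="\<lambda>y a. B y a b" and Y=fst and s=snd and p="(Y p, s p)"
        and L'="\<lambda>a. B' a b" and Y'=fst and s'=snd and S=S] assms(1,2) lin B
    by (auto intro: bilinear_linear_left has_derivative_fst[OF has_derivative_ident]
        has_derivative_snd[OF has_derivative_ident])
  have 2: "((\<lambda>x. (Y x, s x)) has_derivative (\<lambda>v. (Y' v, s' v))) (at p)"
    by (rule has_derivative_Pair[OF Y s])
  show ?thesis
    using has_derivative_linear_family[where L="\<lambda>z. B (fst z) (snd z)" and Y="\<lambda>x. (Y x, s x)"
        and p=p and s=t and S="S \<times> UNIV", OF _ _ _ 1 2 t] assms(1,2) lin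
    by (auto simp: open_Times bilinear_linear_right)
qed

lemma has_derivative_trilinear_family:
  fixes B :: "'p::real_normed_vector \<Rightarrow> 'a::euclidean_space \<Rightarrow> 'a \<Rightarrow> 'a \<Rightarrow> 'b::real_normed_vector"
  assumes "open S" "Y p \<in> S" and lin: "\<And>y b. y \<in> S \<Longrightarrow> bilinear (\<lambda>a. B y a b)" 
    "\<And>y a. y \<in> S \<Longrightarrow> bilinear (B y a)"
    and B: "\<And>a b k. ((\<lambda>y. B y a b k) has_derivative B' a b k) (at (Y p))"
    and Y: "(Y has_derivative Y') (at p)" and s: "(s has_derivative s') (at p)"
    and t: "(t has_derivative t') (at p)" and u: "(u has_derivative u') (at p)"
  shows "((\<lambda>x. B (Y x) (s x) (t x) (u x)) has_derivative
     (\<lambda>v. B' (s p) (t p) (u p) (Y' v) + B (Y p) (s' v) (t p) (u p)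
        + B (Y p) (s p) (t' v) (u p) + B (Y p) (s p) (t p) (u' v))) (at p)"
proof -
  have 1: "((\<lambda>z. B (fst z) (snd z) b k) has_derivative
      (\<lambda>w. B' (s p) b k (fst w) + B (Y p) (snd w) b k)) (at (Y p, s p))" for b k
    using has_derivative_linear_family[where L="\<lambda>y a. B y a b k" and Y=fst and s=snd and p="(Y p, s p)"
        and L'="\<lambda>a. B' a b k" and Y'=fst and s'=snd and S=S] assms(1,2) bilinear_linear_left[OF lin(1)] B
    by (auto intro: has_derivative_fst[OF has_derivative_ident]
        has_derivative_snd[OF has_derivative_ident])
  have 2: "((\<lambda>x. (Y x, s x)) has_derivative (\<lambda>v. (Y' v, s' v))) (at p)"
    by (rule has_derivative_Pair[OF Y s])
  show ?thesis
    using has_derivative_bilinear_family[where B="\<lambda>z. B (fst z) (snd z)" and Y="\<lambda>x. (Y x, s x)"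
        and p=p and S="S \<times> UNIV", OF _ _ _ 1 2 t u] assms(1,2) lin
    by (auto simp: open_Times)
qed

text \<open>The second difference \<open>f(x+ta+tb) - f(x+ta) - f(x+tb) + f(x)\<close> is symmetric in \<open>a\<close> and \<open>b\<close>,
  and the mean value theorem in the direction \<open>a\<close> shows that it is \<open>t\<^sup>2 D(Df a) b + o(t\<^sup>2)\<close>.\<close>

lemma second_difference:
  fixes f :: "'a::real_normed_vector \<Rightarrow> real"
  assumes S: "open S" "x \<in> S" and f: "\<And>y. y \<in> S \<Longrightarrow> (f has_derivative f' y) (at y)"
    and La: "((\<lambda>y. f' y a) has_derivative La) (at x)" and e: "e > 0"
  shows "\<exists>d>0. \<forall>t. 0 < t \<and> t < d \<longrightarrow>
     \<bar>f (x + t *\<^sub>R a + t *\<^sub>R b) - f (x + t *\<^sub>R a) - f (x + t *\<^sub>R b) + f x - t\<^sup>2 * La b\<bar> \<le> e * t\<^sup>2"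
proof -
  \<comment> \<open>\<open>t N\<close> bounds the displacement from \<open>x\<close>; the derivative is evaluated at two points.\<close>
  define N where "N = norm a + norm b + 1"
  have N: "N > 0" by (simp add: N_def add_nonneg_pos)
  define e' where "e' = e / (2 * N)"
  have e': "e' > 0" using e N by (simp add: e'_def)
  interpret La: bounded_linear La using La by (rule has_derivative_bounded_linear)
  obtain d1 where d1: "d1 > 0" "\<And>y. norm (y - x) < d1 \<Longrightarrow>
      \<bar>f' y a - f' x a - La (y - x)\<bar> \<le> e' * norm (y - x)"
    using La e' unfolding has_derivative_at_alt by (metis real_norm_def)
  obtain r where r: "r > 0" "ball x r \<subseteq> S" using S open_contains_ball by blast
  define d where "d = min d1 r / N"
  have d: "d > 0" using d1 r N by (simp add: d_def)
  have "\<bar>f (x + t *\<^sub>R a + t *\<^sub>R b) - f (x + t *\<^sub>R a) - f (x + t *\<^sub>R b) + f x - t\<^sup>2 * La b\<bar> \<le> e * t\<^sup>2"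
    if t: "0 < t" "t < d" for t
  proof -
    have tN: "t * N < d1" "t * N < r" using t N by (auto simp: d_def field_simps)
    have nb: "norm (s *\<^sub>R a + u *\<^sub>R b) \<le> t * N" if "0 \<le> s" "s \<le> t" "0 \<le> u" "u \<le> t" for s u
    proof -
      have "norm (s *\<^sub>R a + u *\<^sub>R b) \<le> s * norm a + u * norm b"
        using norm_triangle_ineq[of "s *\<^sub>R a" "u *\<^sub>R b"] that by simp
      also have "\<dots> \<le> t * norm a + t * norm b"
        using that by (intro add_mono mult_right_mono) auto
      also have "\<dots> \<le> t * N" using t by (simp add: N_def algebra_simps)
      finally show ?thesis .
    qed
    have inS: "x + s *\<^sub>R a + u *\<^sub>R b \<in> S" if "0 \<le> s" "s \<le> t" "0 \<le> u" "u \<le> t" for s u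
      using nb[OF that] tN r(2) norm_minus_cancel[of "s *\<^sub>R a + u *\<^sub>R b"] by (auto simp: dist_norm subset_iff algebra_simps norm_minus_commute)
    define q where "q s = f (x + s *\<^sub>R a + t *\<^sub>R b) - f (x + s *\<^sub>R a)" for s
    have D1: "((\<lambda>s. f (x + s *\<^sub>R a + u *\<^sub>R b)) has_real_derivative f' (x + s *\<^sub>R a + u *\<^sub>R b) a) (at s)"
      if "0 \<le> s" "s \<le> t" "0 \<le> u" "u \<le> t" for s u
    proof -
      have lin: "linear (f' (x + s *\<^sub>R a + u *\<^sub>R b))" using f[OF inS[OF that]] has_derivative_linear by blast
      have "((\<lambda>s. x + s *\<^sub>R a + u *\<^sub>R b) has_derivative (\<lambda>v. v *\<^sub>R a)) (at s)"
        by (auto intro!: derivative_eq_intros)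
      from has_derivative_compose[OF this f[OF inS[OF that]]]
      have "((\<lambda>s. f (x + s *\<^sub>R a + u *\<^sub>R b)) has_derivative
            (\<lambda>v. f' (x + s *\<^sub>R a + u *\<^sub>R b) (v *\<^sub>R a))) (at s)" .
      then show ?thesis unfolding has_field_derivative_def
        by (rule has_derivative_eq_rhs) (simp add: linear_scale[OF lin] mult.commute fun_eq_iff)
    qed
    have Dq: "(q has_real_derivative f' (x + s *\<^sub>R a + t *\<^sub>R b) a - f' (x + s *\<^sub>R a) a) (at s)"
      if "0 \<le> s" "s \<le> t" for s
      unfolding q_def using D1[of s t] D1[of s 0] that t by (auto intro!: DERIV_diff)
    obtain s where s: "0 < s" "s < t"
      "q t - q 0 = (t - 0) * (f' (x + s *\<^sub>R a + t *\<^sub>R b) a - f' (x + s *\<^sub>R a) a)"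
      using MVT2[of 0 t q "\<lambda>s. f' (x + s *\<^sub>R a + t *\<^sub>R b) a - f' (x + s *\<^sub>R a) a"] t Dq by auto
    have E: "\<bar>f' (x + s *\<^sub>R a + u *\<^sub>R b) a - f' x a - La (s *\<^sub>R a + u *\<^sub>R b)\<bar> \<le> e' * (t * N)"
      if "0 \<le> u" "u \<le> t" for u
    proof -
      have *: "norm (s *\<^sub>R a + u *\<^sub>R b) \<le> t * N" using nb s that by auto
      have "\<bar>f' (x + s *\<^sub>R a + u *\<^sub>R b) a - f' x a - La (s *\<^sub>R a + u *\<^sub>R b)\<bar> \<le> e' * norm (s *\<^sub>R a + u *\<^sub>R b)"
        using d1(2)[of "x + s *\<^sub>R a + u *\<^sub>R b"] * tN by (simp add: add.assoc)
      also have "\<dots> \<le> e' * (t * N)" using * e' by (intro mult_left_mono) auto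
      finally show ?thesis .
    qed
    have eq: "f (x + t *\<^sub>R a + t *\<^sub>R b) - f (x + t *\<^sub>R a) - f (x + t *\<^sub>R b) + f x - t\<^sup>2 * La b
       = t * ((f' (x + s *\<^sub>R a + t *\<^sub>R b) a - f' x a - La (s *\<^sub>R a + t *\<^sub>R b))
            - (f' (x + s *\<^sub>R a + 0 *\<^sub>R b) a - f' x a - La (s *\<^sub>R a + 0 *\<^sub>R b)))"
      using s(3) by (simp add: q_def La.add La.scaleR algebra_simps power2_eq_square)
    have "\<bar>(f' (x + s *\<^sub>R a + t *\<^sub>R b) a - f' x a - La (s *\<^sub>R a + t *\<^sub>R b))
            - (f' (x + s *\<^sub>R a + 0 *\<^sub>R b) a - f' x a - La (s *\<^sub>R a + 0 *\<^sub>R b))\<bar> \<le> 2 * (e' * (t * N))"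
      using E[of t] E[of 0] t by linarith
    then have "\<bar>f (x + t *\<^sub>R a + t *\<^sub>R b) - f (x + t *\<^sub>R a) - f (x + t *\<^sub>R b) + f x - t\<^sup>2 * La b\<bar>
        \<le> t * (2 * (e' * (t * N)))"
      unfolding eq abs_mult using t by (simp add: mult_left_mono)
    also have "\<dots> = e * t\<^sup>2" using N by (simp add: e'_def power2_eq_square)
    finally show ?thesis .
  qed
  then show ?thesis using d by blast
qed

lemma second_derivative_symmetric_real:
  fixes f :: "'a::real_normed_vector \<Rightarrow> real"
  assumes S: "open S" "x \<in> S" and f: "\<And>y. y \<in> S \<Longrightarrow> (f has_derivative f' y) (at y)"
    and La: "((\<lambda>y. f' y a) has_derivative La) (at x)" and Lb: "((\<lambda>y. f' y b) has_derivative Lb) (at x)"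
  shows "La b = Lb a"
proof (rule ccontr)
  assume "La b \<noteq> Lb a"
  define e where "e = \<bar>La b - Lb a\<bar> / 3"
  have e: "e > 0" using \<open>La b \<noteq> Lb a\<close> by (simp add: e_def)
  obtain d1 where d1: "d1 > 0" "\<And>t. 0 < t \<Longrightarrow> t < d1 \<Longrightarrow>
     \<bar>f (x + t *\<^sub>R a + t *\<^sub>R b) - f (x + t *\<^sub>R a) - f (x + t *\<^sub>R b) + f x - t\<^sup>2 * La b\<bar> \<le> e * t\<^sup>2"
    using second_difference[OF S f La e, of b] by blast
  obtain d2 where d2: "d2 > 0" "\<And>t. 0 < t \<Longrightarrow> t < d2 \<Longrightarrow>
     \<bar>f (x + t *\<^sub>R b + t *\<^sub>R a) - f (x + t *\<^sub>R b) - f (x + t *\<^sub>R a) + f x - t\<^sup>2 * Lb a\<bar> \<le> e * t\<^sup>2"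
    using second_difference[OF S f Lb e, of a] by blast
  define t where "t = min d1 d2 / 2"
  have t: "0 < t" "t < d1" "t < d2" using d1(1) d2(1) by (auto simp: t_def)
  have sw: "x + t *\<^sub>R b + t *\<^sub>R a = x + t *\<^sub>R a + t *\<^sub>R b" by (simp add: algebra_simps)
  have "\<bar>t\<^sup>2 * La b - t\<^sup>2 * Lb a\<bar> \<le> 2 * (e * t\<^sup>2)"
    using d1(2)[OF t(1,2)] d2(2)[OF t(1,3)] unfolding sw by linarith
  moreover have "\<bar>t\<^sup>2 * La b - t\<^sup>2 * Lb a\<bar> = t\<^sup>2 * \<bar>La b - Lb a\<bar>"
    by (simp add: abs_mult flip: right_diff_distrib)
  ultimately have "t\<^sup>2 * \<bar>La b - Lb a\<bar> \<le> t\<^sup>2 * (2 * e)" by (simp add: mult_ac)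
  then have "\<bar>La b - Lb a\<bar> \<le> 2 * e" using t(1) by simp
  then show False using e by (simp add: e_def)
qed

lemma second_derivative_symmetric:
  fixes f :: "'a::real_normed_vector \<Rightarrow> 'b::euclidean_space"
  assumes "open S" "smooth_on S f" "x \<in> S"
  shows "frechet_derivative (\<lambda>y. frechet_derivative f (at y) a) (at x) b
       = frechet_derivative (\<lambda>y. frechet_derivative f (at y) b) (at x) a"
proof (rule euclidean_eqI)
  fix i :: 'b assume "i \<in> Basis"
  have f: "((\<lambda>z. f z \<bullet> i) has_derivative (\<lambda>v. frechet_derivative f (at y) v \<bullet> i)) (at y)" if "y \<in> S" for y
    using smooth_on_has_derivative[OF assms(2) that] by (auto intro!: derivative_eq_intros)
  have "((\<lambda>y. frechet_derivative f (at y) a \<bullet> i) has_derivative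
      (\<lambda>v. frechet_derivative (\<lambda>y. frechet_derivative f (at y) a) (at x) v \<bullet> i)) (at x)" for a
    using smooth_on_has_derivative[OF smooth_on_derivative[OF assms(2)] assms(3)]
    by (auto intro!: derivative_eq_intros)
  then show "frechet_derivative (\<lambda>y. frechet_derivative f (at y) a) (at x) b \<bullet> i
       = frechet_derivative (\<lambda>y. frechet_derivative f (at y) b) (at x) a \<bullet> i"
    using second_derivative_symmetric_real[OF assms(1,3) f] by blast
qed

section \<open>Linear algebra of positive definite forms\<close>

definition inner_form :: "('b::real_vector \<Rightarrow> 'b \<Rightarrow> real) \<Rightarrow> bool" where
  "inner_form G \<longleftrightarrow> bilinear G \<and> (\<forall>a b. G a b = G b a) \<and> (\<forall>a. a \<noteq> 0 \<longrightarrow> G a a > 0)"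

lemma inner_form_nondegenerate:
  assumes "inner_form G" "\<And>k. G z k = G z' k"
  shows "z = z'"
proof -
  have "G (z - z') k = 0" for k
    using assms(2)[of k] bilinear_lsub[of G z z' k] assms(1) by (simp add: inner_form_def)
  from this[of "z - z'"] show ?thesis
    using assms(1) unfolding inner_form_def by (metis eq_iff_diff_eq_0 less_irrefl)
qed

lemma inner_form_represent:
  fixes G :: "'b::euclidean_space \<Rightarrow> 'b \<Rightarrow> real"
  assumes G: "inner_form G" and l: "linear l"
  shows "\<exists>z. \<forall>k. G z k = l k"
proof -
  define M where "M z = (\<Sum>b\<in>Basis. G z b *\<^sub>R b)" for z
  have B: "bilinear G" using G by (simp add: inner_form_def)
  have ex: "G z k = M z \<bullet> k" for z k
  proof -
    have "G z k = G z (\<Sum>b\<in>Basis. (k \<bullet> b) *\<^sub>R b)" by (simp add: euclidean_representation)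
    also have "\<dots> = (\<Sum>b\<in>Basis. (k \<bullet> b) * G z b)"
      using bilinear_linear_right[OF B] by (simp add: linear_sum linear_scale)
    finally show ?thesis by (simp add: M_def inner_sum_left inner_commute[of k] mult.commute)
  qed
  have "linear M"
    unfolding M_def using B
    by (intro linearI) (simp_all add: bilinear_ladd bilinear_lmul scaleR_add_left sum.distrib scaleR_sum_right)
  moreover have "inj M"
    by (rule injI) (metis inner_form_nondegenerate[OF G] ex)
  ultimately have "surj M" using linear_injective_imp_surjective by blast
  then obtain z where Mz: "M z = (\<Sum>b\<in>Basis. l b *\<^sub>R b)" by (metis surjD)
  then have "G z k = l k" for k
  proof -
    have "l k = l (\<Sum>b\<in>Basis. (k \<bullet> b) *\<^sub>R b)" by (simp add: euclidean_representation)
    also have "\<dots> = (\<Sum>b\<in>Basis. (k \<bullet> b) * l b)" using l by (simp add: linear_sum linear_scale)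
    finally show ?thesis using ex[of z k] Mz
      by (simp add: inner_sum_left inner_commute[of k] mult.commute)
  qed
  then show ?thesis by blast
qed

text \<open>The Koszul formula, for a metric \<open>G\<close> whose derivative in the direction \<open>a\<close> is \<open>D a\<close>.\<close>

lemma koszul_formula:
  assumes G: "inner_form G" and sym: "\<And>a b. \<Gamma> a b = \<Gamma> b a"
    and comp: "\<And>a b k. D a b k = G (\<Gamma> a b) k + G b (\<Gamma> a k)"
  shows "2 * G (\<Gamma> a b) k = D a b k + D b a k - D k a b"
proof -
  have "G u v = G v u" for u v using G by (simp add: inner_form_def)
  then show ?thesis using sym by (simp add: comp)
qed

lemma koszul_exists:
  fixes G :: "'b::euclidean_space \<Rightarrow> 'b \<Rightarrow> real"
  assumes G: "inner_form G" and lin: "\<And>b k. linear (\<lambda>a. D a b k)" "\<And>a. bilinear (D a)"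
    and sym: "\<And>a b k. D a b k = D a k b"
  shows "\<exists>!\<Gamma>. bilinear \<Gamma> \<and> (\<forall>a b. \<Gamma> a b = \<Gamma> b a) \<and>
            (\<forall>a b k. D a b k = G (\<Gamma> a b) k + G b (\<Gamma> a k))"
proof (rule ex_ex1I)
  have lin2: "linear (\<lambda>b. D a b k)" "linear (D a b)" for a b k
    using lin(2) by (auto simp: bilinear_def)
  have B: "bilinear G" and Gs: "\<And>a b. G a b = G b a" using G by (auto simp: inner_form_def)
  have "linear (\<lambda>k. (D a b k + D b a k - D k a b) / 2)" for a b
    by (intro linearI)
       (simp_all add: linear_add[OF lin2(2)] linear_scale[OF lin2(2)]
         linear_add[OF lin(1)] linear_scale[OF lin(1)] field_simps)
  then have "\<exists>z. \<forall>k. G z k = (D a b k + D b a k - D k a b) / 2" for a b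
    by (rule inner_form_represent[OF G])
  then obtain \<Gamma> where \<Gamma>: "\<And>a b k. G (\<Gamma> a b) k = (D a b k + D b a k - D k a b) / 2" by metis
  have s: "\<Gamma> a b = \<Gamma> b a" for a b
    by (rule inner_form_nondegenerate[OF G]) (simp add: \<Gamma> sym[of _ a b])
  have "\<Gamma> a (b + b') = \<Gamma> a b + \<Gamma> a b'" for a b b'
    by (rule inner_form_nondegenerate[OF G])
       (simp add: bilinear_ladd[OF B] \<Gamma> linear_add[OF lin(1)] linear_add[OF lin2(1)]
          linear_add[OF lin2(2)] add_divide_distrib diff_divide_distrib)
  moreover have "\<Gamma> a (r *\<^sub>R b) = r *\<^sub>R \<Gamma> a b" for a b r
    by (rule inner_form_nondegenerate[OF G])
       (simp add: bilinear_lmul[OF B] \<Gamma> linear_scale[OF lin(1)] linear_scale[OF lin2(1)]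
          linear_scale[OF lin2(2)] algebra_simps)
  ultimately have "linear (\<Gamma> a)" for a by (intro linearI)
  moreover from this have "linear (\<lambda>a. \<Gamma> a b)" for b by (simp add: s[of _ b])
  ultimately have "bilinear \<Gamma>" by (simp add: bilinear_def)
  moreover have "D a b k = G (\<Gamma> a b) k + G b (\<Gamma> a k)" for a b k
    using Gs[of b "\<Gamma> a k"] by (simp add: \<Gamma> sym[of a k b] field_simps)
  ultimately show "\<exists>\<Gamma>. bilinear \<Gamma> \<and> (\<forall>a b. \<Gamma> a b = \<Gamma> b a) \<and>
            (\<forall>a b k. D a b k = G (\<Gamma> a b) k + G b (\<Gamma> a k))" using s by blast
next
  fix \<Gamma> \<Delta>
  assume "bilinear \<Gamma> \<and> (\<forall>a b. \<Gamma> a b = \<Gamma> b a) \<and> (\<forall>a b k. D a b k = G (\<Gamma> a b) k + G b (\<Gamma> a k))"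
    and "bilinear \<Delta> \<and> (\<forall>a b. \<Delta> a b = \<Delta> b a) \<and> (\<forall>a b k. D a b k = G (\<Delta> a b) k + G b (\<Delta> a k))"
  then have "2 * G (\<Gamma> a b) k = 2 * G (\<Delta> a b) k" for a b k
    by (subst (1 2) koszul_formula[OF G, where D=D]) auto
  then show "\<Gamma> = \<Delta>" by (intro ext inner_form_nondegenerate[OF G]) simp
qed

text \<open>By Cramer's rule a vector depends continuously, and differentiably, on its products with
  the basis vectors and on the coefficients of the form. This is how regularity of the Christoffel
  symbols and of cross products is obtained.\<close>

lemma inner_form_cramer:
  fixes G :: "real^'n \<Rightarrow> real^'n \<Rightarrow> real"
  assumes G: "inner_form G"
  defines "A \<equiv> (\<chi> i j. G (axis j 1) (axis i 1)) :: real^'n^'n"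
  shows "det A \<noteq> 0"
    and "z $ k = det (\<chi> i j. if j = k then G z (axis i 1) else A$i$j) / det A"
proof -
  have B: "bilinear G" using G by (simp add: inner_form_def)
  have mv: "A *v x = (\<chi> i. G x (axis i 1))" for x
  proof -
    have "G x k = (\<Sum>j\<in>UNIV. G (axis j 1) k * x $ j)" for k
    proof -
      have "G x k = G (\<Sum>j\<in>UNIV. x $ j *\<^sub>R axis j 1) k"
        using basis_expansion[of x] by (simp add: scalar_mult_eq_scaleR)
      also have "\<dots> = (\<Sum>j\<in>UNIV. G (axis j 1) k * x $ j)"
        by (simp add: linear_sum[OF bilinear_linear_left[OF B]] bilinear_lmul[OF B] mult.commute)
      finally show ?thesis .
    qed
    then show ?thesis by (simp add: A_def matrix_vector_mult_def)
  qed
  have "x = 0" if "A *v x = 0" for x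
  proof -
    have i: "G x (axis i 1) = 0" for i using that unfolding mv by (metis vec_lambda_beta zero_index)
    have "G x k = 0" for k
    proof -
      have "G x k = G x (\<Sum>j\<in>UNIV. k $ j *\<^sub>R axis j 1)"
        using basis_expansion[of k] by (simp add: scalar_mult_eq_scaleR)
      also have "\<dots> = 0"
        by (simp add: linear_sum[OF bilinear_linear_right[OF B]] bilinear_rmul[OF B] i)
      finally show ?thesis .
    qed
    then show ?thesis using G unfolding inner_form_def by force
  qed
  then show d: "det A \<noteq> 0"
    by (metis invertible_det_nz invertible_left_inverse matrix_left_invertible_ker)
  show "z $ k = det (\<chi> i j. if j = k then G z (axis i 1) else A$i$j) / det A"
  proof -
    have "z = (\<chi> k. det (\<chi> i j. if j = k then (A *v z)$i else A$i$j) / det A)"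
      using cramer[OF d, of z "A *v z"] by simp
    then have "z $ k = (\<chi> k. det (\<chi> i j. if j = k then (A *v z)$i else A$i$j) / det A) $ k"
      by (rule arg_cong)
    moreover have "(A *v z)$i = G z (axis i 1)" for i by (simp only: mv vec_lambda_beta)
    ultimately show ?thesis by (simp only: vec_lambda_beta)
  qed
qed

lemma isCont_det:
  fixes A :: "'t::t2_space \<Rightarrow> real^'n^'n"
  shows "(\<And>i j. isCont (\<lambda>y. A y $ i $ j) x) \<Longrightarrow> isCont (\<lambda>y. det (A y)) x"
  unfolding det_def
  by (rule continuous_sum, rule continuous_mult, rule continuous_const, rule continuous_prod) simp

lemma differentiable_prod_real:
  fixes f :: "'i \<Rightarrow> 't::real_normed_vector \<Rightarrow> real"
  shows "finite I \<Longrightarrow> (\<And>i. i \<in> I \<Longrightarrow> f i differentiable (at x)) \<Longrightarrow> (\<lambda>y. \<Prod>i\<in>I. f i y) differentiable (at x)"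
  by (induction I rule: finite_induct) auto

lemma differentiable_det:
  fixes A :: "'t::real_normed_vector \<Rightarrow> real^'n^'n"
  shows "(\<And>i j. (\<lambda>y. A y $ i $ j) differentiable (at x)) \<Longrightarrow> (\<lambda>y. det (A y)) differentiable (at x)"
  unfolding det_def
  by (rule differentiable_sum[OF finite_permutations[OF finite]], rule ballI, rule differentiable_mult,
      rule differentiable_const, rule differentiable_prod_real[OF finite]) simp

lemma isCont_represented:
  fixes G :: "'t::t2_space \<Rightarrow> real^'n \<Rightarrow> real^'n \<Rightarrow> real"
  assumes U: "open U" "x \<in> U" "\<And>y. y \<in> U \<Longrightarrow> inner_form (G y)"
    and G: "\<And>a b. isCont (\<lambda>y. G y a b) x" and z: "\<And>k. isCont (\<lambda>y. G y (z y) k) x"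
  shows "isCont z x"
proof -
  define A where "A y = (\<chi> i j. G y (axis j 1) (axis i 1))" for y
  have "isCont (\<lambda>y. z y $ k) x" for k
  proof -
    have 1: "isCont (\<lambda>y. det (\<chi> i j. if j = k then G y (z y) (axis i 1) else A y $i$j) / det (A y)) x"
    proof (intro isCont_divide isCont_det)
      fix i j
      show "isCont (\<lambda>y. (\<chi> i j. if j = k then G y (z y) (axis i 1) else A y $ i $ j) $ i $ j) x"
        using G z by (cases "j = k") (auto simp: A_def)
    qed (use inner_form_cramer(1)[OF U(3)[OF U(2)]] G in \<open>auto simp: A_def\<close>)
    have "\<forall>\<^sub>F y in nhds x. z y $ k = det (\<chi> i j. if j = k then G y (z y) (axis i 1) else A y $i$j) / det (A y)"
      unfolding eventually_nhds A_def using U inner_form_cramer(2) by blast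
    from isCont_cong[OF this] 1 show ?thesis by simp
  qed
  then show ?thesis by (simp add: continuous_at vec_tendstoI)
qed

lemma differentiable_represented:
  fixes G :: "'t::real_normed_vector \<Rightarrow> real^'n \<Rightarrow> real^'n \<Rightarrow> real"
  assumes U: "open U" "x \<in> U" "\<And>y. y \<in> U \<Longrightarrow> inner_form (G y)"
    and G: "\<And>a b. (\<lambda>y. G y a b) differentiable (at x)"
    and z: "\<And>k. (\<lambda>y. G y (z y) k) differentiable (at x)"
  shows "z differentiable (at x)"
proof -
  define A where "A y = (\<chi> i j. G y (axis j 1) (axis i 1))" for y
  have "(\<lambda>y. z y $ k) differentiable (at x)" for k
  proof -
    have 1: "(\<lambda>y. det (\<chi> i j. if j = k then G y (z y) (axis i 1) else A y $i$j) / det (A y)) differentiable (at x)"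
    proof (intro differentiable_divide differentiable_det)
      fix i j
      show "(\<lambda>y. (\<chi> i j. if j = k then G y (z y) (axis i 1) else A y $ i $ j) $ i $ j) differentiable at x"
        using G z by (cases "j = k") (auto simp: A_def)
    qed (use inner_form_cramer(1)[OF U(3)[OF U(2)]] G in \<open>auto simp: A_def\<close>)
    then show ?thesis
      using differentiable_cong_open[OF U(1,2), of "\<lambda>y. z y $ k"
         "\<lambda>y. det (\<chi> i j. if j = k then G y (z y) (axis i 1) else A y $i$j) / det (A y)"]
        inner_form_cramer(2)[OF U(3)] unfolding A_def by simp
  qed
  then have "\<exists>D. ((\<lambda>y. z y $ k) has_derivative D) (at x)" for k by (simp add: differentiable_def)
  then obtain D where D: "\<And>k. ((\<lambda>y. z y $ k) has_derivative D k) (at x)" by metis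
  have "(z has_derivative (\<lambda>v. \<chi> k. D k v)) (at x)"
    unfolding has_derivative_componentwise_within[of z]
  proof
    fix b :: "real^'n" assume "b \<in> Basis"
    then obtain k where "b = axis k 1" by (auto simp: Basis_vec_def)
    then show "((\<lambda>y. z y \<bullet> b) has_derivative (\<lambda>v. (\<chi> k. D k v) \<bullet> b)) (at x)"
      using D[of k] by (simp add: inner_axis)
  qed
  then show ?thesis by (auto simp: differentiable_def)
qed

section \<open>Charts, tangent vectors and differentials\<close>

text \<open>Compatibility of charts, stated separately from the topological conditions on a manifold so that
  it also covers the interval on which a curve is defined.\<close>

definition smooth_atlas :: "('a, 'b::euclidean_space) chart set \<Rightarrow> bool" where
  "smooth_atlas M \<longleftrightarrow>
     (\<forall>c\<in>M. inj_on (snd c) (fst c) \<and> open (chart_image c)) \<and>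
     (\<forall>c\<in>M. \<forall>d\<in>M. open (snd c ` (fst c \<inter> fst d)) \<and>
        smooth_on (snd c ` (fst c \<inter> fst d)) (snd d \<circ> chart_inv c))"

abbreviation in_charts :: "('a, 'b) chart \<Rightarrow> ('c, 'd) chart \<Rightarrow> ('a \<Rightarrow> 'c) \<Rightarrow> 'b \<Rightarrow> 'd" where
  "in_charts c d f \<equiv> snd d \<circ> f \<circ> chart_inv c"

abbreviation transition_jacobian ::
  "('a, 'b::euclidean_space) chart \<Rightarrow> ('a, 'b) chart \<Rightarrow> 'b \<Rightarrow> 'b \<Rightarrow> 'b" where
  "transition_jacobian c d y \<equiv> frechet_derivative (snd d \<circ> chart_inv c) (at y)"

lemma smooth_manifold_atlas: "smooth_manifold M \<Longrightarrow> smooth_atlas M"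
  by (simp add: smooth_manifold_def smooth_atlas_def)

lemma smooth_atlas_interval: "smooth_atlas (interval_manifold e)"
proof -
  have inv: "inv_into {-e<..<e} (\<lambda>t. t) y = y" if "y \<in> {-e<..<e}" for y :: real
    using inv_into_f_f[of "\<lambda>t. t" "{-e<..<e}" y] that by (simp add: inj_on_def)
  have "smooth_on {-e<..<e} ((\<lambda>t. t) \<circ> inv_into {-e<..<e} (\<lambda>t. t))"
    using smooth_on_cong[of "{-e<..<e}" "(\<lambda>t. t) \<circ> inv_into {-e<..<e} (\<lambda>t. t)" "\<lambda>t. t"]
      smooth_on_linear[OF bounded_linear_ident] inv by simp
  then show ?thesis
    by (simp add: smooth_atlas_def interval_manifold_def chart_image_def chart_inv_def)
qed

context
  fixes M :: "('a, 'b::euclidean_space) chart set"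
  assumes M: "smooth_atlas M"
begin

lemma chart_inv_chart: "c \<in> M \<Longrightarrow> p \<in> fst c \<Longrightarrow> chart_inv c (snd c p) = p"
  using M by (auto simp: smooth_atlas_def chart_inv_def)

lemma open_chart_image: "c \<in> M \<Longrightarrow> open (chart_image c)"
  using M by (auto simp: smooth_atlas_def)

lemma open_overlap: "c \<in> M \<Longrightarrow> d \<in> M \<Longrightarrow> open (snd c ` (fst c \<inter> fst d))"
  using M by (auto simp: smooth_atlas_def)

lemma smooth_transition:
  "c \<in> M \<Longrightarrow> d \<in> M \<Longrightarrow> smooth_on (snd c ` (fst c \<inter> fst d)) (snd d \<circ> chart_inv c)"
  using M by (auto simp: smooth_atlas_def)

end

lemma chart_image_mem: "p \<in> fst c \<Longrightarrow> snd c p \<in> chart_image c"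
  by (simp add: chart_image_def)

lemma chart_inv_mem: "y \<in> chart_image c \<Longrightarrow> chart_inv c y \<in> fst c"
  and chart_chart_inv: "y \<in> chart_image c \<Longrightarrow> snd c (chart_inv c y) = y"
  by (auto simp: chart_image_def chart_inv_def inv_into_into f_inv_into_f)

lemma chart_at_mem: "p \<in> carrier M \<Longrightarrow> chart_at M p \<in> M \<and> p \<in> fst (chart_at M p)"
  unfolding chart_at_def carrier_def by (rule someI_ex) auto

lemma carrier_mem: "c \<in> M \<Longrightarrow> p \<in> fst c \<Longrightarrow> p \<in> carrier M"
  by (auto simp: carrier_def)

context
  fixes M :: "('a, 'b::euclidean_space) chart set"
  assumes M: "smooth_atlas M"
begin

lemma overlap_iff:
  assumes "c \<in> M"
  shows "y \<in> snd c ` (fst c \<inter> fst d) \<longleftrightarrow> y \<in> chart_image c \<and> chart_inv c y \<in> fst d"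
proof
  assume "y \<in> snd c ` (fst c \<inter> fst d)"
  then show "y \<in> chart_image c \<and> chart_inv c y \<in> fst d"
    using chart_inv_chart[OF M assms] by (auto simp: chart_image_def)
next
  assume "y \<in> chart_image c \<and> chart_inv c y \<in> fst d"
  then show "y \<in> snd c ` (fst c \<inter> fst d)"
    by (metis IntI chart_chart_inv chart_inv_mem imageI)
qed

lemma transition_has_derivative:
  assumes "c \<in> M" "d \<in> M" "p \<in> fst c" "p \<in> fst d"
  shows "((snd d \<circ> chart_inv c) has_derivative transition_jacobian c d (snd c p)) (at (snd c p))"
  using smooth_on_has_derivative[OF smooth_transition[OF M assms(1,2)]] assms by blast

lemma transition_linear:
  assumes "c \<in> M" "d \<in> M" "p \<in> fst c" "p \<in> fst d"
  shows "linear (transition_jacobian c d (snd c p))"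
  using transition_has_derivative[OF assms] has_derivative_linear by blast

lemma transition_self:
  assumes "c \<in> M" "p \<in> fst c"
  shows "transition_jacobian c c (snd c p) = (\<lambda>a. a)"
proof -
  have "((snd c \<circ> chart_inv c) has_derivative (\<lambda>a. a)) (at (snd c p))"
    by (rule has_derivative_transform_within_open[OF has_derivative_ident open_chart_image[OF M assms(1)]])
       (simp_all add: assms chart_image_mem chart_chart_inv)
  then show ?thesis by (rule frechet_derivative_eqI)
qed

lemma transition_cocycle:
  assumes "c \<in> M" "d \<in> M" "e \<in> M" "p \<in> fst c" "p \<in> fst d" "p \<in> fst e"
  shows "transition_jacobian d e (snd d p) (transition_jacobian c d (snd c p) a)
       = transition_jacobian c e (snd c p) a"
proof -
  have td: "((snd e \<circ> chart_inv d) has_derivative transition_jacobian d e (snd d p)) 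
     (at ((snd d \<circ> chart_inv c) (snd c p)))"
    using transition_has_derivative[of d e p] assms chart_inv_chart[OF M] by simp
  have "((\<lambda>y. (snd e \<circ> chart_inv d) ((snd d \<circ> chart_inv c) y)) has_derivative
      (\<lambda>a. transition_jacobian d e (snd d p) (transition_jacobian c d (snd c p) a))) (at (snd c p))"
    by (rule has_derivative_compose[OF transition_has_derivative td]) (use assms in auto)
  then have "((snd e \<circ> chart_inv c) has_derivative
      (\<lambda>a. transition_jacobian d e (snd d p) (transition_jacobian c d (snd c p) a))) (at (snd c p))"
    by (rule has_derivative_transform_within_open[OF _ open_overlap[OF M assms(1,2)]])
       (use assms in \<open>auto simp: chart_inv_chart[OF M]\<close>)
  then show ?thesis by (metis frechet_derivative_eqI)
qed

lemma tangentI: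
  assumes "\<And>c d. c \<in> M \<Longrightarrow> d \<in> M \<Longrightarrow> p \<in> fst c \<Longrightarrow> p \<in> fst d \<Longrightarrow>
      v d = transition_jacobian c d (snd c p) (v c)"
    and "\<And>c. \<not> (c \<in> M \<and> p \<in> fst c) \<Longrightarrow> v c = 0"
  shows "v \<in> tangent_space M p"
  using assms unfolding tangent_space_def by blast

lemma tangent_transition:
  assumes "v \<in> tangent_space M p" "c \<in> M" "p \<in> fst c" "d \<in> M" "p \<in> fst d"
  shows "v d = transition_jacobian c d (snd c p) (v c)"
  using assms unfolding tangent_space_def by blast

lemma tangent_outside:
  assumes "v \<in> tangent_space M p" "\<not> (c \<in> M \<and> p \<in> fst c)"
  shows "v c = 0"
  using assms unfolding tangent_space_def by blast

lemma tangent_of_mem: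
  assumes "c \<in> M" "p \<in> fst c"
  shows "tangent_of M c p a \<in> tangent_space M p"
  by (rule tangentI) (auto simp: tangent_of_def transition_cocycle assms)

lemma tangent_of_same:
  assumes "c \<in> M" "p \<in> fst c"
  shows "tangent_of M c p a c = a"
  using assms transition_self by (simp add: tangent_of_def)

lemma tangent_eqI:
  assumes "u \<in> tangent_space M p" "v \<in> tangent_space M p" "c \<in> M" "p \<in> fst c" "u c = v c"
  shows "u = v"
proof
  fix d
  show "u d = v d"
  proof (cases "d \<in> M \<and> p \<in> fst d")
    case True
    then show ?thesis
      using tangent_transition[OF assms(1,3,4)] tangent_transition[OF assms(2,3,4)] assms(5) by metis
  qed (simp add: tangent_outside[OF assms(1)] tangent_outside[OF assms(2)])
qed

lemma tangent_of_component:
  assumes "v \<in> tangent_space M p" "c \<in> M" "p \<in> fst c"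
  shows "tangent_of M c p (v c) = v"
  using tangent_eqI[OF tangent_of_mem assms(1)] assms tangent_of_same by blast

lemma
  assumes u: "u \<in> tangent_space M p" and v: "v \<in> tangent_space M p"
  shows tangent_add: "u + v \<in> tangent_space M p" and tangent_tv_scale: "tv_scale r u \<in> tangent_space M p"
    and tangent_diff: "u - v \<in> tangent_space M p"
proof -
  show "u + v \<in> tangent_space M p"
  proof (rule tangentI)
    fix c d assume *: "c \<in> M" "d \<in> M" "p \<in> fst c" "p \<in> fst d"
    show "(u + v) d = transition_jacobian c d (snd c p) ((u + v) c)"
      using tangent_transition[OF u *(1,3,2,4)] tangent_transition[OF v *(1,3,2,4)]
        linear_add[OF transition_linear[OF *]] by simp
  qed (simp add: tangent_outside[OF u] tangent_outside[OF v])
  show "tv_scale r u \<in> tangent_space M p"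
  proof (rule tangentI)
    fix c d assume *: "c \<in> M" "d \<in> M" "p \<in> fst c" "p \<in> fst d"
    show "tv_scale r u d = transition_jacobian c d (snd c p) (tv_scale r u c)"
      using tangent_transition[OF u *(1,3,2,4)] linear_scale[OF transition_linear[OF *]]
      by (simp add: tv_scale_def)
  qed (simp add: tangent_outside[OF u] tv_scale_def)
  show "u - v \<in> tangent_space M p"
  proof (rule tangentI)
    fix c d assume *: "c \<in> M" "d \<in> M" "p \<in> fst c" "p \<in> fst d"
    show "(u - v) d = transition_jacobian c d (snd c p) ((u - v) c)"
      using tangent_transition[OF u *(1,3,2,4)] tangent_transition[OF v *(1,3,2,4)]
        linear_diff[OF transition_linear[OF *]] by simp
  qed (simp add: tangent_outside[OF u] tangent_outside[OF v])
qed

lemma tangent_zero: "0 \<in> tangent_space M p"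
  by (rule tangentI) (simp_all add: linear_0[OF transition_linear])

end

context
  fixes M :: "('a, 'b::euclidean_space) chart set" and N :: "('c, 'd::euclidean_space) chart set"
    and f :: "'a \<Rightarrow> 'c"
  assumes M: "smooth_atlas M" and N: "smooth_atlas N" and f: "smooth_map M N f"
begin

text \<open>Smoothness is given in some pair of charts; composition with the transition maps moves it
  to a prescribed pair.\<close>

lemma smooth_map_in_charts:
  assumes c: "c \<in> M" "p \<in> fst c" and d: "d \<in> N" "f p \<in> fst d"
  obtains U where "open U" "snd c p \<in> U" "U \<subseteq> chart_image c" "f ` (chart_inv c ` U) \<subseteq> fst d"
    "smooth_on U (in_charts c d f)"
proof -
  obtain c' d' U' where c': "c' \<in> M" "p \<in> fst c'" and d': "d' \<in> N"
    and U': "open U'" "snd c' p \<in> U'" "U' \<subseteq> chart_image c'" "f ` (chart_inv c' ` U') \<subseteq> fst d'"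
      "smooth_on U' (in_charts c' d' f)"
    using f[unfolded smooth_map_def, rule_format, OF carrier_mem[OF c]] by blast
  define A where "A = snd c ` (fst c \<inter> fst c')"
  define B where "B = snd d' ` (fst d' \<inter> fst d)"
  define V where "V = U' \<inter> in_charts c' d' f -` B"
  define U where "U = A \<inter> (snd c' \<circ> chart_inv c) -` V"
  have oA: "open A" and oB: "open B"
    unfolding A_def B_def by (rule open_overlap[OF M c(1) c'(1)], rule open_overlap[OF N d' d(1)])
  have oV: "open V" unfolding V_def
    by (intro continuous_open_preimage smooth_on_continuous_on U' oB)
  have sA: "smooth_on A (snd c' \<circ> chart_inv c)" using smooth_transition[OF M] c c' by (simp add: A_def)
  have oU: "open U" unfolding U_def
    by (intro continuous_open_preimage smooth_on_continuous_on sA oA oV)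
  have pU: "snd c p \<in> U"
  proof -
    have "p \<in> chart_inv c' ` U'" using U'(2) chart_inv_chart[OF M c'] by (metis imageI)
    then have "f p \<in> fst d'" using U'(4) by blast
    then have "snd d' (f p) \<in> B" using d unfolding B_def by blast
    moreover have "snd c p \<in> A" using c c' unfolding A_def by blast
    ultimately show ?thesis
      using U'(2) by (simp add: U_def V_def chart_inv_chart[OF M c] chart_inv_chart[OF M c'])
  qed
  have key: "chart_inv c y \<in> fst c" "chart_inv c y \<in> fst c'" "y \<in> chart_image c"
     "chart_inv c' ((snd c' \<circ> chart_inv c) y) = chart_inv c y" 
     "(snd c' \<circ> chart_inv c) y \<in> U'"
     "f (chart_inv c y) \<in> fst d'" "f (chart_inv c y) \<in> fst d" if "y \<in> U" for y
  proof -
    have 1: "y \<in> chart_image c" "chart_inv c y \<in> fst c'"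
      using that overlap_iff[OF M c(1), of y c'] by (auto simp: U_def A_def)
    have inv: "chart_inv c' ((snd c' \<circ> chart_inv c) y) = chart_inv c y"
      using chart_inv_chart[OF M c'(1)] 1 by simp
    have V: "(snd c' \<circ> chart_inv c) y \<in> V" using that by (simp add: U_def)
    then have U'y: "(snd c' \<circ> chart_inv c) y \<in> U'" by (simp add: V_def)
    then have "f (chart_inv c' ((snd c' \<circ> chart_inv c) y)) \<in> fst d'" using U'(4) by blast
    then have fd': "f (chart_inv c y) \<in> fst d'" by (simp only: inv)
    have "snd d' (f (chart_inv c' ((snd c' \<circ> chart_inv c) y))) \<in> B" using V by (simp add: V_def)
    then have "snd d' (f (chart_inv c y)) \<in> B" by (simp only: inv)
    then have "chart_inv d' (snd d' (f (chart_inv c y))) \<in> fst d"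
      unfolding B_def overlap_iff[OF N d'] by (rule conjunct2)
    then have "f (chart_inv c y) \<in> fst d" by (simp only: chart_inv_chart[OF N d' fd'])
    then show "chart_inv c y \<in> fst c" "chart_inv c y \<in> fst c'" "y \<in> chart_image c"
     "chart_inv c' ((snd c' \<circ> chart_inv c) y) = chart_inv c y" 
     "(snd c' \<circ> chart_inv c) y \<in> U'"
     "f (chart_inv c y) \<in> fst d'" "f (chart_inv c y) \<in> fst d"
      using 1 inv U'y fd' chart_inv_mem[OF 1(1)] by blast+
  qed
  have "smooth_on U (\<lambda>y. (snd d \<circ> chart_inv d') ((in_charts c' d' f) ((snd c' \<circ> chart_inv c) y)))"
  proof (rule smooth_on_compose[OF oU oB, where f="snd d \<circ> chart_inv d'"
        and g="\<lambda>y. in_charts c' d' f ((snd c' \<circ> chart_inv c) y)"])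
    show "smooth_on B (snd d \<circ> chart_inv d')"
      unfolding B_def by (rule smooth_transition[OF N d' d(1)])
    have "smooth_on U (snd c' \<circ> chart_inv c)"
      by (rule smooth_on_subset[OF sA]) (simp add: U_def)
    then show "smooth_on U (\<lambda>y. in_charts c' d' f ((snd c' \<circ> chart_inv c) y))"
      by (rule smooth_on_compose[OF oU U'(1) U'(5)]) (use key(5) in blast)
    show "(\<lambda>y. in_charts c' d' f ((snd c' \<circ> chart_inv c) y)) ` U \<subseteq> B"
      unfolding U_def V_def by blast
  qed
  moreover have "(snd d \<circ> chart_inv d') (in_charts c' d' f ((snd c' \<circ> chart_inv c) y)) = in_charts c d f y"
    if "y \<in> U" for y
    using key(4,6)[OF that] chart_inv_chart[OF N d'] by (simp add: comp_def)
  ultimately have "smooth_on U (in_charts c d f)"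
    by (rule smooth_on_cong[OF oU, THEN iffD1, rotated])
  moreover have "f ` (chart_inv c ` U) \<subseteq> fst d" "U \<subseteq> chart_image c" using key(3,7) by blast+
  ultimately show ?thesis using that[of U] oU pU by blast
qed

lemma in_charts_has_derivative:
  assumes c: "c \<in> M" "p \<in> fst c" and d: "d \<in> N" "f p \<in> fst d"
  shows "(in_charts c d f has_derivative frechet_derivative (in_charts c d f) (at (snd c p))) (at (snd c p))"
  using smooth_map_in_charts[OF assms] smooth_on_has_derivative by metis

lemma in_charts_derivative_source:
  assumes c: "c \<in> M" "p \<in> fst c" "c' \<in> M" "p \<in> fst c'" and d: "d \<in> N" "f p \<in> fst d"
  shows "frechet_derivative (in_charts c' d f) (at (snd c' p)) (transition_jacobian c c' (snd c p) a)
       = frechet_derivative (in_charts c d f) (at (snd c p)) a"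
proof -
  have D: "(in_charts c' d f has_derivative frechet_derivative (in_charts c' d f) (at (snd c' p)))
      (at ((snd c' \<circ> chart_inv c) (snd c p)))"
    using in_charts_has_derivative[OF c(3,4) d] chart_inv_chart[OF M] c by simp
  have "((\<lambda>y. in_charts c' d f ((snd c' \<circ> chart_inv c) y)) has_derivative
      (\<lambda>a. frechet_derivative (in_charts c' d f) (at (snd c' p)) (transition_jacobian c c' (snd c p) a)))
      (at (snd c p))"
    by (rule has_derivative_compose[OF transition_has_derivative[OF M] D]) (use c in auto)
  then have "(in_charts c d f has_derivative
      (\<lambda>a. frechet_derivative (in_charts c' d f) (at (snd c' p)) (transition_jacobian c c' (snd c p) a)))
      (at (snd c p))"
    by (rule has_derivative_transform_within_open[OF _ open_overlap[OF M c(1,3)]])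
       (use c in \<open>auto simp: chart_inv_chart[OF M]\<close>)
  then show ?thesis by (metis frechet_derivative_eqI)
qed

lemma in_charts_derivative_target:
  assumes c: "c \<in> M" "p \<in> fst c" and d: "d \<in> N" "f p \<in> fst d" "d' \<in> N" "f p \<in> fst d'"
  shows "transition_jacobian d d' (snd d (f p)) (frechet_derivative (in_charts c d f) (at (snd c p)) a)
       = frechet_derivative (in_charts c d' f) (at (snd c p)) a"
proof -
  obtain U where U: "open U" "snd c p \<in> U" "f ` (chart_inv c ` U) \<subseteq> fst d"
    using smooth_map_in_charts[OF c d(1,2)] by metis
  have D: "((snd d' \<circ> chart_inv d) has_derivative transition_jacobian d d' (snd d (f p)))
      (at (in_charts c d f (snd c p)))"
    using transition_has_derivative[OF N d(1,3,2,4)] chart_inv_chart[OF M c] by simp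
  have "((\<lambda>y. (snd d' \<circ> chart_inv d) (in_charts c d f y)) has_derivative
      (\<lambda>a. transition_jacobian d d' (snd d (f p)) (frechet_derivative (in_charts c d f) (at (snd c p)) a)))
      (at (snd c p))"
    by (rule has_derivative_compose[OF in_charts_has_derivative[OF c d(1,2)] D])
  then have "(in_charts c d' f has_derivative
      (\<lambda>a. transition_jacobian d d' (snd d (f p)) (frechet_derivative (in_charts c d f) (at (snd c p)) a)))
      (at (snd c p))"
    by (rule has_derivative_transform_within_open[OF _ U(1,2)])
       (use U(3) chart_inv_chart[OF N d(1)] in \<open>auto simp: image_subset_iff\<close>)
  then show ?thesis by (metis frechet_derivative_eqI)
qed

text \<open>The differential, which the definition evaluates in a chosen chart, may be computed in any
  chart of the source.\<close>

lemma differential_component: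
  assumes c: "c \<in> M" "p \<in> fst c" and d: "d \<in> N" "f p \<in> fst d" and v: "v \<in> tangent_space M p"
  shows "differential M N f p v d = frechet_derivative (in_charts c d f) (at (snd c p)) (v c)"
proof -
  have c0: "chart_at M p \<in> M" "p \<in> fst (chart_at M p)" using chart_at_mem[OF carrier_mem[OF c]] by auto
  show ?thesis
    using in_charts_derivative_source[OF c0 c d, of "v (chart_at M p)"] tangent_transition[OF M v c0 c] d
    by (simp add: differential_def)
qed

lemma differential_mem:
  assumes "p \<in> carrier M"
  shows "differential M N f p v \<in> tangent_space N (f p)"
proof -
  have c0: "chart_at M p \<in> M" "p \<in> fst (chart_at M p)" using chart_at_mem[OF assms] by auto
  show ?thesis
    by (rule tangentI[OF N])
       (auto simp: differential_def in_charts_derivative_target[OF c0])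
qed

end

section \<open>The Levi-Civita connection in charts\<close>

abbreviation metric_derivative ::
  "('a, 'b::euclidean_space) chart set \<Rightarrow> ('a, 'b) metric_tensor \<Rightarrow> ('a, 'b) chart \<Rightarrow>
     'b \<Rightarrow> 'b \<Rightarrow> 'b \<Rightarrow> 'b \<Rightarrow> real" where
  "metric_derivative M g c y a b k \<equiv> frechet_derivative (\<lambda>z. metric_coord M g c z b k) (at y) a"

abbreviation transition_hessian ::
  "('a, 'b::euclidean_space) chart \<Rightarrow> ('a, 'b) chart \<Rightarrow> 'b \<Rightarrow> 'b \<Rightarrow> 'b \<Rightarrow> 'b" where
  "transition_hessian c d y a b \<equiv> frechet_derivative (\<lambda>z. transition_jacobian c d z b) (at y) a"

lemma symmetric_bilinearI:
  assumes "\<And>a b. B a b = B b a" "\<And>a. linear (B a)"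
  shows "bilinear B"
proof -
  have "(\<lambda>a. B a b) = B b" for b using assms(1) by blast
  then show ?thesis using assms(2) by (simp add: bilinear_def)
qed

lemma
  assumes "riemannian_metric M g"
  shows metric_sym: "p \<in> carrier M \<Longrightarrow> u \<in> tangent_space M p \<Longrightarrow> v \<in> tangent_space M p \<Longrightarrow> g p u v = g p v u"
    and metric_pos: "p \<in> carrier M \<Longrightarrow> u \<in> tangent_space M p \<Longrightarrow> u \<noteq> 0 \<Longrightarrow> g p u u > 0"
    and metric_bilinear: "c \<in> M \<Longrightarrow> y \<in> chart_image c \<Longrightarrow> bilinear (metric_coord M g c y)"
    and metric_smooth: "c \<in> M \<Longrightarrow> smooth_on (chart_image c) (\<lambda>z. metric_coord M g c z a b)"
  by (rule assms[unfolded riemannian_metric_def, THEN conjunct1, rule_format]; assumption)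
     (rule assms[unfolded riemannian_metric_def, THEN conjunct2, THEN conjunct1, rule_format]
        assms[unfolded riemannian_metric_def, THEN conjunct2, THEN conjunct2, THEN conjunct1, rule_format]
        assms[unfolded riemannian_metric_def, THEN conjunct2, THEN conjunct2, THEN conjunct2, rule_format];
      assumption)+

context
  fixes M :: "('a, 'b::euclidean_space) chart set" and g :: "('a, 'b) metric_tensor"
  assumes M: "smooth_atlas M" and g: "riemannian_metric M g"
begin

lemma metric_coord_inner_form:
  assumes "c \<in> M" "y \<in> chart_image c"
  shows "inner_form (metric_coord M g c y)"
proof -
  let ?p = "chart_inv c y"
  have p: "?p \<in> fst c" "?p \<in> carrier M"
    using chart_inv_mem[OF assms(2)] carrier_mem[OF assms(1)] by auto
  have T: "tangent_of M c ?p a \<in> tangent_space M ?p" for a by (rule tangent_of_mem[OF M assms(1) p(1)])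
  have "metric_coord M g c y a b = metric_coord M g c y b a" for a b
    unfolding metric_coord_def by (rule metric_sym[OF g p(2) T T])
  moreover have "metric_coord M g c y a a > 0" if "a \<noteq> 0" for a
  proof -
    have "tangent_of M c ?p a \<noteq> 0"
      using tangent_of_same[OF M assms(1) p(1), of a] that by (metis zero_fun_apply)
    then show ?thesis unfolding metric_coord_def by (rule metric_pos[OF g p(2) T])
  qed
  moreover note metric_bilinear[OF g assms]
  ultimately show ?thesis by (simp add: inner_form_def)
qed

lemma metric_tangent:
  assumes "c \<in> M" "p \<in> fst c" "u \<in> tangent_space M p" "v \<in> tangent_space M p"
  shows "g p u v = metric_coord M g c (snd c p) (u c) (v c)"
  unfolding metric_coord_def chart_inv_chart[OF M assms(1,2)]
    tangent_of_component[OF M assms(3,1,2)] tangent_of_component[OF M assms(4,1,2)] ..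

lemma metric_coord_has_derivative:
  assumes "c \<in> M" "y \<in> chart_image c"
  shows "((\<lambda>z. metric_coord M g c z a b) has_derivative (\<lambda>v. metric_derivative M g c y v a b)) (at y)"
  by (rule smooth_on_has_derivative[OF metric_smooth[OF g assms(1)] assms(2)])

lemma metric_derivative_bilinear:
  assumes c: "c \<in> M" and y: "y \<in> chart_image c"
  shows "bilinear (metric_derivative M g c y v)" "linear (\<lambda>v. metric_derivative M g c y v a b)"
    "metric_derivative M g c y v a b = metric_derivative M g c y v b a"
proof -
  note D = metric_coord_has_derivative[OF c y]
  have uniq: "metric_derivative M g c y v a b = D v"
    if "((\<lambda>z. F z) has_derivative D) (at y)" "\<And>z. z \<in> chart_image c \<Longrightarrow> F z = metric_coord M g c z a b"
    for F D v a b
    using frechet_derivative_eqI[OF has_derivative_transform_within_open[OF that(1)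
          open_chart_image[OF M c] y that(2)]] by simp
  have B: "bilinear (metric_coord M g c z)" and S: "metric_coord M g c z a b = metric_coord M g c z b a"
    if "z \<in> chart_image c" for z a b
    using metric_coord_inner_form[OF c that] unfolding inner_form_def by blast+
  have sym: "metric_derivative M g c y v a b = metric_derivative M g c y v b a" for a b v
    using uniq[OF D[of b a], of a b v] S by blast
  have "linear (metric_derivative M g c y v a)" for a v
  proof (rule linearI)
    fix b k r
    show "metric_derivative M g c y v a (b + k) = metric_derivative M g c y v a b + metric_derivative M g c y v a k"
      by (rule uniq[OF has_derivative_add[OF D[of a b] D[of a k]]]) (simp add: bilinear_radd[OF B])
    show "metric_derivative M g c y v a (r *\<^sub>R b) = r *\<^sub>R metric_derivative M g c y v a b"
      by (rule uniq[OF has_derivative_scaleR_right[OF D[of a b]]]) (simp add: bilinear_rmul[OF B])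
  qed
  then show "bilinear (metric_derivative M g c y v)"
    by (rule symmetric_bilinearI[OF sym])
  show "linear (\<lambda>v. metric_derivative M g c y v a b)" using D has_derivative_linear by blast
  show "metric_derivative M g c y v a b = metric_derivative M g c y v b a" by (rule sym)
qed

lemma levi_civita_spec:
  assumes c: "c \<in> M" and y: "y \<in> chart_image c"
  shows "bilinear (levi_civita M g c y) \<and>
      (\<forall>a b. levi_civita M g c y a b = levi_civita M g c y b a) \<and>
      (\<forall>a b k. metric_derivative M g c y a b k =
         metric_coord M g c y (levi_civita M g c y a b) k + metric_coord M g c y b (levi_civita M g c y a k))"
  unfolding levi_civita_def
  by (rule theI'[OF koszul_exists[OF metric_coord_inner_form[OF c y], of "metric_derivative M g c y"]])
     (rule metric_derivative_bilinear[OF c y])+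

lemma levi_civita_unique:
  assumes c: "c \<in> M" and y: "y \<in> chart_image c" and "bilinear \<Gamma>" "\<And>a b. \<Gamma> a b = \<Gamma> b a"
    "\<And>a b k. metric_derivative M g c y a b k = metric_coord M g c y (\<Gamma> a b) k + metric_coord M g c y b (\<Gamma> a k)"
  shows "levi_civita M g c y = \<Gamma>"
  unfolding levi_civita_def
  by (rule the1_equality[OF koszul_exists[OF metric_coord_inner_form[OF c y], of "metric_derivative M g c y"]])
     (rule metric_derivative_bilinear[OF c y] conjI allI assms(3-))+

lemma levi_civita_bilinear: "c \<in> M \<Longrightarrow> y \<in> chart_image c \<Longrightarrow> bilinear (levi_civita M g c y)"
  and levi_civita_sym: "c \<in> M \<Longrightarrow> y \<in> chart_image c \<Longrightarrow> levi_civita M g c y a b = levi_civita M g c y b a"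
  and levi_civita_metric: "c \<in> M \<Longrightarrow> y \<in> chart_image c \<Longrightarrow> metric_derivative M g c y a b k =
         metric_coord M g c y (levi_civita M g c y a b) k + metric_coord M g c y b (levi_civita M g c y a k)"
  by (rule levi_civita_spec[THEN conjunct1] levi_civita_spec[THEN conjunct2, THEN conjunct1, rule_format]
      levi_civita_spec[THEN conjunct2, THEN conjunct2, rule_format]; assumption)+

lemma metric_coord_transition:
  assumes "c \<in> M" "d \<in> M" "p \<in> fst c" "p \<in> fst d"
  shows "metric_coord M g c (snd c p) a b = metric_coord M g d (snd d p)
     (transition_jacobian c d (snd c p) a) (transition_jacobian c d (snd c p) b)"
proof -
  have "metric_coord M g c (snd c p) a b = g p (tangent_of M c p a) (tangent_of M c p b)"
    using chart_inv_chart[OF M assms(1,3)] by (simp add: metric_coord_def)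
  also have "\<dots> = metric_coord M g d (snd d p) (tangent_of M c p a d) (tangent_of M c p b d)"
    by (rule metric_tangent[OF assms(2,4)]) (rule tangent_of_mem[OF M assms(1,3)])+
  finally show ?thesis using assms by (simp add: tangent_of_def)
qed

lemma transition_jacobian_has_derivative:
  assumes "c \<in> M" "d \<in> M" "p \<in> fst c" "p \<in> fst d"
  shows "((\<lambda>z. transition_jacobian c d z b) has_derivative (\<lambda>a. transition_hessian c d (snd c p) a b)) (at (snd c p))"
  using smooth_on_has_derivative[OF smooth_on_derivative[OF smooth_transition[OF M assms(1,2)]]] assms by blast

text \<open>Differentiating the invariance of the
  metric under a change of charts shows that the transformed symbols, corrected by the second
  derivative of the transition map, satisfy the conditions that determine the Levi-Civita
  connection; the correction is symmetric because second derivatives commute.\<close>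

lemma levi_civita_transition:
  assumes c: "c \<in> M" "p \<in> fst c" and d: "d \<in> M" "p \<in> fst d"
  shows "transition_jacobian c d (snd c p) (levi_civita M g c (snd c p) a b) =
     levi_civita M g d (snd d p) (transition_jacobian c d (snd c p) a) (transition_jacobian c d (snd c p) b)
     + transition_hessian c d (snd c p) a b"
proof -
  define J where "J = transition_jacobian c d (snd c p)"
  define K where "K = transition_jacobian d c (snd d p)"
  define T where "T = transition_hessian c d (snd c p)"
  define \<Gamma> where "\<Gamma> = levi_civita M g c (snd c p)"
  define m where "m = metric_coord M g d (snd d p)"
  have KJ: "K (J a) = a" for a
    using transition_cocycle[OF M c(1) d(1) c(1) c(2) d(2) c(2), of a] transition_self[OF M c]
    by (simp add: J_def K_def)
  have JK: "J (K a) = a" for a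
    using transition_cocycle[OF M d(1) c(1) d(1) d(2) c(2) d(2), of a] transition_self[OF M d]
    by (simp add: J_def K_def)
  have lJ: "linear J" and lK: "linear K"
    unfolding J_def K_def using c d by (simp_all add: transition_linear[OF M])
  have yc: "snd c p \<in> chart_image c" and yd: "snd d p \<in> chart_image d" 
    using chart_image_mem[OF c(2)] chart_image_mem[OF d(2)] by blast+
  have ov: "snd c p \<in> snd c ` (fst c \<inter> fst d)" using c d by blast
  have Tsym: "T a b = T b a" for a b
    unfolding T_def
    by (rule second_derivative_symmetric[OF open_overlap[OF M c(1) d(1)] smooth_transition[OF M c(1) d(1)] ov])
  have lT: "linear (\<lambda>a. T a b)" for b
    unfolding T_def
    by (rule has_derivative_linear[OF transition_jacobian_has_derivative[OF c(1) d(1) c(2) d(2)]])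
  have "(\<lambda>a. T a b) = T b" for b using Tsym by blast
  then have bT: "bilinear T" using lT by (intro symmetric_bilinearI[of T, OF Tsym]) metis
  have b\<Gamma>: "bilinear \<Gamma>" and s\<Gamma>: "\<Gamma> a b = \<Gamma> b a" for a b
    unfolding \<Gamma>_def by (rule levi_civita_bilinear[OF c(1) yc], rule levi_civita_sym[OF c(1) yc])
  have bm: "bilinear m" using metric_coord_inner_form[OF d(1) yd] by (simp add: inner_form_def m_def)
  have mJ: "metric_coord M g c (snd c p) a b = m (J a) (J b)" for a b
    using metric_coord_transition[OF c(1) d(1) c(2) d(2)] by (simp add: m_def J_def)
  have D: "metric_derivative M g c (snd c p) a b k =
     metric_derivative M g d (snd d p) (J a) (J b) (J k) + m (T a b) (J k) + m (J b) (T a k)" for a b k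
  proof -
    have td: "(snd d \<circ> chart_inv c) (snd c p) = snd d p" using chart_inv_chart[OF M c] by simp
    have "((\<lambda>z. metric_coord M g d ((snd d \<circ> chart_inv c) z) (transition_jacobian c d z b) (transition_jacobian c d z k))
       has_derivative (\<lambda>v. metric_derivative M g d (snd d p) (J v) (J b) (J k) + m (T v b) (J k) + m (J b) (T v k)))
       (at (snd c p))"
      unfolding J_def T_def m_def td[symmetric]
      by (rule has_derivative_bilinear_family[OF open_chart_image[OF M d(1)] _ _ metric_coord_has_derivative[OF d(1)]
            transition_has_derivative[OF M c(1) d(1) c(2) d(2)]
            transition_jacobian_has_derivative[OF c(1) d(1) c(2) d(2)]
            transition_jacobian_has_derivative[OF c(1) d(1) c(2) d(2)]])
         (simp_all only: td yd metric_bilinear[OF g d(1)])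
    then have "((\<lambda>z. metric_coord M g c z b k) has_derivative
       (\<lambda>v. metric_derivative M g d (snd d p) (J v) (J b) (J k) + m (T v b) (J k) + m (J b) (T v k))) (at (snd c p))"
    proof (rule has_derivative_transform_within_open[OF _ open_overlap[OF M c(1) d(1)] ov])
      fix z assume "z \<in> snd c ` (fst c \<inter> fst d)"
      then obtain q where q: "z = snd c q" "q \<in> fst c" "q \<in> fst d" by blast
      then show "metric_coord M g d ((snd d \<circ> chart_inv c) z) (transition_jacobian c d z b) (transition_jacobian c d z k)
           = metric_coord M g c z b k"
        using metric_coord_transition[OF c(1) d(1) q(2,3), of b k] chart_inv_chart[OF M c(1) q(2)] by simp
    qed
    from fun_cong[OF frechet_derivative_eqI[OF this], of a] show ?thesis .
  qed
  define \<Delta> where "\<Delta> a b = J (\<Gamma> (K a) (K b)) - T (K a) (K b)" for a b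
  have "levi_civita M g d (snd d p) = \<Delta>"
  proof (rule levi_civita_unique[OF d(1) yd])
    show s: "\<Delta> a b = \<Delta> b a" for a b
      unfolding \<Delta>_def using s\<Gamma>[of "K a" "K b"] Tsym[of "K a" "K b"] by simp
    have "linear (\<Delta> a)" for a
      unfolding \<Delta>_def
      by (intro linearI) (simp_all add: linear_add[OF lK] linear_scale[OF lK] bilinear_radd[OF b\<Gamma>]
        bilinear_rmul[OF b\<Gamma>] bilinear_radd[OF bT] bilinear_rmul[OF bT] linear_add[OF lJ] linear_scale[OF lJ]
        algebra_simps)
    then show "bilinear \<Delta>" by (rule symmetric_bilinearI[of \<Delta>, OF s])
    fix a b k
    have "metric_derivative M g c (snd c p) (K a) (K b) (K k)
       = m (J (\<Gamma> (K a) (K b))) k + m b (J (\<Gamma> (K a) (K k)))"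
      using levi_civita_metric[OF c(1) yc, where a="K a" and b="K b" and k="K k"] by (simp add: mJ \<Gamma>_def JK)
    then have "metric_derivative M g d (snd d p) a b k
       = m (J (\<Gamma> (K a) (K b))) k + m b (J (\<Gamma> (K a) (K k))) - m (T (K a) (K b)) k - m b (T (K a) (K k))"
      using D[where a="K a" and b="K b" and k="K k"] by (simp add: JK)
    then show "metric_derivative M g d (snd d p) a b k =
        metric_coord M g d (snd d p) (\<Delta> a b) k + metric_coord M g d (snd d p) b (\<Delta> a k)"
      unfolding m_def[symmetric] \<Delta>_def by (simp add: bilinear_lsub[OF bm] bilinear_rsub[OF bm])
  qed
  then have "levi_civita M g d (snd d p) (J a) (J b) = J (\<Gamma> a b) - T a b" by (simp add: \<Delta>_def KJ)
  then show ?thesis by (simp add: J_def T_def \<Gamma>_def)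
qed

text \<open>In consequence the covariant derivative \<open>W' + \<Gamma>(Y', W)\<close> of a vector field \<open>W\<close> along \<open>Y\<close>
  transforms like a vector. This one computation serves for sections along maps, for parallel
  fields and for curves in the tangent bundle.\<close>

lemma covariant_derivative_transition:
  fixes Y :: "'p::real_normed_vector \<Rightarrow> 'b"
  assumes c: "c \<in> M" "p \<in> fst c" and d: "d \<in> M" "p \<in> fst d" and Yq: "Y q = snd c p"
    and Y: "(Y has_derivative Y') (at q)" and W: "(W has_derivative W') (at q)"
  defines "J \<equiv> transition_jacobian c d (snd c p)"
  shows "((\<lambda>z. transition_jacobian c d (Y z) (W z)) has_derivative
     (\<lambda>v. J (W' v + levi_civita M g c (snd c p) (Y' v) (W q))
          - levi_civita M g d (snd d p) (J (Y' v)) (J (W q)))) (at q)"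
proof -
  have D: "((\<lambda>z. transition_jacobian c d (Y z) (W z)) has_derivative
     (\<lambda>v. transition_hessian c d (snd c p) (Y' v) (W q) + transition_jacobian c d (Y q) (W' v))) (at q)"
  proof (rule has_derivative_linear_family[OF open_overlap[OF M c(1) d(1)] _ _ _ Y W])
    show "Y q \<in> snd c ` (fst c \<inter> fst d)" using Yq c d by blast
    show "linear (transition_jacobian c d y)" if "y \<in> snd c ` (fst c \<inter> fst d)" for y
      using smooth_on_linear_derivative[OF smooth_transition[OF M c(1) d(1)] that] .
    show "((\<lambda>y. transition_jacobian c d y a) has_derivative (\<lambda>v. transition_hessian c d (snd c p) v a)) (at (Y q))" for a
      unfolding Yq by (rule transition_jacobian_has_derivative[OF c(1) d(1) c(2) d(2)])
  qed
  have lJ: "linear J" unfolding J_def using c d by (simp add: transition_linear[OF M])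
  show ?thesis
    by (rule has_derivative_eq_rhs[OF D])
       (simp add: fun_eq_iff linear_add[OF lJ] Yq levi_civita_transition[OF c d, folded J_def] flip: J_def)
qed

end

lemma isCont_levi_civita:
  fixes M :: "('a, real^'n) chart set"
  assumes M: "smooth_atlas M" and g: "riemannian_metric M g" and c: "c \<in> M" and y: "y \<in> chart_image c"
  shows "isCont (\<lambda>z. levi_civita M g c z a b) y"
proof (rule isCont_represented[where G="metric_coord M g c", OF open_chart_image[OF M c] y])
  show "inner_form (metric_coord M g c z)" if "z \<in> chart_image c" for z
    by (rule metric_coord_inner_form[OF M g c that])
  show "isCont (\<lambda>z. metric_coord M g c z a b) y" for a b
    using metric_coord_has_derivative[OF M g c y] has_derivative_continuous by blast
  fix k
  have D: "isCont (\<lambda>z. metric_derivative M g c z a b k) y" for a b k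
    using smooth_on_continuous_on[OF smooth_on_derivative[OF metric_smooth[OF g c]]] open_chart_image[OF M c] y
      continuous_on_eq_continuous_at by blast
  have "metric_coord M g c z (levi_civita M g c z a b) k =
     (metric_derivative M g c z a b k + metric_derivative M g c z b a k - metric_derivative M g c z k a b) / 2"
    if "z \<in> chart_image c" for z
    using koszul_formula[where G="metric_coord M g c z" and \<Gamma>="levi_civita M g c z" and
        D="metric_derivative M g c z", OF metric_coord_inner_form[OF M g c that]
        levi_civita_sym[OF M g c that] levi_civita_metric[OF M g c that], of a b k] by simp
  then have "\<forall>\<^sub>F z in nhds y. metric_coord M g c z (levi_civita M g c z a b) k =
     (metric_derivative M g c z a b k + metric_derivative M g c z b a k - metric_derivative M g c z k a b) / 2"
    unfolding eventually_nhds using open_chart_image[OF M c] y by blast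
  from isCont_cong[OF this]
  show "isCont (\<lambda>z. metric_coord M g c z (levi_civita M g c z a b) k) y"
    using D by (simp add: continuous_intros)
qed

text \<open>The values that the definition prescribes chart by chart fit together, because covariant
  derivatives transform like vectors.\<close>

lemma nabla_along_tangent:
  fixes M :: "('a, 'b::euclidean_space) chart set" and N :: "('c, 'd::euclidean_space) chart set"
  assumes M: "smooth_atlas M" and N: "smooth_atlas N" and g: "riemannian_metric N g"
    and f: "smooth_map M N f" and p: "p \<in> carrier M" and v: "v \<in> tangent_space M p"
  defines "c \<equiv> chart_at M p"
  assumes U: "open U" "snd c p \<in> U" "\<And>y. y \<in> U \<Longrightarrow> s (chart_inv c y) \<in> tangent_space N (f (chart_inv c y))"
    and d: "d \<in> N" "f p \<in> fst d" and diff: "(\<lambda>y. s (chart_inv c y) d) differentiable (at (snd c p))"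
  shows "nabla_along M N g f s p v \<in> tangent_space N (f p)"
    and "e \<in> N \<Longrightarrow> f p \<in> fst e \<Longrightarrow> (\<lambda>y. s (chart_inv c y) e) differentiable (at (snd c p))"
proof -
  have c: "c \<in> M" "p \<in> fst c" using chart_at_mem[OF p] by (auto simp: c_def)
  have inv: "chart_inv c (snd c p) = p" by (rule chart_inv_chart[OF M c])
  have sp: "s p \<in> tangent_space N (f p)" using U(3)[OF U(2)] inv by simp
  have D: "((\<lambda>y. s (chart_inv c y) e) has_derivative
     (\<lambda>v. transition_jacobian a e (snd a (f p)) (frechet_derivative (\<lambda>y. s (chart_inv c y) a) (at (snd c p)) v
              + levi_civita N g a (snd a (f p)) (frechet_derivative (in_charts c a f) (at (snd c p)) v) (s p a))
       - levi_civita N g e (snd e (f p)) (frechet_derivative (in_charts c e f) (at (snd c p)) v) (s p e))) (at (snd c p))"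
    if a: "a \<in> N" "f p \<in> fst a" "(\<lambda>y. s (chart_inv c y) a) differentiable (at (snd c p))" and
      e: "e \<in> N" "f p \<in> fst e" for a e
  proof -
    obtain V where V: "open V" "snd c p \<in> V" "f ` (chart_inv c ` V) \<subseteq> fst a"
      using smooth_map_in_charts[OF M N f c a(1,2)] by metis
    obtain V' where V': "open V'" "snd c p \<in> V'" "f ` (chart_inv c ` V') \<subseteq> fst e"
      using smooth_map_in_charts[OF M N f c e] by metis
    have "((\<lambda>y. transition_jacobian a e (in_charts c a f y) (s (chart_inv c y) a)) has_derivative
     (\<lambda>v. transition_jacobian a e (snd a (f p)) (frechet_derivative (\<lambda>y. s (chart_inv c y) a) (at (snd c p)) v
              + levi_civita N g a (snd a (f p)) (frechet_derivative (in_charts c a f) (at (snd c p)) v) (s (chart_inv c (snd c p)) a))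
       - levi_civita N g e (snd e (f p)) (transition_jacobian a e (snd a (f p)) (frechet_derivative (in_charts c a f) (at (snd c p)) v))
          (transition_jacobian a e (snd a (f p)) (s (chart_inv c (snd c p)) a)))) (at (snd c p))"
      by (rule covariant_derivative_transition[OF N g a(1,2) e _ in_charts_has_derivative[OF M N f c a(1,2)]
            frechet_derivative_worksI[OF a(3)]]) (simp add: inv)
    moreover have "transition_jacobian a e (snd a (f p)) (s p a) = s p e"
      using tangent_transition[OF N sp a(1,2) e] by simp
    ultimately have "((\<lambda>y. transition_jacobian a e (in_charts c a f y) (s (chart_inv c y) a)) has_derivative
     (\<lambda>v. transition_jacobian a e (snd a (f p)) (frechet_derivative (\<lambda>y. s (chart_inv c y) a) (at (snd c p)) v
              + levi_civita N g a (snd a (f p)) (frechet_derivative (in_charts c a f) (at (snd c p)) v) (s p a))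
       - levi_civita N g e (snd e (f p)) (frechet_derivative (in_charts c e f) (at (snd c p)) v) (s p e))) (at (snd c p))"
      by (simp add: inv in_charts_derivative_target[OF M N f c a(1,2) e])
    then show ?thesis
    proof (rule has_derivative_transform_within_open)
      show "open (U \<inter> V \<inter> V')" "snd c p \<in> U \<inter> V \<inter> V'" using U V V' by auto
      fix y assume y: "y \<in> U \<inter> V \<inter> V'"
      then have "f (chart_inv c y) \<in> fst a" "f (chart_inv c y) \<in> fst e" using V(3) V'(3) by blast+
      then show "transition_jacobian a e (in_charts c a f y) (s (chart_inv c y) a) = s (chart_inv c y) e"
        using tangent_transition[OF N U(3) a(1) _ e(1)] y by simp
    qed
  qed
  show diff_all: "(\<lambda>y. s (chart_inv c y) e) differentiable (at (snd c p))" if "e \<in> N" "f p \<in> fst e" for e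
    using D[OF d diff that] by (auto simp: differentiable_def)
  show "nabla_along M N g f s p v \<in> tangent_space N (f p)"
  proof (rule tangentI[OF N])
    fix a e assume a: "a \<in> N" "e \<in> N" "f p \<in> fst a" "f p \<in> fst e"
    have comp: "nabla_along M N g f s p v b = frechet_derivative (\<lambda>y. s (chart_inv c y) b) (at (snd c p)) (v c)
        + levi_civita N g b (snd b (f p)) (frechet_derivative (in_charts c b f) (at (snd c p)) (v c)) (s p b)"
      if "b \<in> N" "f p \<in> fst b" for b
      using that differential_component[OF M N f c that v] by (simp add: nabla_along_def c_def)
    show "nabla_along M N g f s p v e = transition_jacobian a e (snd a (f p)) (nabla_along M N g f s p v a)"
      using frechet_derivative_eqI[OF D[OF a(1,3) diff_all[OF a(1,3)] a(2,4)]]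
      by (simp add: comp a)
  qed (auto simp: nabla_along_def)
qed

section \<open>Linear differential equations\<close>

text \<open>The integral equation \<open>w(t) = w\<^sub>0 + \<integral>\<^sub>0\<^sup>t A w\<close> is a contraction on the bounded continuous
  functions once the interval is short.\<close>

lemma linear_ode_exists:
  fixes A :: "real \<Rightarrow> 'a::euclidean_space \<Rightarrow> 'a"
  assumes r: "r > 0" and cont: "\<And>b. continuous_on {-r..r} (\<lambda>t. A t b)"
    and lin: "\<And>t. t \<in> {-r..r} \<Longrightarrow> linear (A t)"
  obtains e w where "0 < e" "e \<le> r" "w 0 = w_init"
    "\<And>t. t \<in> {-e<..<e} \<Longrightarrow> (w has_vector_derivative A t (w t)) (at t)"
proof -
  have exp: "A t v = (\<Sum>b\<in>Basis. (v \<bullet> b) *\<^sub>R A t b)" if "t \<in> {-r..r}" for t v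
  proof -
    have "A t v = A t (\<Sum>b\<in>Basis. (v \<bullet> b) *\<^sub>R b)" by (simp add: euclidean_representation)
    then show ?thesis using lin[OF that] by (simp add: linear_sum linear_scale)
  qed
  have "\<exists>B. \<forall>t\<in>{-r..r}. norm (A t b) \<le> B" for b
    using compact_imp_bounded[OF compact_continuous_image[OF cont compact_Icc]]
    by (auto simp: bounded_iff)
  then obtain B where B: "\<And>t b. t \<in> {-r..r} \<Longrightarrow> norm (A t b) \<le> B b" by metis
  define K where "K = 1 + (\<Sum>b\<in>(Basis::'a set). \<bar>B b\<bar>)"
  have K: "K \<ge> 1" by (simp add: K_def sum_nonneg)
  have bound: "norm (A t v) \<le> K * norm v" if "t \<in> {-r..r}" for t v
  proof -
    have "norm (A t v) \<le> (\<Sum>b\<in>Basis. norm ((v \<bullet> b) *\<^sub>R A t b))"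
      unfolding exp[OF that, of v] by (rule norm_sum)
    also have "\<dots> \<le> (\<Sum>b\<in>Basis. norm v * \<bar>B b\<bar>)"
    proof (rule sum_mono)
      fix b :: 'a assume "b \<in> Basis"
      then show "norm ((v \<bullet> b) *\<^sub>R A t b) \<le> norm v * \<bar>B b\<bar>"
        using B[OF that, of b] Basis_le_norm[of b v] by (simp add: mult_mono)
    qed
    also have "\<dots> \<le> K * norm v" by (simp add: K_def sum_distrib_left[symmetric] algebra_simps)
    finally show ?thesis .
  qed
  \<comment> \<open>The contraction constant will be \<open>4 K e\<close>: two integrals over intervals of length at most \<open>2 e\<close>.\<close>
  define e where "e = min r (1 / (8 * K))"
  have e: "0 < e" "e \<le> r" "8 * K * e \<le> 1"
  proof -
    show "0 < e" "e \<le> r" using r K by (auto simp: e_def)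
    have "8 * K * e \<le> 8 * K * (1 / (8 * K))" using K by (intro mult_left_mono) (auto simp: e_def)
    then show "8 * K * e \<le> 1" using K by simp
  qed
  have sub: "{-e..t} \<subseteq> {-r..r}" if "t \<le> e" for t using that e by auto
  have cF: "continuous_on {-e..e} (\<lambda>t. A t (x t))" if "continuous_on UNIV x" for x
  proof -
    have "continuous_on {-e..e} (\<lambda>t. \<Sum>b\<in>Basis. (x t \<bullet> b) *\<^sub>R A t b)"
      by (intro continuous_intros continuous_on_subset[OF that] continuous_on_subset[OF cont] sub) auto
    then show ?thesis
      by (rule continuous_on_eq) (use exp sub[of e] in auto)
  qed
  define I where "I x t = integral {-e..t} (\<lambda>s. A s (apply_bcontfun x s))" for x :: "real \<Rightarrow>\<^sub>C 'a" and t
  have "\<exists>y::real \<Rightarrow>\<^sub>C 'a. (\<forall>t\<in>{-e..e}. y t = w_init + I x t - I x 0) \<and>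
       (\<forall>t. y t = w_init + I x (clamp (-e) e t) - I x 0)" for x
  proof -
    have "continuous_on (cbox (-e) e) (\<lambda>t. w_init + I x t - I x 0)"
      unfolding I_def cbox_interval
      by (intro continuous_intros indefinite_integral_continuous_1 integrable_continuous_real cF) simp
    from continuous_on_cbox_bcontfunE[OF this] show ?thesis by (metis cbox_interval)
  qed
  then obtain T where T: "\<And>x t. t \<in> {-e..e} \<Longrightarrow> apply_bcontfun (T x) t = w_init + I x t - I x 0"
    and T': "\<And>x t. apply_bcontfun (T x) t = w_init + I x (clamp (-e) e t) - I x 0" by metis
  have lip: "dist (T x) (T y) \<le> 1/2 * dist x y" for x y
  proof (rule dist_bound)
    have Ib: "norm (I x t - I y t) \<le> 2 * K * e * dist x y" if t: "t \<in> {-e..e}" for t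
    proof -
      have c: "continuous_on {-e..t} (\<lambda>s. A s (apply_bcontfun z s))" for z
        using continuous_on_subset[OF cF[of "apply_bcontfun z"], of "{-e..t}"] t by auto
      have "I x t - I y t = integral {-e..t} (\<lambda>s. A s (apply_bcontfun x s) - A s (apply_bcontfun y s))"
        unfolding I_def by (rule integral_diff[symmetric]) (intro integrable_continuous_real c)+
      also have "norm \<dots> \<le> K * dist x y * (t - - e)"
      proof (rule integral_bound)
        show "continuous_on {-e..t} (\<lambda>s. A s (apply_bcontfun x s) - A s (apply_bcontfun y s))"
          by (intro continuous_intros c)
        fix s assume "s \<in> {-e..t}"
        then have s: "s \<in> {-r..r}" using sub[of t] t by auto
        have "norm (A s (apply_bcontfun x s) - A s (apply_bcontfun y s)) = norm (A s (apply_bcontfun x s - apply_bcontfun y s))"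
          using lin[OF s] by (simp add: linear_diff)
        also have "\<dots> \<le> K * norm (apply_bcontfun x s - apply_bcontfun y s)" by (rule bound[OF s])
        also have "\<dots> \<le> K * dist x y"
          using K dist_bounded[of x s y] by (intro mult_left_mono) (auto simp: dist_norm)
        finally show "norm (A s (apply_bcontfun x s) - A s (apply_bcontfun y s)) \<le> K * dist x y" .
      qed (use t in auto)
      also have "\<dots> \<le> K * dist x y * (2 * e)" using t K by (intro mult_left_mono) auto
      finally show ?thesis by (simp add: mult_ac)
    qed
    fix t :: real
    have ct: "clamp (-e) e t \<in> {-e..e}" using clamp_in_interval[of "-e" e t] e by (simp add: cbox_interval)
    have "dist (apply_bcontfun (T x) t) (apply_bcontfun (T y) t)
        = norm ((I x (clamp (-e) e t) - I y (clamp (-e) e t)) - (I x 0 - I y 0))"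
      by (simp add: T' dist_norm algebra_simps)
    also have "\<dots> \<le> 2 * K * e * dist x y + 2 * K * e * dist x y"
      using norm_triangle_ineq4 Ib[OF ct] Ib[of 0] e by (smt (verit) atLeastAtMost_iff)
    also have "\<dots> = (4 * K * e) * dist x y" by (simp add: algebra_simps)
    also have "\<dots> \<le> 1/2 * dist x y"
    proof (rule mult_right_mono)
      have "0 \<le> K * e" using K e by simp
      then show "4 * K * e \<le> 1/2" using e(3) by linarith
    qed simp
    finally show "dist (apply_bcontfun (T x) t) (apply_bcontfun (T y) t) \<le> 1/2 * dist x y" .
  qed
  obtain x where x: "T x = x"
    using banach_fix_type[of "1/2" T] lip by auto
  show ?thesis
  proof (rule that[of e "apply_bcontfun x"])
    show "apply_bcontfun x 0 = w_init" using T[of 0 x] x e by simp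
    fix t assume t: "t \<in> {-e<..<e}"
    have "((\<lambda>u. I x u) has_vector_derivative A t (apply_bcontfun x t)) (at t within {-e..e})"
      unfolding I_def using t by (intro integral_has_vector_derivative cF) auto
    then have I: "((\<lambda>u. I x u) has_vector_derivative A t (apply_bcontfun x t)) (at t)"
      using t by (simp add: at_within_Icc_at)
    have "((\<lambda>u. w_init + I x u - I x 0) has_vector_derivative A t (apply_bcontfun x t)) (at t)"
      using has_vector_derivative_diff[OF has_vector_derivative_add[OF has_vector_derivative_const I]
          has_vector_derivative_const] by simp
    then show "(apply_bcontfun x has_vector_derivative A t (apply_bcontfun x t)) (at t)"
      by (rule has_vector_derivative_transform_within_open[of _ _ _ "{-e<..<e}"])
         (use t T[of _ x] x in auto)
  qed (use e in auto)
qed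

section \<open>The cross product of a \<open>G\<^sub>2\<close> structure\<close>

locale vector_cross_product =
  fixes G :: "'v::real_vector \<Rightarrow> 'v \<Rightarrow> real" and X :: "'v \<Rightarrow> 'v \<Rightarrow> 'v"
  assumes G: "inner_form G" and X: "bilinear X" and anti: "X u v = - X v u"
    and cyclic: "G u (X v w) = G v (X w u)"
    and double: "X u (X u v) = G u v *\<^sub>R u - G u u *\<^sub>R v"
begin

lemma bG: "bilinear G" and sG: "G u v = G v u"
  using G by (auto simp: inner_form_def)

lemma linG: "G (u + v) w = G u w + G v w" "G w (u + v) = G w u + G w v"
  "G (r *\<^sub>R u) w = r * G u w" "G w (r *\<^sub>R u) = r * G w u"
  "G (u - v) w = G u w - G v w" "G w (u - v) = G w u - G w v"
  "G (- u) w = - G u w" "G w (- u) = - G w u"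
  using bG by (simp_all add: bilinear_ladd bilinear_radd bilinear_lmul bilinear_rmul bilinear_lsub
      bilinear_rsub bilinear_lneg bilinear_rneg)

lemma linX: "X (u + v) w = X u w + X v w" "X w (u + v) = X w u + X w v"
  "X (r *\<^sub>R u) w = r *\<^sub>R X u w" "X w (r *\<^sub>R u) = r *\<^sub>R X w u"
  "X (u - v) w = X u w - X v w" "X w (u - v) = X w u - X w v"
  "X (- u) w = - X u w" "X w (- u) = - X w u"
  using X by (simp_all add: bilinear_ladd bilinear_radd bilinear_lmul bilinear_rmul bilinear_lsub
      bilinear_rsub bilinear_lneg bilinear_rneg)

lemma cross_self: "X u u = 0"
proof -
  have "2 *\<^sub>R X u u = 0" using anti[of u u] by (metis add.right_inverse scaleR_2)
  then show ?thesis by simp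
qed

lemma orth_left: "G u (X u v) = 0"
  using cyclic[of u u v] anti[of v u] linG(8)[of u "X u v"] by simp

lemma orth_right: "G v (X u v) = 0"
  using orth_left[of v u] anti[of u v] by (simp add: linG)

lemma double_polarized:
  assumes "G u w = 0"
  shows "X u (X w v) + X w (X u v) = G w v *\<^sub>R u + G u v *\<^sub>R w"
proof -
  have "X (u + w) (X (u + w) v) = X u (X u v) + X w (X w v) + (X u (X w v) + X w (X u v))"
    by (simp add: linX algebra_simps)
  moreover have "G w u = 0" using assms sG by simp
  ultimately show ?thesis using assms by (simp add: double linG algebra_simps)
qed

lemma double_orth: "G u x = 0 \<Longrightarrow> G u u = 1 \<Longrightarrow> X u (X u x) = - x"
  by (simp add: double)

text \<open>The geometry of an oriented orthonormal pair \<open>a, b\<close> and \<open>n = a \<times> b\<close>: on the plane of \<open>a\<close>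
  and \<open>b\<close> the product with \<open>n\<close> is the rotation by \<open>90\<close> degrees, and on the orthogonal complement of
  \<open>a, b, n\<close> the products with \<open>a, b, n\<close> are anticommuting complex structures, the third being
  minus the composition of the first two.\<close>

context
  fixes a b n
  assumes aa: "G a a = 1" and bb: "G b b = 1" and ab: "G a b = 0" and n: "n = X a b"
begin

lemma n_orth: "G a n = 0" "G b n = 0" "G n a = 0" "G n b = 0"
  using orth_left[of a b] orth_right[of b a] sG[of n] by (simp_all add: n)

lemma n_a: "X n a = b"
  using anti[of n a] double[of a b] by (simp add: n aa ab)

lemma n_b: "X n b = - a"
proof -
  have "X b (X a b) = a" using anti[of a b] double[of b a] by (simp add: linX bb ab sG[of b a])
  then show ?thesis using anti[of n b] by (simp add: n)
qed

lemma n_unit: "G n n = 1"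
  using cyclic[of n a b] n_b anti[of b n] by (simp add: n[symmetric] aa)

definition perp :: "'v \<Rightarrow> bool" where
  "perp x \<longleftrightarrow> G a x = 0 \<and> G b x = 0 \<and> G n x = 0"

lemma perp_cross: "perp x \<Longrightarrow> perp (X a x)" "perp x \<Longrightarrow> perp (X b x)"
  using cyclic[of b a x] cyclic[of x b a] cyclic[of n a x] cyclic[of x n a]
    cyclic[of a b x] cyclic[of x a b] cyclic[of n b x] cyclic[of x n b]
    orth_left n_a n_b anti[of b a] sG[of x]
  by (simp_all add: perp_def linG n[symmetric])

lemma perp_n: "perp x \<Longrightarrow> X n x = - X a (X b x)"
proof -
  assume x: "perp x"
  have "X x (X a b) + X a (X x b) = 0"
    using double_polarized[of x a b] x by (simp add: perp_def sG[of x] ab)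
  then have "X n x = X a (X x b)"
    using anti[of x n] by (simp add: n[symmetric] add_eq_0_iff)
  then show ?thesis using anti[of x b] by (simp add: linX)
qed

lemma perp_anticommute: "perp x \<Longrightarrow> X b (X a x) = - X a (X b x)"
  using double_polarized[of a b x] ab by (simp add: perp_def add_eq_0_iff)

text \<open>Here \<open>P\<^sub>i\<^sub>j\<close> stands for the second fundamental form in the basis \<open>a, b\<close>, up to tangential terms,
  and \<open>K\<^sub>i\<close> for the covariant derivatives of \<open>n\<close>. The tangential parts of \<open>P\<^sub>i\<^sub>j\<close> contribute only
  multiples of \<open>n\<close> to \<open>K\<^sub>i\<close>, and these cancel because \<open>K\<^sub>i\<close> is orthogonal to \<open>n\<close>. With the normal
  parts, \<open>K\<^sub>1 = a \<times> P\<^sub>1\<^sub>2 - b \<times> P\<^sub>1\<^sub>1\<close> and \<open>K\<^sub>2 = a \<times> P\<^sub>2\<^sub>2 - b \<times> P\<^sub>1\<^sub>2\<close>, and \<open>n \<times> K\<^sub>1 = - b \<times> P\<^sub>1\<^sub>2 - a \<times> P\<^sub>1\<^sub>1\<close>, so that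
  \<open>K\<^sub>2 = n \<times> K\<^sub>1\<close> amounts to \<open>a \<times> (P\<^sub>1\<^sub>1 + P\<^sub>2\<^sub>2) = 0\<close>.\<close>

lemma derivative_complex_linear_iff:
  assumes P: "G n P11 = 0" "G n P12 = 0" "G n P22 = 0"
    and K1: "K1 = X P11 b + X a P12 + r1 *\<^sub>R n" "G n K1 = 0"
    and K2: "K2 = X P12 b + X a P22 + r2 *\<^sub>R n" "G n K2 = 0"
  shows "K2 = X n K1 \<longleftrightarrow> P11 + P22 = G a (P11 + P22) *\<^sub>R a + G b (P11 + P22) *\<^sub>R b"
proof -
  define N where "N P = P - G a P *\<^sub>R a - G b P *\<^sub>R b" for P
  have pN: "perp (N P)" if "G n P = 0" for P
    using that n_orth aa bb ab by (simp add: perp_def N_def linG sG[of b a])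
  have dec: "P = N P + G a P *\<^sub>R a + G b P *\<^sub>R b" for P by (simp add: N_def)
  have K: "Q = X a (N P') - X b (N P)"
    if "Q = X P b + X a P' + r *\<^sub>R n" "G n Q = 0" "G n P = 0" "G n P' = 0" for Q P P' r
  proof -
    have 1: "X P b + X a P' = X (N P) b + X a (N P') + (G a P + G b P') *\<^sub>R n"
    proof -
      have "X P b = X (N P) b + G a P *\<^sub>R n"
        by (subst dec[of P]) (simp add: linX cross_self n)
      moreover have "X a P' = X a (N P') + G b P' *\<^sub>R n"
        by (subst dec[of P']) (simp add: linX cross_self n)
      ultimately show ?thesis by (simp add: algebra_simps)
    qed
    have Q: "Q = X a (N P') - X b (N P) + (G a P + G b P' + r) *\<^sub>R n"
      using that(1) 1 anti[of "N P" b] by (simp add: algebra_simps)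
    have "G n (X a (N P')) = 0" "G n (X b (N P)) = 0"
      using perp_cross pN that(3,4) by (auto simp: perp_def)
    then have "G a P + G b P' + r = 0"
      using that(2) by (simp add: Q linG n_unit)
    then show ?thesis by (simp add: Q)
  qed
  have k1: "K1 = X a (N P12) - X b (N P11)" by (rule K[OF K1 P(1,2)])
  have k2: "K2 = X a (N P22) - X b (N P12)" by (rule K[OF K2 P(2,3)])
  have sq: "X a (X a x) = - x" "X b (X b x) = - x" if "perp x" for x
    using that double_orth aa bb by (auto simp: perp_def)
  have na: "X n (X a x) = - X b x" if "perp x" for x
    using perp_n[OF perp_cross(1)[OF that]] perp_anticommute[OF that] sq(1)[OF perp_cross(2)[OF that]]
    by (simp add: linX)
  have nb: "X n (X b x) = X a x" if "perp x" for x
    using perp_n[OF perp_cross(2)[OF that]] sq(2)[OF that] by (simp add: linX)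
  have "X n K1 = - X b (N P12) - X a (N P11)"
    by (simp add: k1 linX na nb pN P)
  then have "K2 = X n K1 \<longleftrightarrow> X a (N P22) = - X a (N P11)"
    by (simp add: k2 diff_eq_eq)
  also have "\<dots> \<longleftrightarrow> X a (N (P11 + P22)) = 0"
    by (simp add: N_def linX linG algebra_simps eq_neg_iff_add_eq_0)
  also have "\<dots> \<longleftrightarrow> N (P11 + P22) = 0"
    using sq(1)[OF pN, of "P11 + P22"] P by (auto simp: linG linX(4)[of a 0 0, simplified])
  also have "\<dots> \<longleftrightarrow> P11 + P22 = G a (P11 + P22) *\<^sub>R a + G b (P11 + P22) *\<^sub>R b"
    by (auto simp: N_def algebra_simps)
  finally show ?thesis .
qed

end

end

lemma exhaust_7:
  fixes x :: 7
  shows "x = 1 \<or> x = 2 \<or> x = 3 \<or> x = 4 \<or> x = 5 \<or> x = 6 \<or> x = 7"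
proof (induct x)
  case (of_int z)
  then have "z = 0 \<or> z = 1 \<or> z = 2 \<or> z = 3 \<or> z = 4 \<or> z = 5 \<or> z = 6" by fastforce
  then show ?case by auto
qed

lemma UNIV_7: "UNIV = {1::7, 2, 3, 4, 5, 6, 7}"
  using exhaust_7 by auto

lemma sum_7: "sum f (UNIV::7 set) = f 1 + f 2 + f 3 + f 4 + f 5 + f 6 + f 7"
  unfolding UNIV_7 by (simp add: ac_simps)

lemma forall_7: "(\<forall>i::7. P i) \<longleftrightarrow> P 1 \<and> P 2 \<and> P 3 \<and> P 4 \<and> P 5 \<and> P 6 \<and> P 7"
  by (metis exhaust_7)

text \<open>The cross product of the standard form, \<open>u \<bullet> (v \<times> w) = \<phi>\<^sub>0(u, v, w)\<close>, in components.\<close>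

definition cross0 :: "real^7 \<Rightarrow> real^7 \<Rightarrow> real^7" where
  "cross0 v w = (\<chi> i.
     if i = 1 then (v$2 * w$3 - v$3 * w$2) + (v$4 * w$5 - v$5 * w$4) - (v$6 * w$7 - v$7 * w$6)
     else if i = 2 then (v$3 * w$1 - v$1 * w$3) + (v$4 * w$6 - v$6 * w$4) + (v$5 * w$7 - v$7 * w$5)
     else if i = 3 then (v$1 * w$2 - v$2 * w$1) + (v$4 * w$7 - v$7 * w$4) - (v$5 * w$6 - v$6 * w$5)
     else if i = 4 then (v$5 * w$1 - v$1 * w$5) + (v$6 * w$2 - v$2 * w$6) + (v$7 * w$3 - v$3 * w$7)
     else if i = 5 then (v$1 * w$4 - v$4 * w$1) - (v$2 * w$7 - v$7 * w$2) - (v$6 * w$3 - v$3 * w$6)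
     else if i = 6 then (v$2 * w$4 - v$4 * w$2) - (v$7 * w$1 - v$1 * w$7) - (v$3 * w$5 - v$5 * w$3)
     else (v$3 * w$4 - v$4 * w$3) - (v$1 * w$6 - v$6 * w$1) - (v$5 * w$2 - v$2 * w$5))"

lemma cross0_components:
  "cross0 v w $ 1 = (v$2 * w$3 - v$3 * w$2) + (v$4 * w$5 - v$5 * w$4) - (v$6 * w$7 - v$7 * w$6)"
  "cross0 v w $ 2 = (v$3 * w$1 - v$1 * w$3) + (v$4 * w$6 - v$6 * w$4) + (v$5 * w$7 - v$7 * w$5)"
  "cross0 v w $ 3 = (v$1 * w$2 - v$2 * w$1) + (v$4 * w$7 - v$7 * w$4) - (v$5 * w$6 - v$6 * w$5)"
  "cross0 v w $ 4 = (v$5 * w$1 - v$1 * w$5) + (v$6 * w$2 - v$2 * w$6) + (v$7 * w$3 - v$3 * w$7)"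
  "cross0 v w $ 5 = (v$1 * w$4 - v$4 * w$1) - (v$2 * w$7 - v$7 * w$2) - (v$6 * w$3 - v$3 * w$6)"
  "cross0 v w $ 6 = (v$2 * w$4 - v$4 * w$2) - (v$7 * w$1 - v$1 * w$7) - (v$3 * w$5 - v$5 * w$3)"
  "cross0 v w $ 7 = (v$3 * w$4 - v$4 * w$3) - (v$1 * w$6 - v$6 * w$1) - (v$5 * w$2 - v$2 * w$5)"
  by (simp_all add: cross0_def)

lemma inner_7: "(u::real^7) \<bullet> v = u$1 * v$1 + u$2 * v$2 + u$3 * v$3 + u$4 * v$4 + u$5 * v$5 + u$6 * v$6 + u$7 * v$7"
  by (simp add: inner_vec_def sum_7)

lemma inner_cross0: "u \<bullet> cross0 v w = phi0 u v w"
  by (simp add: inner_7 cross0_components phi0_def eps3_def det_3 vector_3 algebra_simps)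

lemma cross0_double: "cross0 u (cross0 u v) = (u \<bullet> v) *\<^sub>R u - (u \<bullet> u) *\<^sub>R v"
  unfolding vec_eq_iff forall_7
  by (simp add: cross0_components inner_7) (intro conjI; algebra)

lemma vector_cross_product_standard: "vector_cross_product (\<bullet>) cross0"
proof
  show "inner_form ((\<bullet>) :: real^7 \<Rightarrow> _)"
    by (simp add: inner_form_def inner_commute bilinear_conv_bounded_bilinear bounded_bilinear_inner)
  have "linear (cross0 u)" for u
    by (rule linearI) (simp_all add: vec_eq_iff forall_7 cross0_components algebra_simps)
  moreover have "linear (\<lambda>u. cross0 u v)" for v
    by (rule linearI) (simp_all add: vec_eq_iff forall_7 cross0_components algebra_simps)
  ultimately show "bilinear cross0" by (simp add: bilinear_def)
  show "cross0 u v = - cross0 v u" for u v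
    by (simp add: vec_eq_iff forall_7 cross0_components)
  show "u \<bullet> cross0 v w = v \<bullet> cross0 w u" for u v w
    by (simp add: inner_7 cross0_components algebra_simps)
  show "cross0 u (cross0 u v) = (u \<bullet> v) *\<^sub>R u - (u \<bullet> u) *\<^sub>R v" for u v by (rule cross0_double)
qed

text \<open>The axioms are invariant under linear isomorphisms, so that they pass from the standard
  structure to any structure with an adapted frame.\<close>

lemma vector_cross_product_frame:
  fixes E :: "real^7 \<Rightarrow> 'v::real_vector"
  assumes E: "linear E" "bij E" and bG: "bilinear G" and G: "\<And>a b. G (E a) (E b) = a \<bullet> b"
  shows "vector_cross_product G (\<lambda>v w. E (cross0 (inv E v) (inv E w)))"
    and "G u (E (cross0 (inv E v) (inv E w))) = phi0 (inv E u) (inv E v) (inv E w)"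
proof -
  interpret c0: vector_cross_product "(\<bullet>)" cross0 by (rule vector_cross_product_standard)
  have EF: "E (inv E v) = v" and FE: "inv E (E a) = a" for v a
    using E(2) by (simp_all add: bij_is_surj surj_f_inv_f bij_is_inj)
  have lF: "linear (inv E)"
    by (rule linearI) (metis EF FE linear_add[OF E(1)], metis EF FE linear_scale[OF E(1)])
  have GF: "G u v = inv E u \<bullet> inv E v" for u v using G[of "inv E u" "inv E v"] by (simp add: EF)
  show "vector_cross_product G (\<lambda>v w. E (cross0 (inv E v) (inv E w)))"
  proof
    have "a \<noteq> 0 \<Longrightarrow> inv E a \<noteq> 0" for a using EF[of a] linear_0[OF E(1)] by auto
    then show "inner_form G" by (simp add: inner_form_def bG GF inner_commute)
    show "bilinear (\<lambda>v w. E (cross0 (inv E v) (inv E w)))"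
      unfolding bilinear_def
      by (intro conjI allI linearI)
         (simp_all add: linear_add[OF lF] linear_scale[OF lF] c0.linX linear_add[OF E(1)] linear_scale[OF E(1)])
    show "E (cross0 (inv E u) (inv E v)) = - E (cross0 (inv E v) (inv E u))" for u v
      using c0.anti[of "inv E u" "inv E v"] linear_neg[OF E(1)] by simp
    show "G u (E (cross0 (inv E v) (inv E w))) = G v (E (cross0 (inv E w) (inv E u)))" for u v w
      using c0.cyclic by (simp add: GF FE)
    show "E (cross0 (inv E u) (inv E (E (cross0 (inv E u) (inv E v))))) = G u v *\<^sub>R u - G u u *\<^sub>R v" for u v
      by (simp add: FE c0.double GF linear_diff[OF E(1)] linear_scale[OF E(1)] EF)
  qed
  show "G u (E (cross0 (inv E v) (inv E w))) = phi0 (inv E u) (inv E v) (inv E w)"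
    by (simp add: GF FE inner_cross0)
qed

section \<open>Tangent vectors of the tangent bundle\<close>

definition bundle_chart ::
  "('a, 'b::euclidean_space) chart set \<Rightarrow> ('a, 'b) chart \<Rightarrow> ('a \<times> ('a, 'b) tvec, 'b \<times> 'b) chart" where
  "bundle_chart M c = ({(p, v). p \<in> fst c \<and> v \<in> tangent_space M p}, \<lambda>(p, v). (snd c p, v c))"

lemma tangent_bundle_eq: "tangent_bundle M = bundle_chart M ` M"
  unfolding tangent_bundle_def bundle_chart_def ..

lemma fst_bundle_chart: "(p, v) \<in> fst (bundle_chart M c) \<longleftrightarrow> p \<in> fst c \<and> v \<in> tangent_space M p"
  and snd_bundle_chart: "snd (bundle_chart M c) (p, v) = (snd c p, v c)"
  by (simp_all add: bundle_chart_def)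

lemma bundle_chart_inject:
  assumes M: "smooth_atlas M" and eq: "bundle_chart M c = bundle_chart M d"
  shows "c = d"
proof (rule prod_eqI)
  have "p \<in> fst e \<longleftrightarrow> (p, 0) \<in> fst (bundle_chart M e)" for p e
    by (simp add: fst_bundle_chart tangent_zero[OF M])
  then show "fst c = fst d" by (simp add: set_eq_iff eq)
  show "snd c = snd d"
  proof
    fix p
    show "snd c p = snd d p"
      using arg_cong[OF eq, of "\<lambda>D. fst (snd D (p, 0))"] by (simp add: snd_bundle_chart)
  qed
qed

text \<open>The vector at \<open>z = (x, n)\<close> whose projection to \<open>X\<close> is \<open>a\<close> and whose vertical part for the
  Levi-Civita connection is \<open>u\<close>: in a bundle chart, \<open>(a, u - \<Gamma>(a, n))\<close>. Every vector that occurs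
  below has this form, so that statements about the double tangent bundle reduce to statements
  about pairs \<open>a, u\<close> of tangent vectors of \<open>X\<close>.\<close>

definition connection_lift ::
  "('a, 'b::euclidean_space) chart set \<Rightarrow> ('a, 'b) metric_tensor \<Rightarrow> 'a \<times> ('a, 'b) tvec \<Rightarrow>
     ('a, 'b) tvec \<Rightarrow> ('a, 'b) tvec \<Rightarrow> ('a \<times> ('a, 'b) tvec, 'b \<times> 'b) tvec" where
  "connection_lift M g z a u =
     (\<lambda>D. if D \<in> tangent_bundle M \<and> z \<in> fst D
          then let c = (THE c. D = bundle_chart M c)
               in (a c, u c - levi_civita M g c (snd c (fst z)) (a c) (snd z c))
          else 0)"

context
  fixes X :: "('x, 'b::euclidean_space) chart set" and g :: "('x, 'b) metric_tensor"
  assumes X: "smooth_atlas X" and g: "riemannian_metric X g"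
begin

lemma connection_lift_component:
  assumes "c \<in> X" "x \<in> fst c" "n \<in> tangent_space X x"
  shows "connection_lift X g (x, n) a u (bundle_chart X c) =
     (a c, u c - levi_civita X g c (snd c x) (a c) (n c))"
proof -
  have "(THE c'. bundle_chart X c = bundle_chart X c') = c"
    by (rule the_equality) (auto dest: bundle_chart_inject[OF X])
  moreover have "bundle_chart X c \<in> tangent_bundle X" "(x, n) \<in> fst (bundle_chart X c)"
    using assms by (simp_all add: tangent_bundle_eq fst_bundle_chart)
  ultimately show ?thesis by (simp add: connection_lift_def)
qed

lemma connection_lift_eqI:
  assumes n: "n \<in> tangent_space X x"
    and 1: "\<And>c. c \<in> X \<Longrightarrow> x \<in> fst c \<Longrightarrow>
       \<xi> (bundle_chart X c) = (a c, u c - levi_civita X g c (snd c x) (a c) (n c))"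
    and 0: "\<And>D. \<not> (D \<in> tangent_bundle X \<and> (x, n) \<in> fst D) \<Longrightarrow> \<xi> D = 0"
  shows "\<xi> = connection_lift X g (x, n) a u"
proof
  fix D
  show "\<xi> D = connection_lift X g (x, n) a u D"
  proof (cases "D \<in> tangent_bundle X \<and> (x, n) \<in> fst D")
    case True
    then obtain c where c: "c \<in> X" "D = bundle_chart X c" by (auto simp: tangent_bundle_eq)
    have xc: "x \<in> fst c" using True c(2) by (simp add: fst_bundle_chart)
    show ?thesis by (simp only: c(2) 1[OF c(1) xc] connection_lift_component[OF c(1) xc n])
  next
    case False
    then show ?thesis using 0[OF False] by (auto simp: connection_lift_def)
  qed
qed

lemma connection_lift_add:
  assumes "n \<in> tangent_space X x"
  shows "connection_lift X g (x, n) (a + a') (u + u') =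
     connection_lift X g (x, n) a u + connection_lift X g (x, n) a' u'"
proof (rule connection_lift_eqI[OF assms, symmetric])
  fix c assume c: "c \<in> X" "x \<in> fst c"
  show "(connection_lift X g (x, n) a u + connection_lift X g (x, n) a' u') (bundle_chart X c) =
     ((a + a') c, (u + u') c - levi_civita X g c (snd c x) ((a + a') c) (n c))"
    using bilinear_ladd[OF levi_civita_bilinear[OF X g c(1) chart_image_mem[OF c(2)]]]
    by (simp add: connection_lift_component[OF c assms])
next
  fix D assume "\<not> (D \<in> tangent_bundle X \<and> (x, n) \<in> fst D)"
  then show "(connection_lift X g (x, n) a u + connection_lift X g (x, n) a' u') D = 0"
    by (auto simp: connection_lift_def)
qed

lemma connection_lift_inject:
  assumes x: "x \<in> carrier X" and n: "n \<in> tangent_space X x"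
    and T: "a \<in> tangent_space X x" "u \<in> tangent_space X x" "a' \<in> tangent_space X x" "u' \<in> tangent_space X x"
    and eq: "connection_lift X g (x, n) a u = connection_lift X g (x, n) a' u'"
  shows "a = a'" "u = u'"
proof -
  have c: "chart_at X x \<in> X" "x \<in> fst (chart_at X x)" using chart_at_mem[OF x] by auto
  have 1: "a (chart_at X x) = a' (chart_at X x)" and 2: "u (chart_at X x) = u' (chart_at X x)"
    using fun_cong[OF eq, of "bundle_chart X (chart_at X x)"]
    by (auto simp: connection_lift_component[OF c n])
  show "a = a'" by (rule tangent_eqI[OF X T(1,3) c 1])
  show "u = u'" by (rule tangent_eqI[OF X T(2,4) c 2])
qed

lemma bundle_chart_inv:
  assumes c: "c \<in> X" and y: "y \<in> chart_image c"
  shows "chart_inv (bundle_chart X c) (y, a) = (chart_inv c y, tangent_of X c (chart_inv c y) a)"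
proof -
  let ?p = "chart_inv c y"
  have p: "?p \<in> fst c" "snd c ?p = y" using chart_inv_mem[OF y] chart_chart_inv[OF y] by auto
  have "inj_on (snd (bundle_chart X c)) (fst (bundle_chart X c))"
  proof (rule inj_onI, clarify)
    fix p v q w
    assume pv: "(p, v) \<in> fst (bundle_chart X c)" and qw: "(q, w) \<in> fst (bundle_chart X c)"
      and eq: "snd (bundle_chart X c) (p, v) = snd (bundle_chart X c) (q, w)"
    from eq have e: "snd c p = snd c q" "v c = w c" by (simp_all add: snd_bundle_chart)
    have pq: "p = q"
    proof -
      have "chart_inv c (snd c p) = p" by (rule chart_inv_chart[OF X c]) (use pv in \<open>simp add: fst_bundle_chart\<close>)
      moreover have "chart_inv c (snd c q) = q" by (rule chart_inv_chart[OF X c]) (use qw in \<open>simp add: fst_bundle_chart\<close>)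
      ultimately show ?thesis using e(1) by metis
    qed
    have "v = w"
    proof (rule tangent_eqI[OF X])
      show "v \<in> tangent_space X p" "w \<in> tangent_space X p" "p \<in> fst c"
        using pv qw pq by (simp_all add: fst_bundle_chart)
      show "c \<in> X" "v c = w c" by (rule c, rule e(2))
    qed
    then show "p = q \<and> v = w" using pq by simp
  qed
  moreover have "(?p, tangent_of X c ?p a) \<in> fst (bundle_chart X c)"
    using p(1) tangent_of_mem[OF X c p(1)] by (simp add: fst_bundle_chart)
  moreover have "snd (bundle_chart X c) (?p, tangent_of X c ?p a) = (y, a)"
    using p tangent_of_same[OF X c p(1)] by (simp add: snd_bundle_chart)
  ultimately show ?thesis unfolding chart_inv_def[of "bundle_chart X c"] by (metis inv_into_f_f)
qed

lemma proj_connection_lift: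
  assumes x: "x \<in> carrier X" and n: "n \<in> tangent_space X x" and a: "a \<in> tangent_space X x"
  shows "differential (tangent_bundle X) X fst (x, n) (connection_lift X g (x, n) a u) = a"
proof
  fix d
  have "(x, n) \<in> carrier (tangent_bundle X)"
    using x n by (auto simp: carrier_def tangent_bundle_eq fst_bundle_chart)
  from chart_at_mem[OF this] obtain c where c: "c \<in> X" "chart_at (tangent_bundle X) (x, n) = bundle_chart X c"
    "(x, n) \<in> fst (bundle_chart X c)" by (auto simp: tangent_bundle_eq)
  then have xc: "x \<in> fst c" by (simp add: fst_bundle_chart)
  show "differential (tangent_bundle X) X fst (x, n) (connection_lift X g (x, n) a u) d = a d"
  proof (cases "d \<in> X \<and> x \<in> fst d")
    case True
    then have d: "d \<in> X" "x \<in> fst d" by auto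
    have td: "((snd d \<circ> chart_inv c) has_derivative transition_jacobian c d (snd c x)) (at (fst (snd c x, n c)))"
      unfolding fst_conv by (rule transition_has_derivative[OF X c(1) d(1) xc d(2)])
    have "((\<lambda>y. (snd d \<circ> chart_inv c) (fst y)) has_derivative (\<lambda>v. transition_jacobian c d (snd c x) (fst v))) (at (snd c x, n c))"
      by (rule has_derivative_compose[OF has_derivative_fst[OF has_derivative_ident] td])
    then have "(in_charts (bundle_chart X c) d fst has_derivative
        (\<lambda>v. transition_jacobian c d (snd c x) (fst v))) (at (snd c x, n c))"
    proof (rule has_derivative_transform_within_open)
      show "open (chart_image c \<times> (UNIV :: 'b set))" by (intro open_Times open_chart_image[OF X c(1)]) simp
      show "(snd c x, n c) \<in> chart_image c \<times> UNIV" using chart_image_mem[OF xc] by simp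
      fix y :: "'b \<times> 'b" assume "y \<in> chart_image c \<times> UNIV"
      then show "(snd d \<circ> chart_inv c) (fst y) = in_charts (bundle_chart X c) d fst y"
        using bundle_chart_inv[OF c(1), of "fst y" "snd y"] by auto
    qed
    from frechet_derivative_eqI[OF this] show ?thesis
      using d tangent_transition[OF X a c(1) xc d]
      by (simp add: differential_def c(2) snd_bundle_chart connection_lift_component[OF c(1) xc n])
  next
    case False
    then show ?thesis using tangent_outside[OF X a False] by (auto simp: differential_def)
  qed
qed

text \<open>Curves of tangent vectors are built in one chart. Here their velocity and their covariant
  derivative are carried over to the other charts, which is what the definitions of parallel fields
  and of velocities in the tangent bundle ask for.\<close>

lemma curve_transition:
  assumes c: "c \<in> X" and T: "open T" "t \<in> T"
    and curve: "\<And>s. s \<in> T \<Longrightarrow> \<gamma> s \<in> fst c" "\<And>s. s \<in> T \<Longrightarrow> w s \<in> tangent_space X (\<gamma> s)"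
    and y': "((\<lambda>s. snd c (\<gamma> s)) has_vector_derivative y') (at t)"
    and w': "((\<lambda>s. w s c) has_vector_derivative w') (at t)"
    and d: "d \<in> X" "\<gamma> t \<in> fst d"
  defines "J \<equiv> transition_jacobian c d (snd c (\<gamma> t))"
  shows "((\<lambda>s. snd d (\<gamma> s)) has_vector_derivative J y') (at t)"
    and "((\<lambda>s. w s d) has_vector_derivative
       J (w' + levi_civita X g c (snd c (\<gamma> t)) y' (w t c)) - levi_civita X g d (snd d (\<gamma> t)) (J y') (w t d)) (at t)"
proof -
  have tc: "\<gamma> t \<in> fst c" by (rule curve(1)[OF T(2)])
  have yD: "((\<lambda>s. snd c (\<gamma> s)) has_derivative (\<lambda>r. r *\<^sub>R y')) (at t)"
    and wD: "((\<lambda>s. w s c) has_derivative (\<lambda>r. r *\<^sub>R w')) (at t)"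
    using y' w' by (simp_all add: has_vector_derivative_def)
  have lJ: "linear J" unfolding J_def by (rule transition_linear[OF X c d(1) tc d(2)])
  have b\<Gamma>: "bilinear (levi_civita X g c (snd c (\<gamma> t)))" "bilinear (levi_civita X g d (snd d (\<gamma> t)))"
    by (rule levi_civita_bilinear[OF X g], rule c, rule chart_image_mem[OF tc])
       (rule levi_civita_bilinear[OF X g], rule d, rule chart_image_mem[OF d(2)])
  have "isCont (\<lambda>s. snd c (\<gamma> s)) t" using yD has_derivative_continuous by blast
  moreover have ov: "open (snd c ` (fst c \<inter> fst d))" by (rule open_overlap[OF X c d(1)])
  moreover have "snd c (\<gamma> t) \<in> snd c ` (fst c \<inter> fst d)" using tc d by blast
  ultimately obtain V where V: "open V" "t \<in> V" "\<And>s. s \<in> V \<Longrightarrow> snd c (\<gamma> s) \<in> snd c ` (fst c \<inter> fst d)"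
    unfolding continuous_at_open by metis
  have in_d: "\<gamma> s \<in> fst c" "\<gamma> s \<in> fst d" if "s \<in> T \<inter> V" for s
  proof -
    show "\<gamma> s \<in> fst c" using that curve(1) by simp
    then have "chart_inv c (snd c (\<gamma> s)) = \<gamma> s" by (rule chart_inv_chart[OF X c])
    moreover have "chart_inv c (snd c (\<gamma> s)) \<in> fst d"
      using V(3) that unfolding overlap_iff[OF X c] by blast
    ultimately show "\<gamma> s \<in> fst d" by simp
  qed
  have TV: "open (T \<inter> V)" "t \<in> T \<inter> V" using T V by auto
  have "((\<lambda>s. (snd d \<circ> chart_inv c) (snd c (\<gamma> s))) has_derivative (\<lambda>r. J (r *\<^sub>R y'))) (at t)"
    unfolding J_def
    by (rule has_derivative_compose[OF yD transition_has_derivative[OF X c d(1) tc d(2)]])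
  then have "((\<lambda>s. snd d (\<gamma> s)) has_derivative (\<lambda>r. J (r *\<^sub>R y'))) (at t)"
    by (rule has_derivative_transform_within_open[OF _ TV]) (simp add: chart_inv_chart[OF X c in_d(1)])
  then show "((\<lambda>s. snd d (\<gamma> s)) has_vector_derivative J y') (at t)"
    by (simp add: has_vector_derivative_def linear_scale[OF lJ])
  have wd: "transition_jacobian c d (snd c (\<gamma> s)) (w s c) = w s d" if "s \<in> T \<inter> V" for s
    by (rule tangent_transition[OF X _ c in_d(1)[OF that] d(1) in_d(2)[OF that], symmetric])
       (use that curve(2) in simp)
  have "((\<lambda>s. transition_jacobian c d (snd c (\<gamma> s)) (w s c)) has_derivative
     (\<lambda>r. J (r *\<^sub>R w' + levi_civita X g c (snd c (\<gamma> t)) (r *\<^sub>R y') (w t c))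
        - levi_civita X g d (snd d (\<gamma> t)) (J (r *\<^sub>R y')) (J (w t c)))) (at t)"
    unfolding J_def by (rule covariant_derivative_transition[OF X g c tc d refl yD wD])
  then have "((\<lambda>s. w s d) has_derivative
     (\<lambda>r. J (r *\<^sub>R w' + levi_civita X g c (snd c (\<gamma> t)) (r *\<^sub>R y') (w t c))
        - levi_civita X g d (snd d (\<gamma> t)) (J (r *\<^sub>R y')) (J (w t c)))) (at t)"
    by (rule has_derivative_transform_within_open[OF _ TV]) (rule wd)
  moreover have "J (w t c) = w t d" using wd[OF TV(2)] by (simp add: J_def)
  ultimately show "((\<lambda>s. w s d) has_vector_derivative
       J (w' + levi_civita X g c (snd c (\<gamma> t)) y' (w t c)) - levi_civita X g d (snd d (\<gamma> t)) (J y') (w t d)) (at t)"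
    unfolding has_vector_derivative_def
    by (elim has_derivative_eq_rhs)
       (simp add: fun_eq_iff bilinear_lmul[OF b\<Gamma>(1)] bilinear_lmul[OF b\<Gamma>(2)] linear_scale[OF lJ]
         scaleR_diff_right flip: scaleR_add_right)
qed

lemma velocity_connection_lift:
  assumes c: "c \<in> X" and T: "open T" "0 \<in> T"
    and curve: "\<And>s. s \<in> T \<Longrightarrow> \<gamma> s \<in> fst c" "\<And>s. s \<in> T \<Longrightarrow> w s \<in> tangent_space X (\<gamma> s)"
    and y': "((\<lambda>s. snd c (\<gamma> s)) has_vector_derivative y') (at 0)"
    and w': "((\<lambda>s. w s c) has_vector_derivative w') (at 0)"
  shows "velocity (tangent_bundle X) (\<lambda>t. (\<gamma> t, w t)) 0 =
     connection_lift X g (\<gamma> 0, w 0) (tangent_of X c (\<gamma> 0) y')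
       (tangent_of X c (\<gamma> 0) (w' + levi_civita X g c (snd c (\<gamma> 0)) y' (w 0 c)))"
proof (rule connection_lift_eqI)
  show w0: "w 0 \<in> tangent_space X (\<gamma> 0)" by (rule curve(2)[OF T(2)])
  fix d assume d: "d \<in> X" "\<gamma> 0 \<in> fst d"
  have "((\<lambda>t. (snd d (\<gamma> t), w t d)) has_vector_derivative
      (transition_jacobian c d (snd c (\<gamma> 0)) y',
       transition_jacobian c d (snd c (\<gamma> 0)) (w' + levi_civita X g c (snd c (\<gamma> 0)) y' (w 0 c))
         - levi_civita X g d (snd d (\<gamma> 0)) (transition_jacobian c d (snd c (\<gamma> 0)) y') (w 0 d))) (at 0)"
    by (rule has_vector_derivative_Pair[OF curve_transition(1)[OF c T curve y' w' d] curve_transition(2)[OF c T curve y' w' d]])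
  then have "vector_derivative (snd (bundle_chart X d) \<circ> (\<lambda>t. (\<gamma> t, w t))) (at 0) =
      (transition_jacobian c d (snd c (\<gamma> 0)) y',
       transition_jacobian c d (snd c (\<gamma> 0)) (w' + levi_civita X g c (snd c (\<gamma> 0)) y' (w 0 c))
         - levi_civita X g d (snd d (\<gamma> 0)) (transition_jacobian c d (snd c (\<gamma> 0)) y') (w 0 d))"
    by (simp add: vector_derivative_at comp_def snd_bundle_chart)
  moreover have "bundle_chart X d \<in> tangent_bundle X" "(\<gamma> 0, w 0) \<in> fst (bundle_chart X d)"
    using d w0 by (simp_all add: tangent_bundle_eq fst_bundle_chart)
  ultimately show "velocity (tangent_bundle X) (\<lambda>t. (\<gamma> t, w t)) 0 (bundle_chart X d) =
      (tangent_of X c (\<gamma> 0) y' d,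
       tangent_of X c (\<gamma> 0) (w' + levi_civita X g c (snd c (\<gamma> 0)) y' (w 0 c)) d
       - levi_civita X g d (snd d (\<gamma> 0)) (tangent_of X c (\<gamma> 0) y' d) (w 0 d))"
    using d by (simp add: velocity_def tangent_of_def)
next
  fix D assume "\<not> (D \<in> tangent_bundle X \<and> (\<gamma> 0, w 0) \<in> fst D)"
  then show "velocity (tangent_bundle X) (\<lambda>t. (\<gamma> t, w t)) 0 D = 0" by (auto simp: velocity_def)
qed

end

section \<open>The sphere bundle and its distribution\<close>

lemma smooth_on_line: "smooth_on T (\<lambda>t::real. a + t *\<^sub>R b)"
  by (rule smooth_on_subset[of UNIV])
     (intro smooth_on_add smooth_on_const smooth_on_linear bounded_linear_scaleR_left, simp_all)

lemma smooth_on_bilinear_family: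
  fixes B :: "'p::euclidean_space \<Rightarrow> 'a::euclidean_space \<Rightarrow> 'a \<Rightarrow> real"
  assumes T: "open T" and O: "open O'" "\<And>t. t \<in> T \<Longrightarrow> Y t \<in> O'"
    and B: "\<And>y. y \<in> O' \<Longrightarrow> bilinear (B y)" "\<And>a b. smooth_on O' (\<lambda>y. B y a b)"
    and Y: "smooth_on T Y" and s: "smooth_on T s" "smooth_on T s'"
  shows "smooth_on T (\<lambda>t. B (Y t) (s t) (s' t))"
proof -
  have exp: "B y a b = (\<Sum>i\<in>Basis. \<Sum>j\<in>Basis. ((a \<bullet> i) * (b \<bullet> j)) * B y i j)" if "y \<in> O'" for y a b
  proof -
    have "B y a b = B y (\<Sum>i\<in>Basis. (a \<bullet> i) *\<^sub>R i) (\<Sum>j\<in>Basis. (b \<bullet> j) *\<^sub>R j)"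
      by (simp add: euclidean_representation)
    also have "\<dots> = (\<Sum>i\<in>Basis. \<Sum>j\<in>Basis. ((a \<bullet> i) * (b \<bullet> j)) * B y i j)"
      by (simp add: bilinear_sum[OF B(1)[OF that]] bilinear_lmul[OF B(1)[OF that]]
          bilinear_rmul[OF B(1)[OF that]] sum.cartesian_product mult_ac)
    finally show ?thesis .
  qed
  have "smooth_on T (\<lambda>t. \<Sum>i\<in>Basis. \<Sum>j\<in>Basis. ((s t \<bullet> i) * (s' t \<bullet> j)) * B (Y t) i j)"
    by (intro smooth_on_sum[OF T] finite_Basis smooth_on_bilinear[OF bounded_bilinear_mult T]
        smooth_on_bilinear[OF bounded_bilinear_inner T] s smooth_on_const
        smooth_on_compose[OF T O(1) B(2) Y]) (use O in auto)
  then show ?thesis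
    by (rule smooth_on_cong[OF T, THEN iffD1, rotated]) (rule exp[OF O(2), symmetric])
qed

context
  fixes X :: "('x, real^7) chart set" and g :: "('x, real^7) metric_tensor"
  assumes X: "smooth_atlas X" and g: "riemannian_metric X g"
begin

lemma chart_line:
  assumes c: "c \<in> X" "x \<in> fst c"
  obtains r where "r > 0" "\<And>t. t \<in> {-r..r} \<Longrightarrow> snd c x + t *\<^sub>R (a :: real^7) \<in> chart_image c"
proof -
  have "isCont (\<lambda>t. snd c x + t *\<^sub>R a) 0" by (intro continuous_intros)
  then have "\<exists>S. open S \<and> 0 \<in> S \<and> (\<forall>t\<in>S. snd c x + t *\<^sub>R a \<in> chart_image c)"
    using open_chart_image[OF X c(1)] chart_image_mem[OF c(2)]
    unfolding continuous_at_open by (metis add.right_neutral scale_zero_left)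
  then obtain S where S: "open S" "0 \<in> S" "\<And>t. t \<in> S \<Longrightarrow> snd c x + t *\<^sub>R a \<in> chart_image c" by blast
  then obtain r where "r > 0" "cball 0 r \<subseteq> S" using open_contains_cball by blast
  then show ?thesis using that[of r] S(3) by (auto simp: cball_eq_atLeastAtMost subset_iff)
qed

lemma interval_chart_inv:
  assumes "t \<in> {-e<..<e}"
  shows "chart_inv ({-e<..<e}, \<lambda>t. t) t = (t::real)"
  using assms inv_into_f_f[of "\<lambda>t. t" "{-e<..<e}" t] by (simp add: chart_inv_def inj_on_def)

lemma smooth_map_intervalI:
  fixes \<zeta> :: "real \<Rightarrow> 'c" and N :: "('c, 'd::euclidean_space) chart set"
  assumes "D \<in> N" "\<And>t. t \<in> {-e<..<e} \<Longrightarrow> \<zeta> t \<in> fst D"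
    and "smooth_on {-e<..<e} (\<lambda>t. snd D (\<zeta> t))"
  shows "smooth_map (interval_manifold e) N \<zeta>"
  unfolding smooth_map_def
proof
  let ?c = "({-e<..<e}, \<lambda>t. t) :: (real, real) chart"
  fix p assume "p \<in> carrier (interval_manifold e)"
  then have p: "p \<in> {-e<..<e}" by (simp add: carrier_def interval_manifold_def)
  have "smooth_on {-e<..<e} (in_charts ?c D \<zeta>)"
    by (rule smooth_on_cong[OF _ _, THEN iffD1, rotated 2, OF assms(3)]) (simp_all add: interval_chart_inv)
  then show "\<exists>c\<in>interval_manifold e. \<exists>d\<in>N. \<exists>U. p \<in> fst c \<and> open U \<and> snd c p \<in> U \<and> U \<subseteq> chart_image c \<and>
        \<zeta> ` (chart_inv c ` U) \<subseteq> fst d \<and> smooth_on U (in_charts c d \<zeta>)"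
    using p assms(1,2)
    by (intro bexI[of _ ?c] bexI[of _ D] exI[of _ "{-e<..<e}"])
       (auto simp: interval_chart_inv chart_image_def interval_manifold_def)
qed

text \<open>Normalizing a straight line in a bundle chart gives a curve of unit vectors. Its vertical
  velocity is the prescribed one if that is orthogonal to \<open>n\<close>.\<close>

lemma connection_lift_in_TZ7:
  assumes x: "x \<in> carrier X" and n: "n \<in> tangent_space X x" "g x n n = 1"
    and a: "a \<in> tangent_space X x" and u: "u \<in> tangent_space X x" "g x n u = 0"
  shows "connection_lift X g (x, n) a u \<in> TZ7 X g (x, n)"
proof -
  define c where "c = chart_at X x"
  have c: "c \<in> X" "x \<in> fst c" using chart_at_mem[OF x] by (auto simp: c_def)
  define y0 where "y0 = snd c x"
  define m where "m = metric_coord X g c"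
  have y0: "y0 \<in> chart_image c" unfolding y0_def by (rule chart_image_mem[OF c(2)])
  obtain r where r: "r > 0" "\<And>t. t \<in> {-r..r} \<Longrightarrow> y0 + t *\<^sub>R a c \<in> chart_image c"
    using chart_line[OF c] unfolding y0_def by metis
  \<comment> \<open>The fibre component of the prescribed vector in the bundle chart.\<close>
  define w1 where "w1 = u c - levi_civita X g c y0 (a c) (n c)"
  define Y where "Y t = y0 + t *\<^sub>R a c" for t :: real
  define b where "b t = n c + t *\<^sub>R w1" for t :: real
  define q where "q t = m (Y t) (b t) (b t)" for t
  have Ym: "Y t \<in> chart_image c" if "t \<in> {-r<..<r}" for t
    using r(2)[of t] that by (simp add: Y_def)
  have sY: "smooth_on T Y" for T unfolding Y_def by (rule smooth_on_line)
  have sb: "smooth_on T b" for T unfolding b_def by (rule smooth_on_line)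
  have sq: "smooth_on {-r<..<r} q"
    unfolding q_def m_def
    by (rule smooth_on_bilinear_family[OF _ open_chart_image[OF X c(1)] Ym metric_bilinear[OF g c(1)]
          metric_smooth[OF g c(1)] sY sb sb]) simp_all
  have q0: "q 0 = 1"
    using n(2) metric_tangent[OF X g c n(1) n(1)] by (simp add: q_def Y_def b_def m_def y0_def)
  have "continuous_on {-r<..<r} q" by (rule smooth_on_continuous_on[OF sq])
  then have "open ({-r<..<r} \<inter> q -` {0<..})"
    by (rule continuous_open_preimage) simp_all
  moreover have "0 \<in> {-r<..<r} \<inter> q -` {0<..}" using q0 r(1) by simp
  ultimately obtain e where e: "e > 0" "ball 0 e \<subseteq> {-r<..<r} \<inter> q -` {0<..}"
    using open_contains_ball by blast
  have qpos: "q t > 0" if "t \<in> {-e<..<e}" for t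
    using e(2) that by (auto simp: ball_eq_greaterThanLessThan)
  have eT: "{-e<..<e} \<subseteq> {-r<..<r}"
    using e(2) by (auto simp: ball_eq_greaterThanLessThan)
  define W where "W t = (q t powr (-1/2)) *\<^sub>R b t" for t
  define \<gamma> where "\<gamma> t = chart_inv c (Y t)" for t
  define w where "w t = tangent_of X c (\<gamma> t) (W t)" for t
  have \<gamma>c: "\<gamma> t \<in> fst c" "snd c (\<gamma> t) = Y t" if "t \<in> {-e<..<e}" for t
    using chart_inv_mem[OF Ym] chart_chart_inv[OF Ym] eT that by (auto simp: \<gamma>_def)
  have w: "w t \<in> tangent_space X (\<gamma> t)" "w t c = W t" if "t \<in> {-e<..<e}" for t
    unfolding w_def by (rule tangent_of_mem[OF X c(1) \<gamma>c(1)[OF that]], rule tangent_of_same[OF X c(1) \<gamma>c(1)[OF that]])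
  have \<gamma>0: "\<gamma> 0 = x" using chart_inv_chart[OF X c] by (simp add: \<gamma>_def Y_def y0_def)
  have w0: "w 0 = n"
    using tangent_of_component[OF X n(1) c] by (simp add: w_def \<gamma>0 W_def q0 b_def)
  have sW: "smooth_on {-e<..<e} W"
    unfolding W_def
    by (intro smooth_on_bilinear[OF bounded_bilinear_scaleR] sb open_greaterThanLessThan
        smooth_on_compose[OF _ open_greaterThan smooth_on_powr smooth_on_subset[OF sq eT]])
       (use qpos in auto)
  have unit: "g (\<gamma> t) (w t) (w t) = 1" if t: "t \<in> {-e<..<e}" for t
  proof -
    have bm: "bilinear (m (Y t))" unfolding m_def
      by (rule metric_bilinear[OF g c(1) Ym]) (use eT t in blast)
    have "g (\<gamma> t) (w t) (w t) = m (Y t) (W t) (W t)"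
      using metric_tangent[OF X g c(1) \<gamma>c(1)[OF t] w(1)[OF t] w(1)[OF t]] by (simp add: m_def \<gamma>c[OF t] w(2)[OF t])
    also have "\<dots> = q t powr (-1/2) * (q t powr (-1/2) * q t)"
      by (simp add: W_def q_def bilinear_lmul[OF bm] bilinear_rmul[OF bm])
    also have "\<dots> = q t powr (-1/2) * q t powr (-1/2) * q t powr 1"
      using qpos[OF t] by simp
    also have "\<dots> = 1" using qpos[OF t] by (simp only: powr_add[symmetric]) simp
    finally show ?thesis .
  qed
  \<comment> \<open>The squared length is stationary because \<open>u\<close> is orthogonal to \<open>n\<close>, so normalizing does not change
    the velocity.\<close>
  have dq: "(q has_derivative (\<lambda>v. 0)) (at 0)"
  proof -
    have dY: "(Y has_derivative (\<lambda>v. v *\<^sub>R a c)) (at 0)" unfolding Y_def by (auto intro!: derivative_eq_intros)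
    have db: "(b has_derivative (\<lambda>v. v *\<^sub>R w1)) (at 0)" unfolding b_def by (auto intro!: derivative_eq_intros)
    have Y0: "Y 0 = y0" and b0: "b 0 = n c" by (simp_all add: Y_def b_def)
    have "(q has_derivative (\<lambda>v. metric_derivative X g c (Y 0) (v *\<^sub>R a c) (b 0) (b 0) + m (Y 0) (v *\<^sub>R w1) (b 0)
            + m (Y 0) (b 0) (v *\<^sub>R w1))) (at 0)"
      unfolding q_def m_def
      by (rule has_derivative_bilinear_family[OF open_chart_image[OF X c(1)] _ metric_bilinear[OF g c(1)]
            metric_coord_has_derivative[OF X g c(1)] dY db db]) (simp_all add: Y0 y0)
    moreover have "metric_derivative X g c (Y 0) (v *\<^sub>R a c) (b 0) (b 0) + m (Y 0) (v *\<^sub>R w1) (b 0)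
            + m (Y 0) (b 0) (v *\<^sub>R w1) = 0" for v
    proof -
      have bm: "bilinear (m y0)" and sm: "m y0 p q = m y0 q p" for p q
        using metric_coord_inner_form[OF X g c(1) y0] by (auto simp: m_def inner_form_def)
      have bG: "bilinear (levi_civita X g c y0)" by (rule levi_civita_bilinear[OF X g c(1) y0])
      have "m y0 (n c) (u c) = 0"
        using u(2) metric_tangent[OF X g c n(1) u(1)] by (simp add: m_def y0_def)
      then have "m y0 (u c) (n c) = 0" "m y0 (n c) (u c) = 0" using sm by simp_all
      then show ?thesis
        unfolding Y0 b0 levi_civita_metric[OF X g c(1) y0] unfolding m_def[symmetric]
        by (simp add: w1_def bilinear_lmul[OF bG] bilinear_lmul[OF bm] bilinear_rmul[OF bm]
            bilinear_lsub[OF bm] bilinear_rsub[OF bm] algebra_simps)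
    qed
    ultimately show ?thesis by simp
  qed
  have dW: "(W has_vector_derivative w1) (at 0)"
  proof -
    have "((\<lambda>t. q t powr (-1/2)) has_derivative (\<lambda>v. 0)) (at 0)"
    proof -
      have "((\<lambda>x. x powr (-1/2)) has_derivative frechet_derivative (\<lambda>x. x powr (-1/2)) (at (q 0))) (at (q 0))"
        by (rule smooth_on_has_derivative[OF smooth_on_powr]) (simp add: q0)
      from has_derivative_compose[OF dq this] linear_0[OF has_derivative_linear[OF this]]
      show ?thesis by simp
    qed
    moreover have "(b has_derivative (\<lambda>v. v *\<^sub>R w1)) (at 0)" unfolding b_def by (auto intro!: derivative_eq_intros)
    ultimately have "(W has_derivative (\<lambda>v. (q 0 powr (-1/2)) *\<^sub>R (v *\<^sub>R w1) + 0 *\<^sub>R b 0)) (at 0)"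
      unfolding W_def by (rule has_derivative_scaleR)
    then show ?thesis by (simp add: q0 has_vector_derivative_def)
  qed
  have zI: "0 \<in> {-e<..<e}" using e(1) by simp
  have "(Y has_vector_derivative a c) (at 0)"
    unfolding Y_def has_vector_derivative_def by (auto intro!: derivative_eq_intros)
  then have dY': "((\<lambda>s. snd c (\<gamma> s)) has_vector_derivative a c) (at 0)"
    by (rule has_vector_derivative_transform_within_open[OF _ open_greaterThanLessThan zI])
       (simp only: \<gamma>c(2))
  have dw': "((\<lambda>s. w s c) has_vector_derivative w1) (at 0)"
    by (rule has_vector_derivative_transform_within_open[OF dW _ zI]) (simp_all add: w(2))
  have "velocity (tangent_bundle X) (\<lambda>t. (\<gamma> t, w t)) 0 = connection_lift X g (\<gamma> 0, w 0)
      (tangent_of X c (\<gamma> 0) (a c)) (tangent_of X c (\<gamma> 0) (w1 + levi_civita X g c (snd c (\<gamma> 0)) (a c) (w 0 c)))"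
    by (rule velocity_connection_lift[OF X g c(1) _ zI \<gamma>c(1) w(1) dY' dw']) simp_all
  also have "\<dots> = connection_lift X g (x, n) a u"
    by (simp add: \<gamma>0 w0 w1_def y0_def[symmetric] tangent_of_component[OF X a c] tangent_of_component[OF X u(1) c])
  finally have vel: "velocity (tangent_bundle X) (\<lambda>t. (\<gamma> t, w t)) 0 = connection_lift X g (x, n) a u" .
  have sm: "smooth_map (interval_manifold e) (tangent_bundle X) (\<lambda>t. (\<gamma> t, w t))"
  proof (rule smooth_map_intervalI)
    show "bundle_chart X c \<in> tangent_bundle X" using c(1) by (simp add: tangent_bundle_eq)
    show "(\<gamma> t, w t) \<in> fst (bundle_chart X c)" if "t \<in> {-e<..<e}" for t
      using \<gamma>c(1)[OF that] w(1)[OF that] by (simp add: fst_bundle_chart)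
    have "smooth_on {-e<..<e} (\<lambda>t. (Y t, W t))"
      by (rule smooth_on_Pair[OF open_greaterThanLessThan sY sW])
    then show "smooth_on {-e<..<e} (\<lambda>t. snd (bundle_chart X c) (\<gamma> t, w t))"
      by (rule smooth_on_cong[OF open_greaterThanLessThan, THEN iffD1, rotated])
         (simp add: snd_bundle_chart \<gamma>c(2) w(2))
  qed
  have "(\<gamma> t, w t) \<in> Z7 X g" if "t \<in> {-e<..<e}" for t
    using unit[OF that] w(1)[OF that] carrier_mem[OF c(1) \<gamma>c(1)[OF that]] by (simp add: Z7_def)
  then show ?thesis
    unfolding TZ7_def using e(1) sm vel \<gamma>0 w0
    by (intro CollectI exI[of _ "\<lambda>t. (\<gamma> t, w t)"] exI[of _ e]) simp
qed

lemma vertical_lift_eq: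
  assumes x: "x \<in> carrier X" and n: "n \<in> tangent_space X x" and u: "u \<in> tangent_space X x"
  shows "vertical_lift X (x, n) u = connection_lift X g (x, n) 0 u"
proof -
  define c where "c = chart_at X x"
  have c: "c \<in> X" "x \<in> fst c" using chart_at_mem[OF x] by (auto simp: c_def)
  have w: "n + tv_scale s u \<in> tangent_space X x" for s
    by (rule tangent_add[OF X n tangent_tv_scale[OF X u u]])
  have "velocity (tangent_bundle X) (\<lambda>t. (x, n + tv_scale t u)) 0 =
     connection_lift X g (x, n + tv_scale 0 u) (tangent_of X c x 0)
       (tangent_of X c x (u c + levi_civita X g c (snd c x) 0 ((n + tv_scale 0 u) c)))"
  proof (rule velocity_connection_lift[OF X g c(1) open_UNIV])
    show "((\<lambda>s. snd c x) has_vector_derivative 0) (at (0::real))" by simp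
    show "((\<lambda>s. (n + tv_scale s u) c) has_vector_derivative u c) (at 0)"
      by (auto simp: tv_scale_def has_vector_derivative_def intro!: derivative_eq_intros)
  qed (use c(2) w in auto)
  moreover have "n + tv_scale 0 u = n" by (simp add: tv_scale_def fun_eq_iff)
  moreover have "tangent_of X c x 0 = 0"
    using tangent_of_component[OF X tangent_zero[OF X] c] by simp
  moreover have "levi_civita X g c (snd c x) 0 v = 0" for v
    by (rule bilinear_lzero[OF levi_civita_bilinear[OF X g c(1) chart_image_mem[OF c(2)]]])
  ultimately show ?thesis
    by (simp add: vertical_lift_def tangent_of_component[OF X u c])
qed

text \<open>A parallel field has vanishing covariant derivative, so its velocity has no vertical part.\<close>

lemma horizontal_space_lift:
  assumes x: "x \<in> carrier X" and n: "n \<in> tangent_space X x" and \<xi>: "\<xi> \<in> horizontal_space X g (x, n)"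
  obtains a where "a \<in> tangent_space X x" "\<xi> = connection_lift X g (x, n) a 0"
proof -
  obtain \<gamma> w e where e: "e > 0" and sm: "smooth_map (interval_manifold e) X \<gamma>"
    and par: "parallel_along X g {-e<..<e} \<gamma> w" and z: "\<gamma> 0 = x" "w 0 = n"
    and \<xi>: "\<xi> = velocity (tangent_bundle X) (\<lambda>t. (\<gamma> t, w t)) 0"
    using \<xi> by (auto simp: horizontal_space_def)
  define c where "c = chart_at X x"
  have c: "c \<in> X" "x \<in> fst c" using chart_at_mem[OF x] by (auto simp: c_def)
  let ?I = "({-e<..<e}, \<lambda>t. t) :: (real, real) chart"
  have I: "?I \<in> interval_manifold e" "0 \<in> fst ?I" using e by (auto simp: interval_manifold_def)
  obtain U where U: "open U" "snd ?I 0 \<in> U" "U \<subseteq> chart_image ?I" "\<gamma> ` (chart_inv ?I ` U) \<subseteq> fst c"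
      "smooth_on U (in_charts ?I c \<gamma>)"
    by (rule smooth_map_in_charts[OF smooth_atlas_interval X sm I c(1)]) (simp_all add: z(1) c(2))
  have Ue: "U \<subseteq> {-e<..<e}" using U(3) by (simp add: chart_image_def)
  have U0: "0 \<in> U" using U(2) by simp
  have \<gamma>U: "\<gamma> t \<in> fst c" if "t \<in> U" for t
  proof -
    have "\<gamma> (chart_inv ?I t) \<in> fst c" using U(4) that by blast
    then show ?thesis by (simp only: interval_chart_inv[OF subsetD[OF Ue that]])
  qed
  have w: "w t \<in> tangent_space X (\<gamma> t)" if "t \<in> U" for t
    using par that Ue unfolding parallel_along_def by blast
  define y' where "y' = vector_derivative (snd c \<circ> \<gamma>) (at 0)"
  have "in_charts ?I c \<gamma> t = snd c (\<gamma> t)" if "t \<in> U" for t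
    by (simp only: comp_apply interval_chart_inv[OF subsetD[OF Ue that]])
  from differentiable_cong_open[OF U(1) U0, of "in_charts ?I c \<gamma>" "\<lambda>t. snd c (\<gamma> t)", OF this] smooth_on_differentiable[OF U(5) U0]
  have "(\<lambda>t. snd c (\<gamma> t)) differentiable (at 0)" by simp
  then have dy: "((\<lambda>t. snd c (\<gamma> t)) has_vector_derivative y') (at 0)"
    by (simp add: y'_def comp_def vector_derivative_works[symmetric])
  have "((\<lambda>s. w s c) has_vector_derivative - levi_civita X g c (snd c (\<gamma> 0)) (velocity X \<gamma> 0 c) (w 0 c)) (at 0)"
    by (rule par[unfolded parallel_along_def, rule_format, THEN conjunct2, rule_format])
       (use e c in \<open>auto simp: z(1)\<close>)
  then have dw: "((\<lambda>s. w s c) has_vector_derivative - levi_civita X g c (snd c (\<gamma> 0)) y' (w 0 c)) (at 0)"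
    using c by (simp add: velocity_def y'_def z(1))
  have "\<xi> = connection_lift X g (\<gamma> 0, w 0) (tangent_of X c (\<gamma> 0) y')
       (tangent_of X c (\<gamma> 0) (- levi_civita X g c (snd c (\<gamma> 0)) y' (w 0 c) + levi_civita X g c (snd c (\<gamma> 0)) y' (w 0 c)))"
    unfolding \<xi> by (rule velocity_connection_lift[OF X g c(1) U(1) U0 \<gamma>U w dy dw])
  moreover have "tangent_of X c x 0 = 0"
    using tangent_of_component[OF X tangent_zero[OF X] c] by simp
  ultimately have "\<xi> = connection_lift X g (x, n) (tangent_of X c x y') 0" by (simp add: z)
  then show ?thesis using that tangent_of_mem[OF X c] by blast
qed

text \<open>Parallel transport along a straight line in a chart, obtained from the linear differential equation.\<close>

lemma connection_lift_horizontal: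
  assumes x: "x \<in> carrier X" and n: "n \<in> tangent_space X x" and a: "a \<in> tangent_space X x"
  shows "connection_lift X g (x, n) a 0 \<in> horizontal_space X g (x, n)"
proof -
  define c where "c = chart_at X x"
  have c: "c \<in> X" "x \<in> fst c" using chart_at_mem[OF x] by (auto simp: c_def)
  define y0 where "y0 = snd c x"
  obtain r where r: "r > 0" "\<And>t. t \<in> {-r..r} \<Longrightarrow> y0 + t *\<^sub>R a c \<in> chart_image c"
    using chart_line[OF c] unfolding y0_def by metis
  define Y where "Y t = y0 + t *\<^sub>R a c" for t :: real
  have Ym: "Y t \<in> chart_image c" if "t \<in> {-r..r}" for t using r(2)[OF that] by (simp add: Y_def)
  define A where "A t = (\<lambda>v. - levi_civita X g c (Y t) (a c) v)" for t
  have cA: "continuous_on {-r..r} (\<lambda>t. A t b)" for b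
  proof (rule continuous_at_imp_continuous_on, rule ballI)
    fix t assume t: "t \<in> {-r..r}"
    have "isCont Y t" unfolding Y_def by (intro continuous_intros)
    from continuous_minus[OF isCont_o2[OF this isCont_levi_civita[OF X g c(1) Ym[OF t], of "a c" b]]]
    show "isCont (\<lambda>t. A t b) t" unfolding A_def .
  qed
  have lA: "linear (A t)" if "t \<in> {-r..r}" for t
    unfolding A_def
    by (rule linear_compose_neg[OF bilinear_linear_right[OF levi_civita_bilinear[OF X g c(1) Ym[OF that]]]])
  obtain e W where e: "0 < e" "e \<le> r" and W0: "W 0 = n c"
    and W: "\<And>t. t \<in> {-e<..<e} \<Longrightarrow> (W has_vector_derivative A t (W t)) (at t)"
  proof (rule linear_ode_exists[OF r(1) cA lA, where w_init="n c"])
    fix e W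
    assume "0 < e" "e \<le> r" "W 0 = n c" "\<And>t. t \<in> {-e<..<e} \<Longrightarrow> (W has_vector_derivative A t (W t)) (at t)"
    then show thesis by (rule that)
  qed
  define \<gamma> where "\<gamma> t = chart_inv c (Y t)" for t
  define w where "w t = tangent_of X c (\<gamma> t) (W t)" for t
  have er: "{-e<..<e} \<subseteq> {-r..r}" using e by auto
  have \<gamma>c: "\<gamma> t \<in> fst c" "snd c (\<gamma> t) = Y t" if "t \<in> {-e<..<e}" for t
    using chart_inv_mem[OF Ym] chart_chart_inv[OF Ym] er that by (auto simp: \<gamma>_def)
  have w: "w t \<in> tangent_space X (\<gamma> t)" "w t c = W t" if "t \<in> {-e<..<e}" for t
    unfolding w_def by (rule tangent_of_mem[OF X c(1) \<gamma>c(1)[OF that]], rule tangent_of_same[OF X c(1) \<gamma>c(1)[OF that]])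
  have \<gamma>0: "\<gamma> 0 = x" using chart_inv_chart[OF X c] by (simp add: \<gamma>_def Y_def y0_def)
  have w0: "w 0 = n" using tangent_of_component[OF X n c] by (simp add: w_def \<gamma>0 W0)
  have oI: "open {-e<..<e}" and zI: "0 \<in> {-e<..<e}" using e(1) by simp_all
  have dY: "((\<lambda>s. snd c (\<gamma> s)) has_vector_derivative a c) (at t)" if t: "t \<in> {-e<..<e}" for t
  proof -
    have "(Y has_vector_derivative a c) (at t)"
      unfolding Y_def has_vector_derivative_def by (auto intro!: derivative_eq_intros)
    then show ?thesis
      by (rule has_vector_derivative_transform_within_open[OF _ oI t]) (simp only: \<gamma>c(2))
  qed
  have dw: "((\<lambda>s. w s c) has_vector_derivative - levi_civita X g c (snd c (\<gamma> t)) (a c) (w t c)) (at t)"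
    if t: "t \<in> {-e<..<e}" for t
    using has_vector_derivative_transform_within_open[OF W[OF t] oI t, of "\<lambda>s. w s c"] w(2)
    by (simp add: A_def \<gamma>c(2)[OF t] w(2)[OF t])
  have "smooth_map (interval_manifold e) X \<gamma>"
  proof (rule smooth_map_intervalI[OF c(1) \<gamma>c(1)])
    have "smooth_on {-e<..<e} Y" unfolding Y_def by (rule smooth_on_line)
    then show "smooth_on {-e<..<e} (\<lambda>t. snd c (\<gamma> t))"
      by (rule smooth_on_cong[OF oI, THEN iffD1, rotated]) (simp add: \<gamma>c(2))
  qed
  moreover have "parallel_along X g {-e<..<e} \<gamma> w"
    unfolding parallel_along_def
  proof (intro ballI conjI impI)
    fix t assume t: "t \<in> {-e<..<e}"
    show "w t \<in> tangent_space X (\<gamma> t)" by (rule w(1)[OF t])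
    fix d assume d: "d \<in> X" "\<gamma> t \<in> fst d"
    have J0: "transition_jacobian c d (snd c (\<gamma> t)) 0 = 0"
      by (rule linear_0[OF transition_linear[OF X c(1) d(1) \<gamma>c(1)[OF t] d(2)]])
    have "velocity X \<gamma> t d = transition_jacobian c d (snd c (\<gamma> t)) (a c)"
      using vector_derivative_at[OF curve_transition(1)[OF X g c(1) oI t \<gamma>c(1) w(1) dY[OF t] dw[OF t] d]] d
      by (simp add: velocity_def comp_def)
    then show "((\<lambda>s. w s d) has_vector_derivative - levi_civita X g d (snd d (\<gamma> t)) (velocity X \<gamma> t d) (w t d)) (at t)"
      using curve_transition(2)[OF X g c(1) oI t \<gamma>c(1) w(1) dY[OF t] dw[OF t] d] by (simp add: J0)
  qed
  moreover have "velocity (tangent_bundle X) (\<lambda>t. (\<gamma> t, w t)) 0 = connection_lift X g (x, n) a 0"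
  proof -
    have "velocity (tangent_bundle X) (\<lambda>t. (\<gamma> t, w t)) 0 = connection_lift X g (\<gamma> 0, w 0)
      (tangent_of X c (\<gamma> 0) (a c)) (tangent_of X c (\<gamma> 0)
        (- levi_civita X g c (snd c (\<gamma> 0)) (a c) (w 0 c) + levi_civita X g c (snd c (\<gamma> 0)) (a c) (w 0 c)))"
      by (rule velocity_connection_lift[OF X g c(1) oI zI \<gamma>c(1) w(1) dY[OF zI] dw[OF zI]])
    moreover have "tangent_of X c x 0 = 0"
      using tangent_of_component[OF X tangent_zero[OF X] c] by simp
    ultimately show ?thesis by (simp add: \<gamma>0 w0 tangent_of_component[OF X a c])
  qed
  ultimately show ?thesis
    unfolding horizontal_space_def using e(1) \<gamma>0 w0
    by (intro CollectI exI[of _ \<gamma>] exI[of _ w] exI[of _ e]) simp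
qed

lemma connection_lift_distribution:
  assumes x: "x \<in> carrier X" and n: "n \<in> tangent_space X x" "g x n n = 1"
    and a: "a \<in> E_space X g (x, n)" and u: "u \<in> E_space X g (x, n)"
  shows "connection_lift X g (x, n) a u \<in> distribution X g (x, n)"
  using connection_lift_in_TZ7[OF x n] proj_connection_lift[OF X g x n(1)] a u
  by (simp add: distribution_def proj_push_def E_space_def)

text \<open>The decomposition by which the complex structure is defined is unique, because a vector
  determines its horizontal and its vertical part.\<close>

lemma distribution_complex_lift:
  assumes x: "x \<in> carrier X" and n: "n \<in> tangent_space X x" "g x n n = 1"
    and a: "a \<in> E_space X g (x, n)" and u: "u \<in> E_space X g (x, n)"
    and E: "\<And>v. v \<in> E_space X g (x, n) \<Longrightarrow> E_complex X \<phi> g (x, n) v \<in> E_space X g (x, n)"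
  shows "distribution_complex X \<phi> g (x, n) (connection_lift X g (x, n) a u) =
     connection_lift X g (x, n) (E_complex X \<phi> g (x, n) a) (E_complex X \<phi> g (x, n) u)"
proof -
  have ET: "v \<in> tangent_space X x" "g x n v = 0" if "v \<in> E_space X g (x, n)" for v
    using that by (simp_all add: E_space_def)
  have T0: "(0 :: ('x, real^7) tvec) \<in> tangent_space X x" by (rule tangent_zero[OF X])
  have E0: "0 \<in> E_space X g (x, n)"
  proof -
    have c: "chart_at X x \<in> X" "x \<in> fst (chart_at X x)" using chart_at_mem[OF x] by auto
    have "g x n 0 = 0"
      using metric_tangent[OF X g c n(1) T0] bilinear_rzero[OF metric_bilinear[OF g c(1) chart_image_mem[OF c(2)]]]
      by simp
    then show ?thesis using T0 by (simp add: E_space_def)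
  qed
  have split: "connection_lift X g (x, n) p q = connection_lift X g (x, n) 0 q + connection_lift X g (x, n) p 0" for p q
    using connection_lift_add[OF X g n(1), of 0 p q 0] by simp
  have vert: "connection_lift X g (x, n) 0 v \<in> vertical_space X g (x, n)" if "v \<in> E_space X g (x, n)" for v
    using connection_lift_in_TZ7[OF x n T0 ET[OF that]] proj_connection_lift[OF X g x n(1) T0]
    by (simp add: vertical_space_def proj_push_def)
  have hor: "connection_lift X g (x, n) v 0 \<in> E_horizontal X g (x, n)" if "v \<in> E_space X g (x, n)" for v
    using connection_lift_distribution[OF x n that E0] connection_lift_horizontal[OF x n(1) ET(1)[OF that]]
    by (simp add: E_horizontal_def)
  have proj: "proj_push X (x, n) (connection_lift X g (x, n) p q) = p" if "p \<in> tangent_space X x" for p q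
    unfolding proj_push_def by (rule proj_connection_lift[OF X g x n(1) that])
  show ?thesis
    unfolding distribution_complex_def
  proof (rule the_equality)
    show "\<exists>u'\<in>E_space X g (x, n). \<exists>v\<in>vertical_space X g (x, n). \<exists>v'\<in>vertical_space X g (x, n).
        \<exists>b\<in>E_horizontal X g (x, n). \<exists>b'\<in>E_horizontal X g (x, n).
          connection_lift X g (x, n) a u = v + b \<and>
          connection_lift X g (x, n) (E_complex X \<phi> g (x, n) a) (E_complex X \<phi> g (x, n) u) = v' + b' \<and>
          v = vertical_lift X (x, n) u' \<and> v' = vertical_lift X (x, n) (E_complex X \<phi> g (x, n) u') \<and>
          proj_push X (x, n) b' = E_complex X \<phi> g (x, n) (proj_push X (x, n) b)"
    proof (intro bexI conjI)
      show "connection_lift X g (x, n) a u = connection_lift X g (x, n) 0 u + connection_lift X g (x, n) a 0"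
        by (rule split)
      show "connection_lift X g (x, n) (E_complex X \<phi> g (x, n) a) (E_complex X \<phi> g (x, n) u)
         = connection_lift X g (x, n) 0 (E_complex X \<phi> g (x, n) u) + connection_lift X g (x, n) (E_complex X \<phi> g (x, n) a) 0"
        by (rule split)
      show "connection_lift X g (x, n) 0 u = vertical_lift X (x, n) u"
        by (rule vertical_lift_eq[OF x n(1) ET(1)[OF u], symmetric])
      show "connection_lift X g (x, n) 0 (E_complex X \<phi> g (x, n) u) = vertical_lift X (x, n) (E_complex X \<phi> g (x, n) u)"
        by (rule vertical_lift_eq[OF x n(1) ET(1)[OF E[OF u]], symmetric])
      show "proj_push X (x, n) (connection_lift X g (x, n) (E_complex X \<phi> g (x, n) a) 0) =
         E_complex X \<phi> g (x, n) (proj_push X (x, n) (connection_lift X g (x, n) a 0))"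
        by (simp only: proj ET(1)[OF a] ET(1)[OF E[OF a]])
    qed (intro vert hor a u E)+
  next
    fix \<zeta>
    assume "\<exists>u'\<in>E_space X g (x, n). \<exists>v\<in>vertical_space X g (x, n). \<exists>v'\<in>vertical_space X g (x, n).
        \<exists>b\<in>E_horizontal X g (x, n). \<exists>b'\<in>E_horizontal X g (x, n).
          connection_lift X g (x, n) a u = v + b \<and> \<zeta> = v' + b' \<and>
          v = vertical_lift X (x, n) u' \<and> v' = vertical_lift X (x, n) (E_complex X \<phi> g (x, n) u') \<and>
          proj_push X (x, n) b' = E_complex X \<phi> g (x, n) (proj_push X (x, n) b)"
    then obtain u' v v' b b' where u': "u' \<in> E_space X g (x, n)"
      and b: "b \<in> E_horizontal X g (x, n)" "b' \<in> E_horizontal X g (x, n)"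
      and eq: "connection_lift X g (x, n) a u = v + b" "\<zeta> = v' + b'"
      and v: "v = vertical_lift X (x, n) u'" "v' = vertical_lift X (x, n) (E_complex X \<phi> g (x, n) u')"
      and pr: "proj_push X (x, n) b' = E_complex X \<phi> g (x, n) (proj_push X (x, n) b)" by blast
    have hb: "b \<in> horizontal_space X g (x, n)" "b' \<in> horizontal_space X g (x, n)"
      using b by (simp_all add: E_horizontal_def)
    obtain p where p: "p \<in> tangent_space X x" "b = connection_lift X g (x, n) p 0"
      by (rule horizontal_space_lift[OF x n(1) hb(1)])
    obtain p' where p': "p' \<in> tangent_space X x" "b' = connection_lift X g (x, n) p' 0"
      by (rule horizontal_space_lift[OF x n(1) hb(2)])
    have "connection_lift X g (x, n) a u = connection_lift X g (x, n) p u'"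
      unfolding eq(1) v(1) vertical_lift_eq[OF x n(1) ET(1)[OF u']] p(2) by (rule split[symmetric])
    from connection_lift_inject[OF X g x n(1) ET(1)[OF a] ET(1)[OF u] p(1) ET(1)[OF u'] this]
    have pu: "a = p" "u = u'" by auto
    have "p' = E_complex X \<phi> g (x, n) a"
      using pr unfolding p'(2) p(2) proj[OF p'(1)] proj[OF p(1)] pu .
    then show "\<zeta> = connection_lift X g (x, n) (E_complex X \<phi> g (x, n) a) (E_complex X \<phi> g (x, n) u)"
      unfolding eq(2) v(2) vertical_lift_eq[OF x n(1) ET(1)[OF E[OF u']]] p'(2) pu(2)
      by (metis split)
  qed
qed

end

section \<open>The cross product on a \<open>G\<^sub>2\<close> manifold\<close>

definition cross_coord ::
  "('a, real^7) chart set \<Rightarrow> ('a, real^7) three_form \<Rightarrow> ('a, real^7) metric_tensor \<Rightarrow>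
     ('a, real^7) chart \<Rightarrow> real^7 \<Rightarrow> real^7 \<Rightarrow> real^7 \<Rightarrow> real^7" where
  "cross_coord X \<phi> g c y a b = cross X \<phi> g (chart_inv c y)
     (tangent_of X c (chart_inv c y) a) (tangent_of X c (chart_inv c y) b) c"

abbreviation form_derivative ::
  "('a, real^7) chart set \<Rightarrow> ('a, real^7) three_form \<Rightarrow> ('a, real^7) chart \<Rightarrow>
     real^7 \<Rightarrow> real^7 \<Rightarrow> real^7 \<Rightarrow> real^7 \<Rightarrow> real^7 \<Rightarrow> real" where
  "form_derivative X \<phi> c y v a b k \<equiv> frechet_derivative (\<lambda>z. form_coord X \<phi> c z a b k) (at y) v"

context
  fixes X :: "('x, real^7) chart set" and \<phi> :: "('x, real^7) three_form"
    and g :: "('x, real^7) metric_tensor"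
  assumes g2: "g2_manifold X \<phi> g"
begin

lemma g2_atlas: "smooth_atlas X" and g2_metric: "riemannian_metric X g"
  using g2 unfolding g2_manifold_def by (simp_all add: smooth_manifold_atlas)

lemma form_smooth: "c \<in> X \<Longrightarrow> smooth_on (chart_image c) (\<lambda>y. form_coord X \<phi> c y a b k)"
  and form_linear: "c \<in> X \<Longrightarrow> y \<in> chart_image c \<Longrightarrow> linear (form_coord X \<phi> c y a b)"
  and form_antisym: "c \<in> X \<Longrightarrow> y \<in> chart_image c \<Longrightarrow> form_coord X \<phi> c y a b k = - form_coord X \<phi> c y b a k \<and>
        form_coord X \<phi> c y a b k = - form_coord X \<phi> c y a k b"
proof -
  have "smooth_three_form X \<phi>" using g2 unfolding g2_manifold_def by simp
  note s = this[unfolded smooth_three_form_def]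
  show "c \<in> X \<Longrightarrow> smooth_on (chart_image c) (\<lambda>y. form_coord X \<phi> c y a b k)"
    by (rule s[THEN conjunct2, THEN conjunct2, rule_format])
  show "c \<in> X \<Longrightarrow> y \<in> chart_image c \<Longrightarrow> linear (form_coord X \<phi> c y a b)"
    by (rule s[THEN conjunct1, rule_format])
  show "c \<in> X \<Longrightarrow> y \<in> chart_image c \<Longrightarrow> form_coord X \<phi> c y a b k = - form_coord X \<phi> c y b a k \<and>
        form_coord X \<phi> c y a b k = - form_coord X \<phi> c y a k b"
    by (rule s[THEN conjunct2, THEN conjunct1, rule_format])
qed

lemma form_bilinear:
  assumes "c \<in> X" "y \<in> chart_image c"
  shows "bilinear (form_coord X \<phi> c y a)" "bilinear (\<lambda>a. form_coord X \<phi> c y a b)"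
proof -
  note l = form_linear[OF assms] and s = form_antisym[OF assms]
  have 1: "(\<lambda>b. form_coord X \<phi> c y a b k) = (\<lambda>b. - form_coord X \<phi> c y a k b)" for a k using s by blast
  have 2: "(\<lambda>a. form_coord X \<phi> c y a b k) = (\<lambda>a. - form_coord X \<phi> c y b a k)" for b k using s by blast
  have l1: "linear (\<lambda>b. form_coord X \<phi> c y a b k)" for a k
    unfolding 1 by (rule linear_compose_neg[OF l])
  have "linear (\<lambda>a. form_coord X \<phi> c y a b k)" for b k
    unfolding 2[of b k] by (rule linear_compose_neg[OF l1])
  then show "bilinear (form_coord X \<phi> c y a)" "bilinear (\<lambda>a. form_coord X \<phi> c y a b)"
    using l l1 by (simp_all add: bilinear_def)
qed

lemma form_has_derivative:
  assumes "c \<in> X" "y \<in> chart_image c"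
  shows "((\<lambda>z. form_coord X \<phi> c z a b k) has_derivative (\<lambda>v. form_derivative X \<phi> c y v a b k)) (at y)"
  by (rule smooth_on_has_derivative[OF form_smooth[OF assms(1)] assms(2)])

lemma form_parallel:
  assumes "c \<in> X" "y \<in> chart_image c"
  shows "form_derivative X \<phi> c y v a b k =
     form_coord X \<phi> c y (levi_civita X g c y v a) b k + form_coord X \<phi> c y a (levi_civita X g c y v b) k
     + form_coord X \<phi> c y a b (levi_civita X g c y v k)"
proof -
  have "parallel_three_form X g \<phi>" using g2 unfolding g2_manifold_def by simp
  from this[unfolded parallel_three_form_def, rule_format, OF assms, of a b k v] show ?thesis by simp
qed

lemma form_tangent:
  assumes "c \<in> X" "x \<in> fst c" "u \<in> tangent_space X x" "v \<in> tangent_space X x" "w \<in> tangent_space X x"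
  shows "\<phi> x u v w = form_coord X \<phi> c (snd c x) (u c) (v c) (w c)"
  unfolding form_coord_def chart_inv_chart[OF g2_atlas assms(1,2)]
    tangent_of_component[OF g2_atlas assms(3,1,2)] tangent_of_component[OF g2_atlas assms(4,1,2)]
    tangent_of_component[OF g2_atlas assms(5,1,2)] ..

text \<open>In an adapted frame the metric and the form are standard, so the standard cross product can
  be transported to the coordinates of any chart.\<close>

lemma chart_cross_product_exists:
  assumes c: "c \<in> X" "x \<in> fst c"
  obtains P where "vector_cross_product (metric_coord X g c (snd c x)) P"
    "\<And>u v w. metric_coord X g c (snd c x) u (P v w) = form_coord X \<phi> c (snd c x) u v w"
proof -
  have x: "x \<in> carrier X" by (rule carrier_mem[OF c])
  obtain e where e: "adapted_frame X \<phi> x e"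
    using g2 x unfolding g2_manifold_def by blast
  have on: "g x (e i) (e j) = (if i = j then 1 else 0)" for i j
    using g2 x e unfolding g2_manifold_def by blast
  have bij: "bij_betw (frame_comb e) UNIV (tangent_space X x)"
    and ph: "\<phi> x (frame_comb e u) (frame_comb e v) (frame_comb e w) = phi0 u v w" for u v w
    using e by (simp_all add: adapted_frame_def)
  have T: "frame_comb e u \<in> tangent_space X x" for u using bij by (auto simp: bij_betw_def)
  define E where "E u = frame_comb e u c" for u
  let ?m = "metric_coord X g c (snd c x)"
  have bm: "bilinear ?m" by (rule metric_bilinear[OF g2_metric c(1) chart_image_mem[OF c(2)]])
  have Esum: "E u = (\<Sum>i\<in>UNIV. u $ i *\<^sub>R e i c)" for u by (simp add: E_def frame_comb_def)
  have lE: "linear E"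
    by (rule linearI) (simp_all add: Esum scaleR_add_left sum.distrib scaleR_sum_right)
  have "bij E"
  proof (rule bijI)
    show "inj E"
    proof (rule injI)
      fix u v assume "E u = E v"
      then have "frame_comb e u = frame_comb e v"
        unfolding E_def by (rule tangent_eqI[OF g2_atlas T T c])
      then show "u = v" using bij by (auto simp: bij_betw_def inj_on_def)
    qed
    show "surj E"
      unfolding surj_def
    proof
      fix b
      have "tangent_of X c x b \<in> frame_comb e ` UNIV"
        using bij tangent_of_mem[OF g2_atlas c] by (auto simp: bij_betw_def)
      then obtain u where "frame_comb e u = tangent_of X c x b" by auto
      then have "b = E u" using tangent_of_same[OF g2_atlas c, of b] by (simp add: E_def)
      then show "\<exists>u. b = E u" ..
    qed
  qed
  have ei: "e i = frame_comb e (axis i 1)" for i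
    by (simp add: frame_comb_def fun_eq_iff axis_def if_distrib[of "\<lambda>r. r *\<^sub>R _"] sum.delta' cong: if_cong)
  have mm: "?m (e i c) (e j c) = (if i = j then 1 else 0)" for i j
    using metric_tangent[OF g2_atlas g2_metric c T[of "axis i 1"] T[of "axis j 1"]] on[of i j]
    by (simp flip: ei)
  have G: "?m (E u) (E v) = u \<bullet> v" for u v
    unfolding Esum bilinear_sum[OF bm] sum.cartesian_product[symmetric]
    by (simp add: bilinear_lmul[OF bm] bilinear_rmul[OF bm] mm inner_vec_def sum.delta
        if_distrib[of "\<lambda>r. _ * r"] mult.commute cong: if_cong)
  have EF: "E (inv E v) = v" for v using \<open>bij E\<close> by (simp add: bij_is_surj surj_f_inv_f)
  have ph': "phi0 (inv E u) (inv E v) (inv E w) = form_coord X \<phi> c (snd c x) u v w" for u v w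
    using ph[of "inv E u" "inv E v" "inv E w"] form_tangent[OF c T T T, of "inv E u" "inv E v" "inv E w"]
    by (simp add: EF flip: E_def)
  show ?thesis
    by (rule that[OF vector_cross_product_frame(1)[OF lE \<open>bij E\<close> bm G]])
       (simp add: vector_cross_product_frame(2)[OF lE \<open>bij E\<close> bm G] ph')
qed

text \<open>The cross product is determined by its products with all tangent vectors, as the metric is
  nondegenerate.\<close>

lemma cross_spec:
  assumes c: "c \<in> X" "x \<in> fst c" and v: "v \<in> tangent_space X x" and w: "w \<in> tangent_space X x"
    and P: "\<And>u v w. metric_coord X g c (snd c x) u (P v w) = form_coord X \<phi> c (snd c x) u v w"
  shows "cross X \<phi> g x v w = tangent_of X c x (P (v c) (w c))"
  unfolding cross_def
proof (rule the_equality)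
  note X = g2_atlas
  let ?m = "metric_coord X g c (snd c x)"
  have m: "inner_form ?m" by (rule metric_coord_inner_form[OF X g2_metric c(1) chart_image_mem[OF c(2)]])
  have T: "tangent_of X c x a \<in> tangent_space X x" for a by (rule tangent_of_mem[OF X c])
  show "tangent_of X c x (P (v c) (w c)) \<in> tangent_space X x \<and>
     (\<forall>u\<in>tangent_space X x. g x u (tangent_of X c x (P (v c) (w c))) = \<phi> x u v w)"
    using T metric_tangent[OF X g2_metric c _ T] form_tangent[OF c _ v w]
    by (simp add: tangent_of_same[OF X c] P)
  fix z assume z: "z \<in> tangent_space X x \<and> (\<forall>u\<in>tangent_space X x. g x u z = \<phi> x u v w)"
  show "z = tangent_of X c x (P (v c) (w c))"
  proof (rule tangent_eqI[OF X _ T c])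
    show "z \<in> tangent_space X x" using z by simp
    show "z c = tangent_of X c x (P (v c) (w c)) c"
    proof (rule inner_form_nondegenerate[OF m])
      fix k
      have "?m (z c) k = ?m k (z c)" using m unfolding inner_form_def by blast
      also have "\<dots> = g x (tangent_of X c x k) z"
        using metric_tangent[OF X g2_metric c T[of k], of z] z by (simp add: tangent_of_same[OF X c])
      also have "\<dots> = \<phi> x (tangent_of X c x k) v w" using z T by blast
      also have "\<dots> = ?m k (P (v c) (w c))"
        using form_tangent[OF c T v w] by (simp add: P tangent_of_same[OF X c])
      also have "\<dots> = ?m (P (v c) (w c)) k" using m unfolding inner_form_def by blast
      finally show "?m (z c) k = ?m (tangent_of X c x (P (v c) (w c)) c) k"
        by (simp add: tangent_of_same[OF X c])
    qed
  qed
qed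

lemma cross_coord_properties:
  assumes c: "c \<in> X" "x \<in> fst c"
  shows "vector_cross_product (metric_coord X g c (snd c x)) (cross_coord X \<phi> g c (snd c x))"
    and "metric_coord X g c (snd c x) k (cross_coord X \<phi> g c (snd c x) a b) = form_coord X \<phi> c (snd c x) k a b"
    and "v \<in> tangent_space X x \<Longrightarrow> w \<in> tangent_space X x \<Longrightarrow>
       cross X \<phi> g x v w \<in> tangent_space X x \<and>
       cross X \<phi> g x v w c = cross_coord X \<phi> g c (snd c x) (v c) (w c)"
proof -
  obtain P where P: "vector_cross_product (metric_coord X g c (snd c x)) P"
    "\<And>u v w. metric_coord X g c (snd c x) u (P v w) = form_coord X \<phi> c (snd c x) u v w"
    using chart_cross_product_exists[OF c] by metis
  note T = tangent_of_mem[OF g2_atlas c] and S = tangent_of_same[OF g2_atlas c]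
  have "cross_coord X \<phi> g c (snd c x) a b = P a b" for a b
    unfolding cross_coord_def chart_inv_chart[OF g2_atlas c] cross_spec[OF c T T P(2)] S ..
  then have eq: "cross_coord X \<phi> g c (snd c x) = P" by blast
  show "vector_cross_product (metric_coord X g c (snd c x)) (cross_coord X \<phi> g c (snd c x))"
    unfolding eq by (rule P(1))
  show "metric_coord X g c (snd c x) k (cross_coord X \<phi> g c (snd c x) a b) = form_coord X \<phi> c (snd c x) k a b"
    unfolding eq by (rule P(2))
  show "v \<in> tangent_space X x \<Longrightarrow> w \<in> tangent_space X x \<Longrightarrow>
       cross X \<phi> g x v w \<in> tangent_space X x \<and>
       cross X \<phi> g x v w c = cross_coord X \<phi> g c (snd c x) (v c) (w c)"
    unfolding eq by (simp add: cross_spec[OF c _ _ P(2)] T S)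
qed

end

section \<open>Oriented planes\<close>

definition det2 :: "real^2 \<Rightarrow> real^2 \<Rightarrow> real" where
  "det2 a b = a$1 * b$2 - a$2 * b$1"

lemma det_vector_2: "det (vector [a, b] :: real^2^2) = det2 a b"
  by (simp add: det_2 det2_def)

lemma linear_det2:
  assumes J: "linear J"
  shows "det2 (J a) (J b) = det (matrix J) * det2 a b"
proof -
  have "J x $ i = matrix J $ i $ 1 * x $ 1 + matrix J $ i $ 2 * x $ 2" for x i
  proof -
    have "J x = matrix J *v x" using J by (simp add: matrix_works)
    then show ?thesis by (simp add: matrix_vector_mult_def sum_2)
  qed
  then show ?thesis by (simp add: det2_def det_2 algebra_simps)
qed

lemma plane_combination:
  assumes "det2 a b \<noteq> 0"
  shows "u = (det2 u b / det2 a b) *\<^sub>R a + (det2 a u / det2 a b) *\<^sub>R b"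
proof -
  have "det2 u b * a $ i + det2 a u * b $ i = det2 a b * u $ i" for i
    using exhaust_2[of i] by (auto simp: det2_def algebra_simps)
  then show ?thesis
    using assms by (simp add: vec_eq_iff divide_simps mult.commute)
qed

text \<open>The Gram-Schmidt process, applied to the standard basis, preserves the orientation.\<close>

lemma positive_orthonormal_basis:
  fixes B :: "real^2 \<Rightarrow> real^2 \<Rightarrow> real"
  assumes B: "inner_form B"
  obtains a b where "det2 a b > 0" "B a a = 1" "B b b = 1" "B a b = 0"
proof -
  have bB: "bilinear B" and sB: "B u v = B v u" and pB: "u \<noteq> 0 \<Longrightarrow> B u u > 0" for u v
    using B by (auto simp: inner_form_def)
  define e1 e2 :: "real^2" where "e1 = axis 1 1" and "e2 = axis 2 1"
  have e: "e1 $ 1 = 1" "e1 $ 2 = 0" "e2 $ 1 = 0" "e2 $ 2 = 1" by (simp_all add: e1_def e2_def axis_def)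
  then have "e1 \<noteq> 0" by (metis zero_index zero_neq_one)
  define a where "a = (1 / sqrt (B e1 e1)) *\<^sub>R e1"
  define b0 where "b0 = e2 - B a e2 *\<^sub>R a"
  define b where "b = (1 / sqrt (B b0 b0)) *\<^sub>R b0"
  have p1: "B e1 e1 > 0" by (rule pB[OF \<open>e1 \<noteq> 0\<close>])
  have aa: "B a a = 1"
    using p1 by (simp add: a_def bilinear_lmul[OF bB] bilinear_rmul[OF bB] flip: power2_eq_square)
  have "b0 $ 2 = 1" by (simp add: b0_def a_def e)
  then have "b0 \<noteq> 0" by (metis zero_index zero_neq_one)
  then have p2: "B b0 b0 > 0" by (rule pB)
  have bb: "B b b = 1"
    using p2 by (simp add: b_def bilinear_lmul[OF bB] bilinear_rmul[OF bB] flip: power2_eq_square)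
  have "B a b0 = 0"
    by (simp add: b0_def bilinear_rsub[OF bB] bilinear_rmul[OF bB] aa)
  then have ab: "B a b = 0" by (simp add: b_def bilinear_rmul[OF bB])
  have "det2 a b > 0"
    using p1 p2 \<open>b0 $ 2 = 1\<close> by (simp add: det2_def b_def a_def e)
  then show ?thesis using that aa bb ab by blast
qed

text \<open>Under a change of basis an alternating \<open>C\<close> is multiplied by the determinant and the Gram
  determinant by its square. The root of the latter is the area of the parallelogram of \<open>u\<close> and \<open>v\<close>.\<close>

lemma alternating_area:
  fixes B :: "real^2 \<Rightarrow> real^2 \<Rightarrow> real" and C :: "real^2 \<Rightarrow> real^2 \<Rightarrow> 'v::real_vector"
  assumes bB: "inner_form B" and bC: "bilinear C" and alt: "\<And>u. C u u = 0"
    and ab: "det2 a b > 0" "B a a = 1" "B b b = 1" "B a b = 0" and uv: "det2 u v > 0"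
  shows "C u v = sqrt (B u u * B v v - (B u v)\<^sup>2) *\<^sub>R C a b"
    and "B u u * B v v - (B u v)\<^sup>2 > 0"
proof -
  have lB: "bilinear B" and sB: "B p q = B q p" for p q using bB by (auto simp: inner_form_def)
  have anti: "C b a = - C a b"
  proof -
    have "C (a + b) (a + b) = (C a a + C a b) + (C b a + C b b)"
      by (simp only: bilinear_ladd[OF bC] bilinear_radd[OF bC] ac_simps)
    then have "C b a + C a b = 0" unfolding alt by (simp add: add.commute)
    then show ?thesis by (simp add: eq_neg_iff_add_eq_0)
  qed
  obtain p q where u: "u = p *\<^sub>R a + q *\<^sub>R b" using plane_combination[of a b u] ab(1) by auto
  obtain r s where v: "v = r *\<^sub>R a + s *\<^sub>R b" using plane_combination[of a b v] ab(1) by auto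
  have "det2 u v = (p * s - q * r) * det2 a b" by (simp add: u v det2_def algebra_simps)
  then have pos: "p * s - q * r > 0" using uv ab(1) by (simp add: zero_less_mult_iff)
  have BB: "B (x *\<^sub>R a + y *\<^sub>R b) (z *\<^sub>R a + w *\<^sub>R b) = x * z + y * w" for x y z w
    by (simp add: bilinear_ladd[OF lB] bilinear_radd[OF lB] bilinear_lmul[OF lB] bilinear_rmul[OF lB]
        ab sB[of b a])
  have sq: "B u u * B v v - (B u v)\<^sup>2 = (p * s - q * r)\<^sup>2"
    by (simp add: u v BB power2_eq_square algebra_simps)
  have "C u v = (p * s - q * r) *\<^sub>R C a b"
    by (simp add: u v bilinear_ladd[OF bC] bilinear_radd[OF bC] bilinear_lmul[OF bC] bilinear_rmul[OF bC]
        alt anti scaleR_diff_left mult.commute)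
  then show "C u v = sqrt (B u u * B v v - (B u v)\<^sup>2) *\<^sub>R C a b" using pos by (simp add: sq)
  show "B u u * B v v - (B u v)\<^sup>2 > 0" using pos by (simp add: sq)
qed

section \<open>The Gauss lift and its derivative\<close>

text \<open>The covariant derivative of \<open>df\<close> for the flat connection of the chart of the source. It
  differs from \<open>\<nabla>df\<close> and from the second fundamental form by tangential vectors only.\<close>

definition chart_hessian ::
  "('c, 'd::euclidean_space) chart set \<Rightarrow> ('c, 'd) metric_tensor \<Rightarrow> ('a, 'b::euclidean_space) chart \<Rightarrow>
     ('c, 'd) chart \<Rightarrow> ('a \<Rightarrow> 'c) \<Rightarrow> 'b \<Rightarrow> 'b \<Rightarrow> 'b \<Rightarrow> 'd" where
  "chart_hessian N g c d f y a b =
     frechet_derivative (\<lambda>z. frechet_derivative (in_charts c d f) (at z) b) (at y) a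
     + levi_civita N g d (in_charts c d f y) (frechet_derivative (in_charts c d f) (at y) a)
         (frechet_derivative (in_charts c d f) (at y) b)"

definition induced_coord ::
  "('c, 'd::euclidean_space) chart set \<Rightarrow> ('c, 'd) metric_tensor \<Rightarrow> ('a, 'b::euclidean_space) chart \<Rightarrow>
     ('c, 'd) chart \<Rightarrow> ('a \<Rightarrow> 'c) \<Rightarrow> 'b \<Rightarrow> 'b \<Rightarrow> 'b \<Rightarrow> real" where
  "induced_coord N g c d f y a b = metric_coord N g d (in_charts c d f y)
     (frechet_derivative (in_charts c d f) (at y) a) (frechet_derivative (in_charts c d f) (at y) b)"

lemma smooth_map_carrier:
  assumes M: "smooth_atlas M" and f: "smooth_map M N f" and p: "p \<in> carrier M"
  shows "f p \<in> carrier N"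
proof -
  obtain c d U where c: "c \<in> M" "p \<in> fst c" and d: "d \<in> N"
    and U: "snd c p \<in> U" "f ` (chart_inv c ` U) \<subseteq> fst d"
    using f[unfolded smooth_map_def, rule_format, OF p] by blast
  have "f (chart_inv c (snd c p)) \<in> fst d" using U by blast
  then show ?thesis unfolding chart_inv_chart[OF M c] by (rule carrier_mem[OF d])
qed

lemma bilinear_compose_linear:
  assumes m: "bilinear m" and lin: "linear D"
  shows "bilinear (\<lambda>a b. m (D a) (D b))"
  unfolding bilinear_def
  by (intro conjI allI linearI)
     (simp_all add: linear_add[OF lin] linear_scale[OF lin] bilinear_ladd[OF m] bilinear_radd[OF m]
       bilinear_lmul[OF m] bilinear_rmul[OF m])

lemma induced_inner_form:
  fixes M :: "('a, 'b::euclidean_space) chart set" and N :: "('c, 'd::euclidean_space) chart set"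
  assumes M: "smooth_atlas M" and N: "smooth_atlas N" and g: "riemannian_metric N g"
    and f: "immersion M N f" and c: "c \<in> M" "q \<in> fst c" and d: "d \<in> N" "f q \<in> fst d"
  shows "inner_form (induced_coord N g c d f (snd c q))"
    and "frechet_derivative (in_charts c d f) (at (snd c q)) a = 0 \<Longrightarrow> a = 0"
proof -
  have sm: "smooth_map M N f" and inj: "inj_on (differential M N f q) (tangent_space M q)"
    using f carrier_mem[OF c] by (simp_all add: immersion_def)
  let ?D = "frechet_derivative (in_charts c d f) (at (snd c q))"
  let ?m = "metric_coord N g d (in_charts c d f (snd c q))"
  have lin: "linear ?D" by (rule has_derivative_linear[OF in_charts_has_derivative[OF M N sm c d]])
  have Fq: "in_charts c d f (snd c q) = snd d (f q)" by (simp add: chart_inv_chart[OF M c])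
  have m: "inner_form ?m"
    unfolding Fq by (rule metric_coord_inner_form[OF N g d(1) chart_image_mem[OF d(2)]])
  show zero: "a = 0" if "?D a = 0" for a
  proof -
    have T: "tangent_of M c q b \<in> tangent_space M q" for b by (rule tangent_of_mem[OF M c])
    have comp: "differential M N f q (tangent_of M c q b) d = ?D b" for b
      by (simp only: differential_component[OF M N sm c d T] tangent_of_same[OF M c])
    have "differential M N f q (tangent_of M c q a) = differential M N f q (tangent_of M c q 0)"
      by (rule tangent_eqI[OF N differential_mem[OF M N sm carrier_mem[OF c]]
            differential_mem[OF M N sm carrier_mem[OF c]] d])
         (simp only: comp that linear_0[OF lin])
    then have "tangent_of M c q a = tangent_of M c q 0" by (rule inj_onD[OF inj _ T T])
    then show "a = 0" using tangent_of_same[OF M c, of a] tangent_of_same[OF M c, of 0] by simp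
  qed
  have bm: "bilinear ?m" and sm': "?m u v = ?m v u" and pm: "u \<noteq> 0 \<Longrightarrow> ?m u u > 0" for u v
    using m by (auto simp: inner_form_def)
  have "bilinear (induced_coord N g c d f (snd c q))"
    unfolding induced_coord_def[abs_def] by (rule bilinear_compose_linear[OF bm lin])
  then show "inner_form (induced_coord N g c d f (snd c q))"
    using sm' pm zero unfolding inner_form_def induced_coord_def by blast
qed

lemma positive_basis_iff:
  assumes S: "oriented_surface S" and c: "c \<in> S" "q \<in> fst c" and u: "u \<in> tangent_space S q" and v: "v \<in> tangent_space S q"
  shows "positive_basis S q u v \<longleftrightarrow> det2 (u c) (v c) > 0"
proof -
  have SA: "smooth_atlas S" using S by (simp add: oriented_surface_def smooth_manifold_atlas)
  show ?thesis
  proof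
  assume "positive_basis S q u v"
  then have "\<forall>c\<in>S. q \<in> fst c \<longrightarrow> det (vector [u c, v c] :: real^2^2) > 0"
    by (simp add: positive_basis_def)
  from this[rule_format, OF c] show "det2 (u c) (v c) > 0" by (simp add: det_vector_2)
next
  assume pos: "det2 (u c) (v c) > 0"
  have "det (vector [u d, v d] :: real^2^2) > 0" if d: "d \<in> S" "q \<in> fst d" for d
  proof -
    have "\<forall>c\<in>S. \<forall>d\<in>S. \<forall>p\<in>fst c \<inter> fst d. det (matrix (transition_jacobian c d (snd c p))) > 0"
      using S by (simp add: oriented_surface_def)
    from this[rule_format, OF c(1) d(1), of q] have J: "det (matrix (transition_jacobian c d (snd c q))) > 0"
      using c d by simp
    have "det2 (u d) (v d) = det (matrix (transition_jacobian c d (snd c q))) * det2 (u c) (v c)"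
      unfolding tangent_transition[OF SA u c d] tangent_transition[OF SA v c d]
      by (rule linear_det2[OF transition_linear[OF SA c(1) d(1) c(2) d(2)]])
    then show ?thesis using J pos by (simp add: det_vector_2)
  qed
  then show "positive_basis S q u v" using u v by (simp add: positive_basis_def)
qed
qed

context
  fixes X :: "('x, real^7) chart set" and \<phi> :: "('x, real^7) three_form"
    and g :: "('x, real^7) metric_tensor"
    and S :: "('s, real^2) chart set" and f :: "'s \<Rightarrow> 'x"
  assumes g2: "g2_manifold X \<phi> g" and S: "oriented_surface S" and f: "immersion S X f"
begin

lemma surface_atlas: "smooth_atlas S" and surface_smooth: "smooth_map S X f"
  using S f by (simp_all add: oriented_surface_def smooth_manifold_atlas immersion_def)

text \<open>The definition of the Gauss lift by orthonormal bases is unambiguous, and the lift can be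
  computed with any positive basis, in particular with one that is constant in a chart.\<close>

lemma gauss_lift_coord:
  assumes c: "c \<in> S" "q \<in> fst c" and d: "d \<in> X" "f q \<in> fst d"
  defines "D \<equiv> frechet_derivative (in_charts c d f) (at (snd c q))"
    and "B \<equiv> induced_coord X g c d f (snd c q)" and "n \<equiv> snd (gauss_lift S X \<phi> g f q)"
  shows "n \<in> tangent_space X (f q)" and "g (f q) n n = 1"
    and "det2 u v > 0 \<Longrightarrow> cross_coord X \<phi> g d (snd d (f q)) (D u) (D v) =
           sqrt (B u u * B v v - (B u v)\<^sup>2) *\<^sub>R n d"
    and "det2 u v > 0 \<Longrightarrow> B u u * B v v - (B u v)\<^sup>2 > 0"
proof -
  note X = g2_atlas[OF g2] and gX = g2_metric[OF g2] and SA = surface_atlas and sm = surface_smooth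
  let ?m = "metric_coord X g d (snd d (f q))"
  let ?C = "cross_coord X \<phi> g d (snd d (f q))"
  have Fq: "in_charts c d f (snd c q) = snd d (f q)" by (simp add: chart_inv_chart[OF SA c])
  interpret P: vector_cross_product ?m ?C by (rule cross_coord_properties(1)[OF g2 d])
  have lin: "linear D" unfolding D_def by (rule has_derivative_linear[OF in_charts_has_derivative[OF SA X sm c d]])
  have B: "inner_form B" unfolding B_def by (rule induced_inner_form(1)[OF SA X gX f c d])
  have Bm: "B a b = ?m (D a) (D b)" for a b by (simp only: B_def D_def induced_coord_def Fq)
  have bC: "bilinear (\<lambda>a b. ?C (D a) (D b))"
    by (rule bilinear_compose_linear[OF P.X lin])
  have TS: "tangent_of S c q a \<in> tangent_space S q" for a by (rule tangent_of_mem[OF SA c])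
  have TX: "differential S X f q w \<in> tangent_space X (f q)" for w
    by (rule differential_mem[OF SA X sm carrier_mem[OF c]])
  have comp: "differential S X f q w d = D (w c)" if "w \<in> tangent_space S q" for w
    unfolding D_def by (rule differential_component[OF SA X sm c d that])
  have gm: "g (f q) (differential S X f q v) (differential S X f q w) = B (v c) (w c)"
    if "v \<in> tangent_space S q" "w \<in> tangent_space S q" for v w
    by (simp only: metric_tangent[OF X gX d TX TX] comp[OF that(1)] comp[OF that(2)] Bm)
  have cr: "cross X \<phi> g (f q) (differential S X f q v) (differential S X f q w) \<in> tangent_space X (f q)"
    "cross X \<phi> g (f q) (differential S X f q v) (differential S X f q w) d = ?C (D (v c)) (D (w c))"
    if "v \<in> tangent_space S q" "w \<in> tangent_space S q" for v w
    using cross_coord_properties(3)[OF g2 d TX TX, of v w] by (simp_all add: comp[OF that(1)] comp[OF that(2)])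
  obtain a b where ab: "det2 a b > 0" "B a a = 1" "B b b = 1" "B a b = 0"
    by (rule positive_orthonormal_basis[OF B])
  note area = alternating_area[OF B bC P.cross_self ab]
  define N where "N = cross X \<phi> g (f q) (differential S X f q (tangent_of S c q a)) (differential S X f q (tangent_of S c q b))"
  have N: "N \<in> tangent_space X (f q)" "N d = ?C (D a) (D b)"
    unfolding N_def using cr[OF TS TS] by (simp_all add: tangent_of_same[OF SA c])
  have "n = N"
    unfolding n_def gauss_lift_def snd_conv
  proof (rule the_equality)
    show "\<exists>u v a b. positive_basis S q u v \<and> a = differential S X f q u \<and> b = differential S X f q v \<and>
        g (f q) a a = 1 \<and> g (f q) b b = 1 \<and> g (f q) a b = 0 \<and> N = cross X \<phi> g (f q) a b"
      unfolding N_def using ab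
      by (intro exI[of _ "tangent_of S c q a"] exI[of _ "tangent_of S c q b"] exI conjI refl)
         (simp_all add: positive_basis_iff[OF S c TS TS] gm[OF TS TS] tangent_of_same[OF SA c])
  next
    fix n'
    assume "\<exists>u v a b. positive_basis S q u v \<and> a = differential S X f q u \<and> b = differential S X f q v \<and>
        g (f q) a a = 1 \<and> g (f q) b b = 1 \<and> g (f q) a b = 0 \<and> n' = cross X \<phi> g (f q) a b"
    then obtain u v where uv: "positive_basis S q u v"
      and on: "g (f q) (differential S X f q u) (differential S X f q u) = 1"
        "g (f q) (differential S X f q v) (differential S X f q v) = 1"
        "g (f q) (differential S X f q u) (differential S X f q v) = 0"
      and n': "n' = cross X \<phi> g (f q) (differential S X f q u) (differential S X f q v)" by blast
    have T: "u \<in> tangent_space S q" "v \<in> tangent_space S q" using uv by (simp_all add: positive_basis_def)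
    have "det2 (u c) (v c) > 0" using uv positive_basis_iff[OF S c T] by simp
    from area(1)[OF this] have "?C (D (u c)) (D (v c)) = ?C (D a) (D b)"
      using on by (simp add: gm T)
    then have "n' d = N d" by (simp add: n' cr(2)[OF T] N(2))
    then show "n' = N" by (rule tangent_eqI[OF X _ N(1) d, rotated]) (simp only: n' cr(1)[OF T])
  qed
  with N show T: "n \<in> tangent_space X (f q)" by simp
  have nd: "n d = ?C (D a) (D b)" using \<open>n = N\<close> N(2) by simp
  have "?m (n d) (n d) = 1"
    unfolding nd by (rule P.n_unit[OF _ _ _ refl]) (use ab Bm in simp_all)
  then show "g (f q) n n = 1" by (simp add: metric_tangent[OF X gX d T T])
  show "det2 u v > 0 \<Longrightarrow> ?C (D u) (D v) = sqrt (B u u * B v v - (B u v)\<^sup>2) *\<^sub>R n d"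
    unfolding nd by (rule area(1))
  show "det2 u v > 0 \<Longrightarrow> B u u * B v v - (B u v)\<^sup>2 > 0" by (rule area(2))
qed

text \<open>Differentiate \<open>n = (e\<^sub>1 \<times> e\<^sub>2) / area\<close> for the images \<open>e\<^sub>1, e\<^sub>2\<close> of a constant basis, in the form
  \<open>g(k, n) area = \<phi>(k, e\<^sub>1, e\<^sub>2)\<close> with a constant test vector \<open>k\<close>. As \<open>\<phi>\<close> is parallel, the product rule
  holds for covariant derivatives, and the covariant derivatives of \<open>e\<^sub>1, e\<^sub>2\<close> are given by the
  Hessian. The derivative of the area contributes a multiple of \<open>n\<close> only.\<close>

lemma gauss_derivative:
  assumes p: "p \<in> carrier S" and v: "v \<in> tangent_space S p"
  defines "c \<equiv> chart_at S p"
  assumes d: "d \<in> X" "f p \<in> fst d"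
  defines "D \<equiv> frechet_derivative (in_charts c d f) (at (snd c p))"
    and "B \<equiv> induced_coord X g c d f (snd c p)" and "n \<equiv> \<lambda>q. snd (gauss_lift S X \<phi> g f q)"
    and "II \<equiv> chart_hessian X g c d f (snd c p)"
    and "C \<equiv> cross_coord X \<phi> g d (snd d (f p))"
  assumes u: "det2 u1 u2 > 0" "B u1 u1 = 1" "B u2 u2 = 1" "B u1 u2 = 0"
  shows "(\<lambda>y. n (chart_inv c y) d) differentiable (at (snd c p))"
    and "\<exists>r. nabla_along S X g f n p v d = C (II (v c) u1) (D u2) + C (D u1) (II (v c) u2) + r *\<^sub>R n p d"
    and "metric_coord X g d (snd d (f p)) (n p d) (nabla_along S X g f n p v d) = 0"
proof -
  note X = g2_atlas[OF g2] and gX = g2_metric[OF g2] and SA = surface_atlas and sm = surface_smooth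
  have c: "c \<in> S" "p \<in> fst c" using chart_at_mem[OF p] by (auto simp: c_def)
  define y0 where "y0 = snd c p"
  define F where "F = in_charts c d f"
  obtain U where U: "open U" "y0 \<in> U" "U \<subseteq> chart_image c" "f ` (chart_inv c ` U) \<subseteq> fst d" "smooth_on U F"
    unfolding y0_def F_def by (rule smooth_map_in_charts[OF SA X sm c d])
  have q: "chart_inv c y \<in> fst c" "snd c (chart_inv c y) = y" "f (chart_inv c y) \<in> fst d"
    "F y = snd d (f (chart_inv c y))" "F y \<in> chart_image d" if "y \<in> U" for y
  proof -
    have y: "y \<in> chart_image c" using that U(3) by blast
    show "chart_inv c y \<in> fst c" by (rule chart_inv_mem[OF y])
    show "snd c (chart_inv c y) = y" by (rule chart_chart_inv[OF y])
    show fq: "f (chart_inv c y) \<in> fst d" using that U(4) by blast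
    show Fy: "F y = snd d (f (chart_inv c y))" by (simp add: F_def)
    show "F y \<in> chart_image d" unfolding Fy by (rule chart_image_mem[OF fq])
  qed
  have p0: "chart_inv c y0 = p" unfolding y0_def by (rule chart_inv_chart[OF SA c])
  have F0: "F y0 = snd d (f p)" using q(4)[OF U(2)] p0 by simp
  define m where "m y = metric_coord X g d (F y)" for y
  define \<Phi> where "\<Phi> y = form_coord X \<phi> d (F y)" for y
  define \<Gamma> where "\<Gamma> = levi_civita X g d (F y0)"
  define e where "e w y = frechet_derivative F (at y) w" for w y
  define e' where "e' w = frechet_derivative (e w) (at y0)" for w
  define ny where "ny y = n (chart_inv c y) d" for y
  define Q where "Q y = m y (e u1 y) (e u1 y) * m y (e u2 y) (e u2 y) - (m y (e u1 y) (e u2 y))\<^sup>2" for y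
  have D: "D = (\<lambda>a. e a y0)" by (simp add: D_def e_def F_def y0_def)
  have II: "II a b = e' b a + \<Gamma> (e a y0) (e b y0)" for a b
    by (simp add: II_def chart_hessian_def e'_def \<Gamma>_def e_def[abs_def] F_def y0_def)
  have on: "m y0 (e u1 y0) (e u1 y0) = 1" "m y0 (e u2 y0) (e u2 y0) = 1" "m y0 (e u1 y0) (e u2 y0) = 0"
    using u(2-4) by (simp_all add: B_def induced_coord_def m_def e_def F_def y0_def)
  have im: "inner_form (m y)" if "y \<in> U" for y
    unfolding m_def by (rule metric_coord_inner_form[OF X gX d(1) q(5)[OF that]])
  have bm: "bilinear (m y)" and sm': "m y a b = m y b a" if "y \<in> U" for y a b
    using im[OF that] by (auto simp: inner_form_def)
  have b\<Phi>: "bilinear (\<Phi> y a)" "bilinear (\<lambda>a. \<Phi> y a b)" if "y \<in> U" for y a b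
    unfolding \<Phi>_def by (rule form_bilinear[OF g2 d(1) q(5)[OF that]])+
  have area: "m y k (ny y) * sqrt (Q y) = \<Phi> y k (e u1 y) (e u2 y)" and Qpos: "Q y > 0" if y: "y \<in> U" for y k
  proof -
    note G = gauss_lift_coord(3,4)[OF c(1) q(1)[OF y] d(1) q(3)[OF y] u(1), folded F_def, unfolded q(2)[OF y]
        induced_coord_def, folded F_def q(4)[OF y] m_def]
    show "Q y > 0" using G(2) by (simp add: Q_def e_def)
    have "cross_coord X \<phi> g d (F y) (e u1 y) (e u2 y) = sqrt (Q y) *\<^sub>R ny y"
      using G(1) by (simp only: Q_def e_def ny_def n_def)
    moreover have "m y k (cross_coord X \<phi> g d (F y) (e u1 y) (e u2 y)) = \<Phi> y k (e u1 y) (e u2 y)"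
      unfolding m_def \<Phi>_def q(4)[OF y] by (rule cross_coord_properties(2)[OF g2 d(1) q(3)[OF y]])
    ultimately show "m y k (ny y) * sqrt (Q y) = \<Phi> y k (e u1 y) (e u2 y)"
      by (simp add: bilinear_rmul[OF bm[OF y]] mult.commute)
  qed
  have unit: "m y (ny y) (ny y) = 1" if y: "y \<in> U" for y
    using gauss_lift_coord(2)[OF c(1) q(1)[OF y] d(1) q(3)[OF y]]
      metric_tangent[OF X gX d(1) q(3)[OF y] gauss_lift_coord(1)[OF c(1) q(1)[OF y] d(1) q(3)[OF y]]
        gauss_lift_coord(1)[OF c(1) q(1)[OF y] d(1) q(3)[OF y]]]
    by (simp add: m_def ny_def n_def q(4)[OF y])
  have dF: "(F has_derivative (\<lambda>a. e a y0)) (at y0)"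
    using smooth_on_has_derivative[OF U(5,2)] by (simp add: e_def)
  have de: "(e w has_derivative e' w) (at y0)" for w
    unfolding e'_def e_def[abs_def]
    by (rule smooth_on_has_derivative[OF smooth_on_derivative[OF U(5)] U(2)])
  have dm: "((\<lambda>y. m y (s y) (t y)) has_derivative (\<lambda>a. metric_derivative X g d (F y0) (e a y0) (s y0) (t y0)
      + m y0 (s' a) (t y0) + m y0 (s y0) (t' a))) (at y0)"
    if "(s has_derivative s') (at y0)" "(t has_derivative t') (at y0)" for s t s' t'
    unfolding m_def
    by (rule has_derivative_bilinear_family[OF open_chart_image[OF X d(1)] q(5)[OF U(2)] metric_bilinear[OF gX d(1)]
          metric_coord_has_derivative[OF X gX d(1) q(5)[OF U(2)]] dF that])
  have d\<Phi>: "((\<lambda>y. \<Phi> y k (e u1 y) (e u2 y)) has_derivative (\<lambda>a. form_derivative X \<phi> d (F y0) (e a y0) k (e u1 y0) (e u2 y0)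
      + \<Phi> y0 0 (e u1 y0) (e u2 y0) + \<Phi> y0 k (e' u1 a) (e u2 y0) + \<Phi> y0 k (e u1 y0) (e' u2 a))) (at y0)" for k
    unfolding \<Phi>_def
    by (rule has_derivative_trilinear_family[OF open_chart_image[OF X d(1)] q(5)[OF U(2)]
          form_bilinear(2)[OF g2 d(1)] form_bilinear(1)[OF g2 d(1)]
          form_has_derivative[OF g2 d(1) q(5)[OF U(2)]] dF has_derivative_const de de])
  have Q0: "Q y0 = 1" by (simp add: Q_def on)
  have "(\<lambda>y. m y (e w y) (e w' y)) differentiable (at y0)" for w w'
    using dm[OF de de] by (rule differentiableI)
  then have "Q differentiable (at y0)" unfolding Q_def[abs_def] power2_eq_square
    by (intro differentiable_diff differentiable_mult)
  then obtain Q' where "(Q has_derivative Q') (at y0)" by (auto simp: differentiable_def)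
  from has_derivative_real_sqrt[OF _ this] have dA: "((\<lambda>y. sqrt (Q y)) has_derivative (\<lambda>a. Q' a / 2)) (at y0)"
    by (simp add: Q0)
  have "ny differentiable (at y0)"
  proof (rule differentiable_represented[OF U(1,2) im])
    show "(\<lambda>y. m y a b) differentiable (at y0)" for a b
      using dm[OF has_derivative_const has_derivative_const] by (rule differentiableI)
    fix k
    have "(\<lambda>y. \<Phi> y k (e u1 y) (e u2 y) / sqrt (Q y)) differentiable (at y0)"
      by (rule differentiable_divide[OF differentiableI[OF d\<Phi>] differentiableI[OF dA]]) (simp add: Q0)
    moreover have "\<Phi> y k (e u1 y) (e u2 y) / sqrt (Q y) = m y (ny y) k" if "y \<in> U" for y
      using area[OF that, of k] Qpos[OF that] sm'[OF that, of k "ny y"] by (simp add: divide_simps)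
    ultimately show "(\<lambda>y. m y (ny y) k) differentiable (at y0)"
      using differentiable_cong_open[OF U(1,2), of "\<lambda>y. \<Phi> y k (e u1 y) (e u2 y) / sqrt (Q y)"
          "\<lambda>y. m y (ny y) k"] by simp
  qed
  then show "(\<lambda>y. n (chart_inv c y) d) differentiable (at (snd c p))"
    by (simp add: ny_def[abs_def] y0_def)
  from \<open>ny differentiable (at y0)\<close> have dn: "(ny has_derivative frechet_derivative ny (at y0)) (at y0)"
    by (rule frechet_derivative_worksI)
  define n' where "n' = frechet_derivative ny (at y0)"
  define n0 where "n0 = ny y0"
  have n0: "n p d = n0" by (simp add: n0_def ny_def p0)
  have met: "metric_derivative X g d (F y0) (e a y0) x y = m y0 (\<Gamma> (e a y0) x) y + m y0 x (\<Gamma> (e a y0) y)" for a x y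
    unfolding m_def \<Gamma>_def by (rule levi_civita_metric[OF X gX d(1) q(5)[OF U(2)]])
  have par: "form_derivative X \<phi> d (F y0) (e a y0) x y z = \<Phi> y0 (\<Gamma> (e a y0) x) y z + \<Phi> y0 x (\<Gamma> (e a y0) y) z
      + \<Phi> y0 x y (\<Gamma> (e a y0) z)" for a x y z
    unfolding \<Phi>_def \<Gamma>_def by (rule form_parallel[OF g2 d(1) q(5)[OF U(2)]])
  note B0 = bm[OF U(2)] and S0 = sm'[OF U(2)]
  have \<Phi>n: "\<Phi> y0 k (e u1 y0) (e u2 y0) = m y0 k n0" for k
    using area[OF U(2), of k] by (simp add: Q0 n0_def)
  have \<Phi>C: "\<Phi> y0 k x y = m y0 k (C x y)" for k x y
    unfolding \<Phi>_def m_def C_def F0 by (rule cross_coord_properties(2)[OF g2 d, symmetric])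
  have m0: "m y0 0 x = 0" "m y0 x 0 = 0" for x by (simp_all add: bilinear_lzero[OF B0] bilinear_rzero[OF B0])
  \<comment> \<open>The derivatives of both sides of the area equation are compared. The Christoffel terms in which
    the test vector \<open>k\<close> is differentiated agree on the two sides, since the area is \<open>1\<close> at the point.\<close>
  have key: "n' a + \<Gamma> (e a y0) n0 = C (II a u1) (e u2 y0) + C (e u1 y0) (II a u2) - (Q' a / 2) *\<^sub>R n0" for a
  proof (rule inner_form_nondegenerate[OF im[OF U(2)]])
    fix k
    have "((\<lambda>y. m y k (ny y) * sqrt (Q y)) has_derivative (\<lambda>a. m y0 k n0 * (Q' a / 2)
        + (metric_derivative X g d (F y0) (e a y0) k n0 + m y0 0 n0 + m y0 k (n' a)) * sqrt (Q y0))) (at y0)"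
      unfolding n0_def n'_def by (rule has_derivative_mult[OF dm[OF has_derivative_const dn] dA])
    then have "((\<lambda>y. \<Phi> y k (e u1 y) (e u2 y)) has_derivative (\<lambda>a. m y0 k n0 * (Q' a / 2)
        + (metric_derivative X g d (F y0) (e a y0) k n0 + m y0 0 n0 + m y0 k (n' a)) * sqrt (Q y0))) (at y0)"
      by (rule has_derivative_transform_within_open[OF _ U(1,2)]) (rule area)
    from fun_cong[OF has_derivative_unique[OF this d\<Phi>], of a]
    have "m y0 k n0 * (Q' a / 2) + m y0 k (\<Gamma> (e a y0) n0) + m y0 k (n' a)
       = \<Phi> y0 k (e' u1 a) (e u2 y0) + \<Phi> y0 k (\<Gamma> (e a y0) (e u1 y0)) (e u2 y0)
         + (\<Phi> y0 k (e u1 y0) (e' u2 a) + \<Phi> y0 k (e u1 y0) (\<Gamma> (e a y0) (e u2 y0)))"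
      by (simp add: met par Q0 \<Phi>n m0)
    also have "\<dots> = \<Phi> y0 k (II a u1) (e u2 y0) + \<Phi> y0 k (e u1 y0) (II a u2)"
      by (simp add: II bilinear_ladd[OF b\<Phi>(1)[OF U(2)]] bilinear_radd[OF b\<Phi>(1)[OF U(2)]])
    finally have "m y0 k (n' a + \<Gamma> (e a y0) n0) = m y0 k (C (II a u1) (e u2 y0) + C (e u1 y0) (II a u2) - (Q' a / 2) *\<^sub>R n0)"
      by (simp add: \<Phi>C bilinear_radd[OF B0] bilinear_rsub[OF B0] bilinear_rmul[OF B0] algebra_simps)
    then show "m y0 (n' a + \<Gamma> (e a y0) n0) k = m y0 (C (II a u1) (e u2 y0) + C (e u1 y0) (II a u2) - (Q' a / 2) *\<^sub>R n0) k"
      by (metis S0)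
  qed
  have orth: "m y0 n0 (n' a + \<Gamma> (e a y0) n0) = 0" for a
  proof -
    have "((\<lambda>y. m y (ny y) (ny y)) has_derivative (\<lambda>a. metric_derivative X g d (F y0) (e a y0) n0 n0
       + m y0 (n' a) n0 + m y0 n0 (n' a))) (at y0)"
      unfolding n0_def n'_def by (rule dm[OF dn dn])
    moreover have "((\<lambda>y. m y (ny y) (ny y)) has_derivative (\<lambda>a. 0)) (at y0)"
      by (rule has_derivative_transform_within_open[OF has_derivative_const U(1,2)]) (rule unit[symmetric])
    ultimately have "metric_derivative X g d (F y0) (e a y0) n0 n0 + m y0 (n' a) n0 + m y0 n0 (n' a) = 0"
      using fun_cong[OF has_derivative_unique, of _ "\<lambda>a. metric_derivative X g d (F y0) (e a y0) n0 n0
       + m y0 (n' a) n0 + m y0 n0 (n' a)" y0 "\<lambda>a. 0" a] by blast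
    then show ?thesis
      using S0[of "n' a" n0] S0[of "\<Gamma> (e a y0) n0" n0] by (simp add: met bilinear_radd[OF B0])
  qed
  have nab: "nabla_along S X g f n p v d = n' (v c) + \<Gamma> (e (v c) y0) n0"
  proof -
    have "differential S X f p v d = e (v c) y0"
      unfolding e_def F_def y0_def by (rule differential_component[OF SA X sm c d v])
    then show ?thesis
      using d by (simp add: nabla_along_def c_def[symmetric] n'_def ny_def[abs_def] y0_def[symmetric] n0 \<Gamma>_def F0)
  qed
  show "\<exists>r. nabla_along S X g f n p v d = C (II (v c) u1) (D u2) + C (D u1) (II (v c) u2) + r *\<^sub>R n p d"
    unfolding nab key D n0 by (rule exI[of _ "- (Q' (v c) / 2)"]) simp
  show "metric_coord X g d (snd d (f p)) (n p d) (nabla_along S X g f n p v d) = 0"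
    using orth[of "v c"] by (simp add: nab n0 m_def F0)
qed

text \<open>In a bundle chart the derivative of \<open>(f, \<eta>)\<close> is \<open>(DF, D\<eta>)\<close>, and \<open>D\<eta>\<close> is the covariant
  derivative of \<open>\<eta>\<close> minus the Christoffel term.\<close>

lemma gauss_lift_derivative:
  assumes p: "p \<in> carrier S" and v: "v \<in> tangent_space S p"
  defines "n \<equiv> \<lambda>q. snd (gauss_lift S X \<phi> g f q)"
  shows "differential S (tangent_bundle X) (gauss_lift S X \<phi> g f) p v =
     connection_lift X g (f p, n p) (differential S X f p v) (nabla_along S X g f n p v)"
    and "nabla_along S X g f n p v \<in> tangent_space X (f p)"
    and "g (f p) (n p) (nabla_along S X g f n p v) = 0"
proof -
  note X = g2_atlas[OF g2] and gX = g2_metric[OF g2] and SA = surface_atlas and sm = surface_smooth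
  define c where "c = chart_at S p"
  have c: "c \<in> S" "p \<in> fst c" using chart_at_mem[OF p] by (auto simp: c_def)
  have GL: "gauss_lift S X \<phi> g f q = (f q, n q)" for q by (simp add: n_def gauss_lift_def)
  have on: "\<exists>u1 u2. det2 u1 u2 > 0 \<and> induced_coord X g c d f (snd c p) u1 u1 = 1 \<and>
      induced_coord X g c d f (snd c p) u2 u2 = 1 \<and> induced_coord X g c d f (snd c p) u1 u2 = 0"
    if d: "d \<in> X" "f p \<in> fst d" for d
    using positive_orthonormal_basis[OF induced_inner_form(1)[OF SA X gX f c d]] by metis
  have dif: "(\<lambda>y. n (chart_inv c y) d) differentiable (at (snd c p))"
    and orth: "metric_coord X g d (snd d (f p)) (n p d) (nabla_along S X g f n p v d) = 0"
    if d: "d \<in> X" "f p \<in> fst d" for d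
    using gauss_derivative(1,3)[OF p v d] on[OF d] unfolding c_def n_def by blast+
  define d where "d = chart_at X (f p)"
  have d: "d \<in> X" "f p \<in> fst d"
    using chart_at_mem[OF smooth_map_carrier[OF SA sm p]] by (auto simp: d_def)
  obtain U where U: "open U" "snd c p \<in> U" "U \<subseteq> chart_image c" "f ` (chart_inv c ` U) \<subseteq> fst d" "smooth_on U (in_charts c d f)"
    by (rule smooth_map_in_charts[OF SA X sm c d])
  have nT: "n (chart_inv c y) \<in> tangent_space X (f (chart_inv c y))" if y: "y \<in> U" for y
    unfolding n_def
  proof (rule gauss_lift_coord(1)[OF c(1) _ d(1)])
    show "chart_inv c y \<in> fst c" by (rule chart_inv_mem[OF subsetD[OF U(3) y]])
    show "f (chart_inv c y) \<in> fst d" using U(4) y by blast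
  qed
  have np: "n p \<in> tangent_space X (f p)" unfolding n_def by (rule gauss_lift_coord(1)[OF c d])
  show T: "nabla_along S X g f n p v \<in> tangent_space X (f p)"
    by (rule nabla_along_tangent(1)[OF SA X gX sm p v U(1) U(2)[unfolded c_def] nT[unfolded c_def] d
          dif[OF d, unfolded c_def]])
  show "g (f p) (n p) (nabla_along S X g f n p v) = 0"
    using orth[OF d] metric_tangent[OF X gX d np T] by simp
  show "differential S (tangent_bundle X) (gauss_lift S X \<phi> g f) p v =
     connection_lift X g (f p, n p) (differential S X f p v) (nabla_along S X g f n p v)"
  proof (rule connection_lift_eqI[OF X gX np])
    fix d
    assume d: "d \<in> X" "f p \<in> fst d"
    have "(\<lambda>y. (in_charts c d f y, n (chart_inv c y) d)) =
        in_charts c (bundle_chart X d) (gauss_lift S X \<phi> g f)"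
      by (simp add: fun_eq_iff GL snd_bundle_chart)
    with has_derivative_Pair[OF in_charts_has_derivative[OF SA X sm c d] frechet_derivative_worksI[OF dif[OF d]]]
    have "(in_charts c (bundle_chart X d) (gauss_lift S X \<phi> g f) has_derivative
        (\<lambda>a. (frechet_derivative (in_charts c d f) (at (snd c p)) a,
              frechet_derivative (\<lambda>y. n (chart_inv c y) d) (at (snd c p)) a))) (at (snd c p))"
      by (simp only:)
    note frechet_derivative_eqI[OF this]
    moreover have "bundle_chart X d \<in> tangent_bundle X" "(f p, n p) \<in> fst (bundle_chart X d)"
      using d np by (simp_all add: tangent_bundle_eq fst_bundle_chart)
    ultimately show "differential S (tangent_bundle X) (gauss_lift S X \<phi> g f) p v (bundle_chart X d) =
        (differential S X f p v d, nabla_along S X g f n p v d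
           - levi_civita X g d (snd d (f p)) (differential S X f p v d) (n p d))"
      using d by (simp add: differential_def nabla_along_def GL c_def[symmetric])
  next
    fix D assume "\<not> (D \<in> tangent_bundle X \<and> (f p, n p) \<in> fst D)"
    then show "differential S (tangent_bundle X) (gauss_lift S X \<phi> g f) p v D = 0"
      by (auto simp: differential_def GL)
  qed
qed

end

section \<open>The second fundamental form and the tension field in charts\<close>

text \<open>A local field is given in some chart; in another chart its components are transformed by
  the Jacobian of the transition map, which is itself differentiable.\<close>

lemma smooth_field_in_chart:
  fixes M :: "('a, 'b::euclidean_space) chart set"
  assumes M: "smooth_atlas M" and W: "smooth_field_near M p W" and c: "c \<in> M" "p \<in> fst c"
  obtains U where "open U" "snd c p \<in> U" "U \<subseteq> chart_image c"
    "\<forall>y\<in>U. W (chart_inv c y) \<in> tangent_space M (chart_inv c y)"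
    "(\<lambda>y. W (chart_inv c y) c) differentiable (at (snd c p))"
proof -
  obtain c' U' where c': "c' \<in> M" "p \<in> fst c'" and U': "open U'" "snd c' p \<in> U'" "U' \<subseteq> chart_image c'"
      "\<And>y. y \<in> U' \<Longrightarrow> W (chart_inv c' y) \<in> tangent_space M (chart_inv c' y)"
      "smooth_on U' (\<lambda>y. W (chart_inv c' y) c')"
    using W unfolding smooth_field_near_def by blast
  define A where "A = snd c ` (fst c \<inter> fst c')"
  define T where "T = snd c' \<circ> chart_inv c"
  define U where "U = A \<inter> T -` U'"
  have oA: "open A" unfolding A_def by (rule open_overlap[OF M c(1) c'(1)])
  have sT: "smooth_on A T" unfolding A_def T_def by (rule smooth_transition[OF M c(1) c'(1)])
  have oU: "open U" unfolding U_def
    by (rule continuous_open_preimage[OF smooth_on_continuous_on[OF sT] oA U'(1)])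
  have Tp: "T (snd c p) = snd c' p" by (simp add: T_def chart_inv_chart[OF M c])
  have pA: "snd c p \<in> A" unfolding A_def using c c' by blast
  have pU: "snd c p \<in> U" using pA U'(2) by (simp add: U_def Tp)
  have q: "y \<in> chart_image c" "chart_inv c y \<in> fst c" "chart_inv c y \<in> fst c'"
     "chart_inv c' (T y) = chart_inv c y" "T y \<in> U'" "T y = snd c' (chart_inv c y)" if "y \<in> U" for y
  proof -
    have "y \<in> A" using that by (simp add: U_def)
    then show y: "y \<in> chart_image c" and i': "chart_inv c y \<in> fst c'"
      unfolding A_def overlap_iff[OF M c(1)] by blast+
    show "chart_inv c y \<in> fst c" by (rule chart_inv_mem[OF y])
    show "chart_inv c' (T y) = chart_inv c y" unfolding T_def comp_apply by (rule chart_inv_chart[OF M c'(1) i'])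
    show "T y \<in> U'" using that by (simp add: U_def)
    show "T y = snd c' (chart_inv c y)" by (simp add: T_def)
  qed
  have tan: "W (chart_inv c y) \<in> tangent_space M (chart_inv c y)" if "y \<in> U" for y
    using U'(4)[OF q(5)[OF that]] by (simp only: q(4)[OF that])
  have dT: "(T has_derivative frechet_derivative T (at (snd c p))) (at (snd c p))"
    by (rule smooth_on_has_derivative[OF sT pA])
  have dW: "((\<lambda>y. W (chart_inv c' y) c') has_derivative frechet_derivative (\<lambda>y. W (chart_inv c' y) c') (at (snd c' p))) (at (T (snd c p)))"
    unfolding Tp by (rule smooth_on_has_derivative[OF U'(5,2)])
  have ov: "snd c' p \<in> snd c' ` (fst c' \<inter> fst c)" using c c' by blast
  have "((\<lambda>y. transition_jacobian c' c (T y) (W (chart_inv c' (T y)) c')) has_derivative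
     (\<lambda>v. frechet_derivative (\<lambda>z. transition_jacobian c' c z (W (chart_inv c' (T (snd c p))) c')) (at (snd c' p)) (frechet_derivative T (at (snd c p)) v)
      + transition_jacobian c' c (T (snd c p)) (frechet_derivative (\<lambda>y. W (chart_inv c' y) c') (at (snd c' p)) (frechet_derivative T (at (snd c p)) v))))
     (at (snd c p))"
  proof (rule has_derivative_linear_family[OF open_overlap[OF M c'(1) c(1)] _ _ _ dT has_derivative_compose[OF dT dW]])
    show "T (snd c p) \<in> snd c' ` (fst c' \<inter> fst c)" unfolding Tp by (rule ov)
    show "linear (transition_jacobian c' c y)" if "y \<in> snd c' ` (fst c' \<inter> fst c)" for y
      by (rule smooth_on_linear_derivative[OF smooth_transition[OF M c'(1) c(1)] that])
    show "((\<lambda>z. transition_jacobian c' c z a) has_derivative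
        (\<lambda>v. frechet_derivative (\<lambda>z. transition_jacobian c' c z a) (at (snd c' p)) v)) (at (T (snd c p)))" for a
      unfolding Tp by (rule smooth_on_has_derivative[OF smooth_on_derivative[OF smooth_transition[OF M c'(1) c(1)]] ov])
  qed
  then have "((\<lambda>y. W (chart_inv c y) c) has_derivative
     (\<lambda>v. frechet_derivative (\<lambda>z. transition_jacobian c' c z (W (chart_inv c' (T (snd c p))) c')) (at (snd c' p)) (frechet_derivative T (at (snd c p)) v)
      + transition_jacobian c' c (T (snd c p)) (frechet_derivative (\<lambda>y. W (chart_inv c' y) c') (at (snd c' p)) (frechet_derivative T (at (snd c p)) v))))
     (at (snd c p))"
  proof (rule has_derivative_transform_within_open[OF _ oU pU])
    fix y assume y: "y \<in> U"
    show "transition_jacobian c' c (T y) (W (chart_inv c' (T y)) c') = W (chart_inv c y) c"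
      unfolding q(4)[OF y] unfolding q(6)[OF y]
      by (rule tangent_transition[OF M tan[OF y] c'(1) q(3)[OF y] c(1) q(2)[OF y], symmetric])
  qed
  then have "(\<lambda>y. W (chart_inv c y) c) differentiable (at (snd c p))" by (rule differentiableI)
  moreover have "U \<subseteq> chart_image c" using q(1) by blast
  ultimately show ?thesis using that[of U] oU pU tan by blast
qed

text \<open>The extension for which the definitions of \<open>\<nabla>df\<close> and of the second fundamental form are evaluated.\<close>

lemma constant_field:
  assumes M: "smooth_atlas M" and c: "c \<in> M" "p \<in> fst c" and w: "w \<in> tangent_space M p"
  defines "W \<equiv> \<lambda>q. tangent_of M c q (w c)"
  shows "smooth_field_near M p W" and "W p = w"
    and "frechet_derivative (\<lambda>y. W (chart_inv c y) c) (at (snd c p)) = (\<lambda>v. 0)"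
proof -
  have y: "W (chart_inv c y) \<in> tangent_space M (chart_inv c y)" "W (chart_inv c y) c = w c" if "y \<in> chart_image c" for y
    unfolding W_def by (rule tangent_of_mem[OF M c(1) chart_inv_mem[OF that]], rule tangent_of_same[OF M c(1) chart_inv_mem[OF that]])
  note oc = open_chart_image[OF M c(1)] and pc = chart_image_mem[OF c(2)]
  have "smooth_on (chart_image c) (\<lambda>y. W (chart_inv c y) c)"
    by (rule smooth_on_cong[OF oc, THEN iffD1, OF _ smooth_on_const[of _ "w c"]]) (simp only: y(2))
  then show "smooth_field_near M p W"
    unfolding smooth_field_near_def using c oc pc y(1)
    by (intro bexI[of _ c] exI[of _ "chart_image c"]) simp_all
  show "W p = w" unfolding W_def by (rule tangent_of_component[OF M w c])
  have "((\<lambda>y. W (chart_inv c y) c) has_derivative (\<lambda>v. 0)) (at (snd c p))"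
    by (rule has_derivative_transform_within_open[OF has_derivative_const oc pc]) (simp only: y(2))
  then show "frechet_derivative (\<lambda>y. W (chart_inv c y) c) (at (snd c p)) = (\<lambda>v. 0)"
    by (rule frechet_derivative_eqI)
qed

context
  fixes M :: "('a, 'b::euclidean_space) chart set" and N :: "('c, 'd::euclidean_space) chart set"
    and h :: "('a, 'b) metric_tensor" and g :: "('c, 'd) metric_tensor" and f :: "'a \<Rightarrow> 'c"
  assumes M: "smooth_atlas M" and h: "riemannian_metric M h" and N: "smooth_atlas N"
    and g: "riemannian_metric N g" and f: "smooth_map M N f"
begin

text \<open>The product rule for \<open>y \<mapsto> DF(y) W(y)\<close>, which represents \<open>df W\<close> in charts.\<close>

lemma nabla_along_of_differential:
  assumes p: "p \<in> carrier M" and v: "v \<in> tangent_space M p" and W: "smooth_field_near M p W"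
  defines "c \<equiv> chart_at M p"
  assumes d: "d \<in> N" "f p \<in> fst d"
  shows "nabla_along M N g f (\<lambda>q. differential M N f q (W q)) p v d =
     chart_hessian N g c d f (snd c p) (v c) (W p c)
     + frechet_derivative (in_charts c d f) (at (snd c p)) (frechet_derivative (\<lambda>y. W (chart_inv c y) c) (at (snd c p)) (v c))"
    and "(\<lambda>y. differential M N f (chart_inv c y) (W (chart_inv c y)) d) differentiable (at (snd c p))"
proof -
  have c: "c \<in> M" "p \<in> fst c" using chart_at_mem[OF p] by (auto simp: c_def)
  have p0: "chart_inv c (snd c p) = p" by (rule chart_inv_chart[OF M c])
  define F where "F = in_charts c d f"
  define W' where "W' = frechet_derivative (\<lambda>y. W (chart_inv c y) c) (at (snd c p))"
  obtain V where V: "open V" "snd c p \<in> V" "V \<subseteq> chart_image c"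
      "\<forall>y\<in>V. W (chart_inv c y) \<in> tangent_space M (chart_inv c y)"
      "(\<lambda>y. W (chart_inv c y) c) differentiable (at (snd c p))"
    by (rule smooth_field_in_chart[OF M W c])
  obtain U where U: "open U" "snd c p \<in> U" "U \<subseteq> chart_image c" "f ` (chart_inv c ` U) \<subseteq> fst d" "smooth_on U F"
    unfolding F_def by (rule smooth_map_in_charts[OF M N f c d])
  have Wp: "W p \<in> tangent_space M p" using bspec[OF V(4,2)] by (simp only: p0)
  have comp: "differential M N f (chart_inv c y) (W (chart_inv c y)) d = frechet_derivative F (at y) (W (chart_inv c y) c)"
    if y: "y \<in> U \<inter> V" for y
  proof -
    have yc: "y \<in> chart_image c" using y U(3) by blast
    have fd: "f (chart_inv c y) \<in> fst d" using y U(4) by blast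
    show ?thesis
      using differential_component[OF M N f c(1) chart_inv_mem[OF yc] d(1) fd bspec[OF V(4), of y]] y
      by (simp add: F_def chart_chart_inv[OF yc])
  qed
  have "((\<lambda>y. frechet_derivative F (at y) (W (chart_inv c y) c)) has_derivative
      (\<lambda>a. frechet_derivative (\<lambda>z. frechet_derivative F (at z) (W (chart_inv c (snd c p)) c)) (at (snd c p)) a
         + frechet_derivative F (at (snd c p)) (W' a))) (at (snd c p))"
    unfolding W'_def
    by (rule has_derivative_linear_family[OF U(1) _ _ _ has_derivative_ident frechet_derivative_worksI[OF V(5)]])
       (simp_all add: U(2) smooth_on_linear_derivative[OF U(5)] smooth_on_has_derivative[OF smooth_on_derivative[OF U(5)] U(2)])
  then have D: "((\<lambda>y. differential M N f (chart_inv c y) (W (chart_inv c y)) d) has_derivative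
      (\<lambda>a. frechet_derivative (\<lambda>z. frechet_derivative F (at z) (W p c)) (at (snd c p)) a
         + frechet_derivative F (at (snd c p)) (W' a))) (at (snd c p))"
    unfolding p0
    by (rule has_derivative_transform_within_open[of _ _ _ _ "U \<inter> V"]) (use U V comp in \<open>auto simp: open_Int\<close>)
  then show "(\<lambda>y. differential M N f (chart_inv c y) (W (chart_inv c y)) d) differentiable (at (snd c p))"
    by (rule differentiableI)
  have "differential M N f p v d = frechet_derivative F (at (snd c p)) (v c)"
    "differential M N f p (W p) d = frechet_derivative F (at (snd c p)) (W p c)"
    unfolding F_def by (rule differential_component[OF M N f c d v], rule differential_component[OF M N f c d Wp])
  then show "nabla_along M N g f (\<lambda>q. differential M N f q (W q)) p v d =
     chart_hessian N g c d f (snd c p) (v c) (W p c)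
     + frechet_derivative (in_charts c d f) (at (snd c p)) (frechet_derivative (\<lambda>y. W (chart_inv c y) c) (at (snd c p)) (v c))"
    using d by (simp add: nabla_along_def c_def[symmetric] frechet_derivative_eqI[OF D] chart_hessian_def
        F_def[symmetric] W'_def[symmetric]) (simp add: F_def p0)
qed

lemma nabla_along_of_differential_tangent:
  assumes p: "p \<in> carrier M" and v: "v \<in> tangent_space M p" and W: "smooth_field_near M p W"
  shows "nabla_along M N g f (\<lambda>q. differential M N f q (W q)) p v \<in> tangent_space N (f p)"
proof -
  define c where "c = chart_at M p"
  define d where "d = chart_at N (f p)"
  have c: "c \<in> M" "p \<in> fst c" using chart_at_mem[OF p] by (auto simp: c_def)
  have d: "d \<in> N" "f p \<in> fst d"
    using chart_at_mem[OF smooth_map_carrier[OF M f p]] by (auto simp: d_def)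
  have "differential M N f (chart_inv c y) (W (chart_inv c y)) \<in> tangent_space N (f (chart_inv c y))"
    if "y \<in> chart_image c" for y
    by (rule differential_mem[OF M N f carrier_mem[OF c(1) chart_inv_mem[OF that]]])
  then show ?thesis
    by (intro nabla_along_tangent(1)[where s="\<lambda>q. differential M N f q (W q)",
          OF M N g f p v open_chart_image[OF M c(1), unfolded c_def] chart_image_mem[OF c(2), unfolded c_def]
          _ d nabla_along_of_differential(2)[OF p v W d]]) (simp add: c_def)
qed

text \<open>The derivative of the chosen extension of \<open>w\<close> enters both \<open>\<nabla>\<^sub>v (df W)\<close> and \<open>df (\<nabla>\<^sub>v W)\<close> and
  cancels.\<close>

lemma nabla_differential_component:
  assumes p: "p \<in> carrier M" and v: "v \<in> tangent_space M p" and w: "w \<in> tangent_space M p"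
  defines "c \<equiv> chart_at M p"
  shows "d \<in> N \<Longrightarrow> f p \<in> fst d \<Longrightarrow> nabla_differential M h N g f p v w d =
      chart_hessian N g c d f (snd c p) (v c) (w c)
      - frechet_derivative (in_charts c d f) (at (snd c p)) (levi_civita M h c (snd c p) (v c) (w c))"
    and "\<not> (d \<in> N \<and> f p \<in> fst d) \<Longrightarrow> nabla_differential M h N g f p v w d = 0"
proof -
  have c: "c \<in> M" "p \<in> fst c" using chart_at_mem[OF p] by (auto simp: c_def)
  define R where "R W = nabla_along M N g f (\<lambda>q. differential M N f q (W q)) p v
            - differential M N f p (nabla_along M M h (\<lambda>q. q) W p v)" for W
  have in_d: "R W d = chart_hessian N g c d f (snd c p) (v c) (w c)
      - frechet_derivative (in_charts c d f) (at (snd c p)) (levi_civita M h c (snd c p) (v c) (w c))"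
    if W: "smooth_field_near M p W" "W p = w" and d: "d \<in> N" "f p \<in> fst d" for W d
  proof -
    let ?D = "frechet_derivative (in_charts c d f) (at (snd c p))"
    have lin: "linear ?D" by (rule has_derivative_linear[OF in_charts_has_derivative[OF M N f c d]])
    have "differential M M (\<lambda>q. q) p v c = v c"
      using c transition_self[OF M c] by (simp add: differential_def c_def[symmetric] comp_def)
    then have "nabla_along M M h (\<lambda>q. q) W p v c =
        frechet_derivative (\<lambda>y. W (chart_inv c y) c) (at (snd c p)) (v c) + levi_civita M h c (snd c p) (v c) (w c)"
      using c W(2) by (simp add: nabla_along_def c_def[symmetric])
    then have "differential M N f p (nabla_along M M h (\<lambda>q. q) W p v) d =
        ?D (frechet_derivative (\<lambda>y. W (chart_inv c y) c) (at (snd c p)) (v c)) + ?D (levi_civita M h c (snd c p) (v c) (w c))"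
      using d by (simp add: differential_def c_def[symmetric] linear_add[OF lin])
    then show ?thesis
      unfolding R_def fun_diff_def nabla_along_of_differential(1)[OF p v W(1) d, folded c_def] W(2) by simp
  qed
  have out: "R W d = 0" if "\<not> (d \<in> N \<and> f p \<in> fst d)" for W d
    using that by (auto simp: R_def nabla_along_def differential_def)
  have const: "smooth_field_near M p (\<lambda>q. tangent_of M c q (w c))" "tangent_of M c p (w c) = w"
    using constant_field(1,2)[OF M c w] by auto
  have "nabla_differential M h N g f p v w = R (\<lambda>q. tangent_of M c q (w c))"
    unfolding nabla_differential_def R_def[symmetric]
  proof (rule the_equality)
    show "\<forall>W. smooth_field_near M p W \<and> W p = w \<longrightarrow> R (\<lambda>q. tangent_of M c q (w c)) = R W"
    proof (intro allI impI ext)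
      fix W d assume W: "smooth_field_near M p W \<and> W p = w"
      show "R (\<lambda>q. tangent_of M c q (w c)) d = R W d"
        by (cases "d \<in> N \<and> f p \<in> fst d") (use in_d[OF const] in_d W out in \<open>simp_all\<close>)
    qed
  qed (use const in blast)
  then show "d \<in> N \<Longrightarrow> f p \<in> fst d \<Longrightarrow> nabla_differential M h N g f p v w d =
      chart_hessian N g c d f (snd c p) (v c) (w c)
      - frechet_derivative (in_charts c d f) (at (snd c p)) (levi_civita M h c (snd c p) (v c) (w c))"
    "\<not> (d \<in> N \<and> f p \<in> fst d) \<Longrightarrow> nabla_differential M h N g f p v w d = 0"
    using in_d[OF const] out by simp_all
qed

lemma chart_hessian_bilinear:
  assumes c: "c \<in> M" "p \<in> fst c" and d: "d \<in> N" "f p \<in> fst d"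
  shows "chart_hessian N g c d f (snd c p) a b = chart_hessian N g c d f (snd c p) b a"
    and "bilinear (chart_hessian N g c d f (snd c p))"
proof -
  define F where "F = in_charts c d f"
  obtain U where U: "open U" "snd c p \<in> U" "U \<subseteq> chart_image c" "f ` (chart_inv c ` U) \<subseteq> fst d" "smooth_on U F"
    unfolding F_def by (rule smooth_map_in_charts[OF M N f c d])
  have F0: "in_charts c d f (snd c p) = snd d (f p)" by (simp add: chart_inv_chart[OF M c])
  note \<Gamma> = levi_civita_bilinear[OF N g d(1) chart_image_mem[OF d(2)]]
    levi_civita_sym[OF N g d(1) chart_image_mem[OF d(2)]]
  have H: "chart_hessian N g c d f (snd c p) a b = frechet_derivative (\<lambda>z. frechet_derivative F (at z) b) (at (snd c p)) a
     + levi_civita N g d (snd d (f p)) (frechet_derivative F (at (snd c p)) a) (frechet_derivative F (at (snd c p)) b)" for a b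
    unfolding chart_hessian_def F0 F_def ..
  have s: "chart_hessian N g c d f (snd c p) a b = chart_hessian N g c d f (snd c p) b a" for a b
    unfolding H second_derivative_symmetric[OF U(1,5,2), of b a] \<Gamma>(2)[of _ "frechet_derivative F (at (snd c p)) b"] ..
  then show "chart_hessian N g c d f (snd c p) a b = chart_hessian N g c d f (snd c p) b a" .
  have l1: "linear (frechet_derivative F (at (snd c p)))" by (rule smooth_on_linear_derivative[OF U(5,2)])
  have l2: "linear (frechet_derivative (\<lambda>z. frechet_derivative F (at z) b) (at (snd c p)))" for b
    by (rule smooth_on_linear_derivative[OF smooth_on_derivative[OF U(5)] U(2)])
  have "linear (\<lambda>a. chart_hessian N g c d f (snd c p) a b)" for b
    unfolding H
    by (intro linear_compose_add l2 bilinear_linear_left[OF bilinear_compose_linear[OF \<Gamma>(1) l1]])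
  moreover have "(\<lambda>b. chart_hessian N g c d f (snd c p) b a) = chart_hessian N g c d f (snd c p) a" for a
    using s by blast
  ultimately show "bilinear (chart_hessian N g c d f (snd c p))"
    unfolding bilinear_def by metis
qed

text \<open>Metric compatibility along \<open>f\<close>: the Christoffel term of the Hessian accounts for the
  derivative of the metric coefficients.\<close>

lemma induced_has_derivative:
  assumes c: "c \<in> M" "p \<in> fst c" and d: "d \<in> N" "f p \<in> fst d"
  defines "D \<equiv> frechet_derivative (in_charts c d f) (at (snd c p))"
    and "II \<equiv> chart_hessian N g c d f (snd c p)" and "m \<equiv> metric_coord N g d (snd d (f p))"
  shows "((\<lambda>y. induced_coord N g c d f y b k) has_derivative
     (\<lambda>a. m (II a b) (D k) + m (D b) (II a k))) (at (snd c p))"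
proof -
  define F where "F = in_charts c d f"
  obtain U where U: "open U" "snd c p \<in> U" "U \<subseteq> chart_image c" "f ` (chart_inv c ` U) \<subseteq> fst d" "smooth_on U F"
    unfolding F_def by (rule smooth_map_in_charts[OF M N f c d])
  have F0: "F (snd c p) = snd d (f p)" by (simp add: F_def chart_inv_chart[OF M c])
  have Fd: "F (snd c p) \<in> chart_image d" unfolding F0 by (rule chart_image_mem[OF d(2)])
  have bm: "bilinear m" unfolding m_def by (rule metric_bilinear[OF g d(1) chart_image_mem[OF d(2)]])
  have de: "((\<lambda>y. frechet_derivative F (at y) w) has_derivative
      (\<lambda>a. frechet_derivative (\<lambda>y. frechet_derivative F (at y) w) (at (snd c p)) a)) (at (snd c p))" for w
    by (rule smooth_on_has_derivative[OF smooth_on_derivative[OF U(5)] U(2)])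
  have "((\<lambda>y. metric_coord N g d (F y) (frechet_derivative F (at y) b) (frechet_derivative F (at y) k)) has_derivative
     (\<lambda>a. metric_derivative N g d (F (snd c p)) (frechet_derivative F (at (snd c p)) a)
            (frechet_derivative F (at (snd c p)) b) (frechet_derivative F (at (snd c p)) k)
        + metric_coord N g d (F (snd c p)) (frechet_derivative (\<lambda>y. frechet_derivative F (at y) b) (at (snd c p)) a) (frechet_derivative F (at (snd c p)) k)
        + metric_coord N g d (F (snd c p)) (frechet_derivative F (at (snd c p)) b) (frechet_derivative (\<lambda>y. frechet_derivative F (at y) k) (at (snd c p)) a)))
     (at (snd c p))"
    by (rule has_derivative_bilinear_family[OF open_chart_image[OF N d(1)] Fd metric_bilinear[OF g d(1)]
          metric_coord_has_derivative[OF N g d(1) Fd] smooth_on_has_derivative[OF U(5,2)] de de])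
  then have 1: "((\<lambda>y. induced_coord N g c d f y b k) has_derivative
     (\<lambda>a. metric_derivative N g d (F (snd c p)) (D a) (D b) (D k)
        + m (frechet_derivative (\<lambda>y. frechet_derivative F (at y) b) (at (snd c p)) a) (D k)
        + m (D b) (frechet_derivative (\<lambda>y. frechet_derivative F (at y) k) (at (snd c p)) a)))
     (at (snd c p))"
    unfolding induced_coord_def F_def[symmetric] D_def m_def F0 .
  show ?thesis
  proof (rule has_derivative_eq_rhs[OF 1], rule ext)
    fix a
    have II: "II a b = frechet_derivative (\<lambda>y. frechet_derivative F (at y) b) (at (snd c p)) a
        + levi_civita N g d (F (snd c p)) (D a) (D b)" for b
      unfolding II_def chart_hessian_def F_def D_def ..
    have met: "metric_derivative N g d (F (snd c p)) (D a) (D b) (D k) =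
        m (levi_civita N g d (F (snd c p)) (D a) (D b)) (D k) + m (D b) (levi_civita N g d (F (snd c p)) (D a) (D k))"
      unfolding m_def F0[symmetric] by (rule levi_civita_metric[OF N g d(1) Fd])
    show "metric_derivative N g d (F (snd c p)) (D a) (D b) (D k)
        + m (frechet_derivative (\<lambda>y. frechet_derivative F (at y) b) (at (snd c p)) a) (D k)
        + m (D b) (frechet_derivative (\<lambda>y. frechet_derivative F (at y) k) (at (snd c p)) a)
      = m (II a b) (D k) + m (D b) (II a k)"
      unfolding met II by (simp add: bilinear_ladd[OF bm] bilinear_radd[OF bm])
  qed
qed

end

section \<open>Orthonormal pairs and rotations in the plane\<close>

lemma orthonormal_expand:
  fixes B :: "real^2 \<Rightarrow> real^2 \<Rightarrow> real"
  assumes B: "inner_form B" and xy: "B x x = 1" "B y y = 1" "B x y = 0"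
  shows "u = B u x *\<^sub>R x + B u y *\<^sub>R y"
proof -
  have bB: "bilinear B" and sB: "B p q = B q p" for p q using B by (auto simp: inner_form_def)
  have "det2 x y \<noteq> 0"
  proof
    assume z: "det2 x y = 0"
    have "(y$i) *\<^sub>R x = (x$i) *\<^sub>R y" for i
      using z exhaust_2[of i] by (auto simp: vec_eq_iff det2_def forall_2 algebra_simps)
    then have "B ((y$i) *\<^sub>R x) x = B ((x$i) *\<^sub>R y) x" for i by metis
    then have "y$i = 0" for i by (simp add: bilinear_lmul[OF bB] xy sB[of y x])
    then have "y = 0" by (simp add: vec_eq_iff)
    then show False using xy(2) by (simp add: bilinear_lzero[OF bB])
  qed
  from plane_combination[OF this, of u] obtain p q where u: "u = p *\<^sub>R x + q *\<^sub>R y" by blast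
  have "B u x = p" "B u y = q"
    by (simp_all add: u bilinear_ladd[OF bB] bilinear_lmul[OF bB] xy sB[of y x])
  then show ?thesis using u by simp
qed

text \<open>This is why the tension field does not depend on the orthonormal basis.\<close>

lemma orthonormal_trace:
  fixes B :: "real^2 \<Rightarrow> real^2 \<Rightarrow> real" and N :: "real^2 \<Rightarrow> real^2 \<Rightarrow> 'v::real_vector"
  assumes B: "inner_form B" and N: "bilinear N" and xy: "B x x = 1" "B y y = 1" "B x y = 0"
    and uv: "B u u = 1" "B v v = 1" "B u v = 0"
  shows "N u u + N v v = N x x + N y y"
proof -
  have bB: "bilinear B" and sB: "B p q = B q p" for p q using B by (auto simp: inner_form_def)
  obtain p q where u: "u = p *\<^sub>R x + q *\<^sub>R y" using orthonormal_expand[OF B xy] by blast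
  obtain r s where v: "v = r *\<^sub>R x + s *\<^sub>R y" using orthonormal_expand[OF B xy] by blast
  have e: "p * p + q * q = 1" "r * r + s * s = 1" "p * r + q * s = 0"
    using uv by (simp_all add: u v bilinear_ladd[OF bB] bilinear_radd[OF bB] bilinear_lmul[OF bB]
        bilinear_rmul[OF bB] xy sB[of y x] mult.commute)
  \<comment> \<open>The rows of the orthogonal matrix of the change of basis are orthonormal, hence so are its columns.\<close>
  define D where "D = p * s - q * r"
  have qs: "q * s = - (p * r)" using e(3) by simp
  have "s * D = p * (s * s) - r * (q * s)" by (simp add: D_def algebra_simps)
  also have "\<dots> = p * (r * r + s * s)" unfolding qs by (simp add: algebra_simps)
  finally have p: "s * D = p" by (simp add: e(2))
  have "r * D = s * (p * r) - q * (r * r)" by (simp add: D_def algebra_simps)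
  also have "\<dots> = - q * (r * r + s * s)" using qs by (simp add: algebra_simps)
  finally have q: "r * D = - q" by (simp add: e(2))
  have "D * D = p * (s * D) - q * (r * D)" by (simp add: D_def algebra_simps)
  then have D2: "D * D = 1" using e(1) by (simp add: p q)
  have "p * p = (s * s) * (D * D)" "q * q = (r * r) * (D * D)" "p * q = - (r * s) * (D * D)"
    using arg_cong2[OF p p, of "(*)"] arg_cong2[OF q q, of "(*)"] arg_cong2[OF p q, of "(*)"]
    by (simp_all add: algebra_simps)
  then have c: "p * p + r * r = 1" "q * q + s * s = 1" "p * q + r * s = 0"
    using e(2) by (simp_all add: D2 add.commute)
  have "N u u + N v v = (p * p + r * r) *\<^sub>R N x x + (q * q + s * s) *\<^sub>R N y y + (p * q + r * s) *\<^sub>R (N x y + N y x)"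
    by (simp add: u v bilinear_ladd[OF N] bilinear_radd[OF N] bilinear_lmul[OF N] bilinear_rmul[OF N]
        scaleR_add_left scaleR_add_right mult.commute)
  then show ?thesis by (simp add: c)
qed

text \<open>The conditions that characterize the rotation by \<open>90\<close> degrees, in the coordinates of a chart.\<close>

definition plane_rotation :: "(real^2 \<Rightarrow> real^2 \<Rightarrow> real) \<Rightarrow> real^2 \<Rightarrow> real^2 \<Rightarrow> bool" where
  "plane_rotation B a w \<longleftrightarrow> B a w = 0 \<and> B w w = B a a \<and> (a \<noteq> 0 \<longrightarrow> det2 a w > 0)"

lemma plane_rotation_iff:
  fixes B :: "real^2 \<Rightarrow> real^2 \<Rightarrow> real"
  assumes B: "inner_form B" and xy: "B x x = 1" "B y y = 1" "B x y = 0" and pos: "det2 x y > 0"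
  shows "plane_rotation B a w \<longleftrightarrow> w = B a x *\<^sub>R y - B a y *\<^sub>R x"
proof -
  have bB: "bilinear B" and sB: "B p q = B q p" for p q using B by (auto simp: inner_form_def)
  have BB: "B (p *\<^sub>R x + q *\<^sub>R y) (r *\<^sub>R x + s *\<^sub>R y) = p * r + q * s" for p q r s
    by (simp add: bilinear_ladd[OF bB] bilinear_radd[OF bB] bilinear_lmul[OF bB] bilinear_rmul[OF bB] xy sB[of y x])
  define p q where "p = B a x" and "q = B a y"
  define r s where "r = B w x" and "s = B w y"
  have a: "a = p *\<^sub>R x + q *\<^sub>R y" unfolding p_def q_def by (rule orthonormal_expand[OF B xy])
  have w: "w = r *\<^sub>R x + s *\<^sub>R y" unfolding r_def s_def by (rule orthonormal_expand[OF B xy])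
  have d: "det2 a w = (p * s - q * r) * det2 x y" unfolding a w by (simp add: det2_def algebra_simps)
  have Baw: "B a w = p * r + q * s" "B w w = r * r + s * s" "B a a = p * p + q * q"
    unfolding a w by (rule BB)+
  have a0: "a = 0 \<longleftrightarrow> p * p + q * q = 0"
    using B Baw(3) unfolding inner_form_def by (metis bilinear_lzero less_irrefl)
  show ?thesis
  proof
    assume R: "plane_rotation B a w"
    have "r = - q \<and> s = p"
    proof (cases "a = 0")
      case True
      then have "p = 0" "q = 0" using a0 by (auto simp: sum_squares_eq_zero_iff)
      then show ?thesis using R Baw by (auto simp: plane_rotation_def sum_squares_eq_zero_iff)
    next
      case False
      define R where "R = p * p + q * q"
      have R0: "R > 0" using a0 False by (simp add: R_def sum_squares_gt_zero_iff)
      have "p * s - q * r > 0" using R False d pos by (simp add: plane_rotation_def zero_less_mult_iff)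
      moreover have "(p * s - q * r)\<^sup>2 = R\<^sup>2"
      proof -
        have "(p * s - q * r)\<^sup>2 = (p * p + q * q) * (r * r + s * s) - (p * r + q * s)\<^sup>2"
          by (simp add: power2_eq_square algebra_simps)
        then show ?thesis using R Baw by (simp add: plane_rotation_def R_def power2_eq_square)
      qed
      ultimately have E: "p * s - q * r = R" using R0 by (simp add: power2_eq_iff)
      have o: "p * r + q * s = 0" using R Baw by (simp add: plane_rotation_def)
      have "R * r = p * (p * r + q * s) - q * (p * s - q * r)" "R * s = q * (p * r + q * s) + p * (p * s - q * r)"
        by (simp_all add: R_def algebra_simps)
      then have "R * r = R * (- q)" "R * s = R * p" unfolding E o by simp_all
      then show ?thesis
        using R0 mult_left_cancel[of R r "- q"] mult_left_cancel[of R s p] by (metis less_irrefl)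
    qed
    then show "w = B a x *\<^sub>R y - B a y *\<^sub>R x" using w by (simp add: p_def q_def algebra_simps)
  next
    assume "w = B a x *\<^sub>R y - B a y *\<^sub>R x"
    then have w': "w = (- q) *\<^sub>R x + p *\<^sub>R y" by (simp add: p_def q_def algebra_simps)
    have "B w x = - q" "B w y = p"
      unfolding w' bilinear_ladd[OF bB] bilinear_lmul[OF bB] by (simp_all add: xy sB[of y x])
    then have rs: "r = - q" "s = p" by (simp_all add: r_def s_def)
    have "p * p + q * q > 0" if "a \<noteq> 0" using a0 that by (simp add: sum_squares_gt_zero_iff)
    then show "plane_rotation B a w"
      using Baw d pos by (simp add: plane_rotation_def rs)
  qed
qed

lemma rotate90_component:
  fixes S :: "('s, real^2) chart set"
  assumes S: "oriented_surface S" and h: "riemannian_metric S h" and c: "c \<in> S" "p \<in> fst c"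
    and v: "v \<in> tangent_space S p"
  shows "rotate90 S h p v \<in> tangent_space S p"
    and "plane_rotation (metric_coord S h c (snd c p)) (v c) w \<Longrightarrow> rotate90 S h p v c = w"
proof -
  have SA: "smooth_atlas S" using S by (simp add: oriented_surface_def smooth_manifold_atlas)
  let ?h = "metric_coord S h c (snd c p)"
  have ih: "inner_form ?h" by (rule metric_coord_inner_form[OF SA h c(1) chart_image_mem[OF c(2)]])
  obtain x y where xy: "det2 x y > 0" "?h x x = 1" "?h y y = 1" "?h x y = 0"
    by (rule positive_orthonormal_basis[OF ih])
  define r where "r = ?h (v c) x *\<^sub>R y - ?h (v c) y *\<^sub>R x"
  have ri: "plane_rotation ?h (v c) w \<longleftrightarrow> w = r" for w
    unfolding r_def by (rule plane_rotation_iff[OF ih xy(2-4,1)])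
  have v0: "v = 0 \<longleftrightarrow> v c = 0"
    using tangent_eqI[OF SA v tangent_zero[OF SA] c] by auto
  have P: "(w \<in> tangent_space S p \<and> h p v w = 0 \<and> h p w w = h p v v \<and> (v \<noteq> 0 \<longrightarrow> positive_basis S p v w))
      \<longleftrightarrow> w \<in> tangent_space S p \<and> plane_rotation ?h (v c) (w c)" for w
  proof (rule conj_cong[OF refl])
    assume w: "w \<in> tangent_space S p"
    have 1: "h p v w = ?h (v c) (w c)" "h p w w = ?h (w c) (w c)" "h p v v = ?h (v c) (v c)"
      by (rule metric_tangent[OF SA h c v w], rule metric_tangent[OF SA h c w w], rule metric_tangent[OF SA h c v v])
    have 2: "positive_basis S p v w \<longleftrightarrow> det2 (v c) (w c) > 0"
      using positive_basis_iff[OF S c v w] .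
    show "h p v w = 0 \<and> h p w w = h p v v \<and> (v \<noteq> 0 \<longrightarrow> positive_basis S p v w) \<longleftrightarrow> plane_rotation ?h (v c) (w c)"
      unfolding plane_rotation_def 1 2 v0 ..
  qed
  have rot: "rotate90 S h p v = tangent_of S c p r"
    unfolding rotate90_def P
  proof (rule the_equality)
    show "tangent_of S c p r \<in> tangent_space S p \<and> plane_rotation ?h (v c) (tangent_of S c p r c)"
      unfolding tangent_of_same[OF SA c] ri by (simp add: tangent_of_mem[OF SA c])
    fix w assume w: "w \<in> tangent_space S p \<and> plane_rotation ?h (v c) (w c)"
    then have "w c = r" using ri by blast
    then show "w = tangent_of S c p r" using tangent_of_component[OF SA _ c, of w] w by simp
  qed
  show "rotate90 S h p v \<in> tangent_space S p" unfolding rot by (rule tangent_of_mem[OF SA c])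
  show "plane_rotation ?h (v c) w \<Longrightarrow> rotate90 S h p v c = w"
    unfolding rot tangent_of_same[OF SA c] ri by simp
qed

section \<open>Normal components\<close>

context
  fixes X :: "('x, 'd::euclidean_space) chart set" and g :: "('x, 'd) metric_tensor"
    and S :: "('s, real^2) chart set" and h :: "('s, real^2) metric_tensor" and f :: "'s \<Rightarrow> 'x"
  assumes X: "smooth_atlas X" and gX: "riemannian_metric X g"
    and SA: "smooth_atlas S" and h: "riemannian_metric S h" and f: "immersion S X f"
begin

text \<open>Existence is orthogonal projection by means of an orthonormal basis of the tangent plane;
  the difference of two candidates is both tangential and normal.\<close>

lemma normal_part_spec:
  assumes p: "p \<in> carrier S" and u: "u \<in> tangent_space X (f p)"
  shows "\<exists>!n. n \<in> tangent_space X (f p) \<and>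
        (\<forall>v\<in>tangent_space S p. g (f p) n (differential S X f p v) = 0) \<and>
        (\<exists>v\<in>tangent_space S p. u = n + differential S X f p v)"
proof -
  have sm: "smooth_map S X f" using f by (simp add: immersion_def)
  define c where "c = chart_at S p"
  define d where "d = chart_at X (f p)"
  have c: "c \<in> S" "p \<in> fst c" using chart_at_mem[OF p] by (auto simp: c_def)
  have d: "d \<in> X" "f p \<in> fst d"
    using chart_at_mem[OF smooth_map_carrier[OF SA sm p]] by (auto simp: d_def)
  define D where "D = frechet_derivative (in_charts c d f) (at (snd c p))"
  define m where "m = metric_coord X g d (snd d (f p))"
  have F0: "in_charts c d f (snd c p) = snd d (f p)" by (simp add: chart_inv_chart[OF SA c])
  have lin: "linear D" unfolding D_def by (rule has_derivative_linear[OF in_charts_has_derivative[OF SA X sm c d]])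
  have im: "inner_form m" unfolding m_def by (rule metric_coord_inner_form[OF X gX d(1) chart_image_mem[OF d(2)]])
  then have bm: "bilinear m" and sm': "m a b = m b a" for a b by (auto simp: inner_form_def)
  obtain a b where ab: "det2 a b > 0" "m (D a) (D a) = 1" "m (D b) (D b) = 1" "m (D a) (D b) = 0"
    using positive_orthonormal_basis[OF induced_inner_form(1)[OF SA X gX f c d]]
    unfolding induced_coord_def F0 D_def[symmetric] m_def[symmetric] by blast
  have TX: "differential S X f p v \<in> tangent_space X (f p)" for v by (rule differential_mem[OF SA X sm p])
  have comp: "differential S X f p v d = D (v c)" if "v \<in> tangent_space S p" for v
    unfolding D_def by (rule differential_component[OF SA X sm c d that])
  have gm: "g (f p) n (differential S X f p v) = m (n d) (D (v c))"
    if "n \<in> tangent_space X (f p)" "v \<in> tangent_space S p" for n v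
    by (simp only: metric_tangent[OF X gX d that(1) TX] comp[OF that(2)] m_def)
  show ?thesis
  proof (rule ex_ex1I)
    define nd where "nd = u d - m (u d) (D a) *\<^sub>R D a - m (u d) (D b) *\<^sub>R D b"
    define z where "z = m (u d) (D a) *\<^sub>R a + m (u d) (D b) *\<^sub>R b"
    have Tn: "tangent_of X d (f p) nd \<in> tangent_space X (f p)" by (rule tangent_of_mem[OF X d])
    have Tz: "tangent_of S c p z \<in> tangent_space S p" by (rule tangent_of_mem[OF SA c])
    have "m nd (D w) = 0" for w
    proof -
      obtain r s where w: "w = r *\<^sub>R a + s *\<^sub>R b" using plane_combination[of a b w] ab(1) by auto
      show ?thesis
        by (simp add: w nd_def linear_add[OF lin] linear_scale[OF lin] bilinear_radd[OF bm] bilinear_rmul[OF bm]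
            bilinear_lsub[OF bm] bilinear_lmul[OF bm] ab sm'[of "D b" "D a"])
    qed
    then have "\<forall>v\<in>tangent_space S p. g (f p) (tangent_of X d (f p) nd) (differential S X f p v) = 0"
      using gm[OF Tn] by (simp add: tangent_of_same[OF X d])
    moreover have "u = tangent_of X d (f p) nd + differential S X f p (tangent_of S c p z)"
    proof (rule tangent_eqI[OF X u tangent_add[OF X Tn TX] d])
      have "D z = m (u d) (D a) *\<^sub>R D a + m (u d) (D b) *\<^sub>R D b"
        by (simp add: z_def linear_add[OF lin] linear_scale[OF lin])
      then show "u d = (tangent_of X d (f p) nd + differential S X f p (tangent_of S c p z)) d"
        by (simp add: comp[OF Tz] tangent_of_same[OF X d] tangent_of_same[OF SA c] nd_def)
    qed
    ultimately show "\<exists>n. n \<in> tangent_space X (f p) \<and>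
        (\<forall>v\<in>tangent_space S p. g (f p) n (differential S X f p v) = 0) \<and>
        (\<exists>v\<in>tangent_space S p. u = n + differential S X f p v)"
      using Tn Tz by blast
  next
    fix n n'
    assume "n \<in> tangent_space X (f p) \<and>
        (\<forall>v\<in>tangent_space S p. g (f p) n (differential S X f p v) = 0) \<and>
        (\<exists>v\<in>tangent_space S p. u = n + differential S X f p v)"
      and "n' \<in> tangent_space X (f p) \<and>
        (\<forall>v\<in>tangent_space S p. g (f p) n' (differential S X f p v) = 0) \<and>
        (\<exists>v\<in>tangent_space S p. u = n' + differential S X f p v)"
    then obtain v v' where n: "n \<in> tangent_space X (f p)" "n' \<in> tangent_space X (f p)"
      and o: "\<And>w. w \<in> tangent_space S p \<Longrightarrow> g (f p) n (differential S X f p w) = 0"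
        "\<And>w. w \<in> tangent_space S p \<Longrightarrow> g (f p) n' (differential S X f p w) = 0"
      and v: "v \<in> tangent_space S p" "v' \<in> tangent_space S p"
      and e: "u = n + differential S X f p v" "u = n' + differential S X f p v'" by blast
    have w: "v' - v \<in> tangent_space S p" by (rule tangent_diff[OF SA v(2,1)])
    have "n d + D (v c) = n' d + D (v' c)"
      using fun_cong[OF e(1), of d] fun_cong[OF e(2), of d] by (simp add: comp v)
    then have nd: "n d - n' d = D ((v' - v) c)"
      by (simp add: linear_diff[OF lin] algebra_simps)
    have "m (n d) (D ((v' - v) c)) = 0" "m (n' d) (D ((v' - v) c)) = 0"
      using o[OF w] unfolding gm[OF n(1) w] gm[OF n(2) w] by blast+
    then have "m (n d - n' d) (n d - n' d) = 0" unfolding nd[symmetric] by (simp add: bilinear_lsub[OF bm])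
    then have "n d = n' d" using im unfolding inner_form_def by (metis less_irrefl right_minus_eq)
    then show "n = n'" by (rule tangent_eqI[OF X n d])
  qed
qed

lemma normal_part_translate:
  assumes p: "p \<in> carrier S" and u: "u \<in> tangent_space X (f p)" and z: "z \<in> tangent_space S p"
  shows "normal_part S X g f p (u + differential S X f p z) = normal_part S X g f p u"
proof -
  have sm: "smooth_map S X f" using f by (simp add: immersion_def)
  have TX: "differential S X f p v \<in> tangent_space X (f p)" for v by (rule differential_mem[OF SA X sm p])
  define d where "d = chart_at X (f p)"
  define c where "c = chart_at S p"
  have c: "c \<in> S" "p \<in> fst c" using chart_at_mem[OF p] by (auto simp: c_def)
  have d: "d \<in> X" "f p \<in> fst d"
    using chart_at_mem[OF smooth_map_carrier[OF SA sm p]] by (auto simp: d_def)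
  have lin: "linear (frechet_derivative (in_charts c d f) (at (snd c p)))"
    by (rule has_derivative_linear[OF in_charts_has_derivative[OF SA X sm c d]])
  note n = theI'[OF normal_part_spec[OF p u], folded normal_part_def]
  then obtain v where v: "v \<in> tangent_space S p" "u = normal_part S X g f p u + differential S X f p v" by blast
  have vz: "v + z \<in> tangent_space S p" by (rule tangent_add[OF SA v(1) z])
  have "differential S X f p (v + z) = differential S X f p v + differential S X f p z"
    by (rule tangent_eqI[OF X TX tangent_add[OF X TX TX] d])
       (simp add: differential_component[OF SA X sm c d vz] differential_component[OF SA X sm c d v(1)]
          differential_component[OF SA X sm c d z] linear_add[OF lin])
  then have "u + differential S X f p z = normal_part S X g f p u + differential S X f p (v + z)"
    by (subst v(2)) (simp add: add.assoc)
  then show ?thesis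
    unfolding normal_part_def[of S X g f p "u + _"]
    by (intro the1_equality[OF normal_part_spec[OF p tangent_add[OF X u TX]]]) (use n vz in blast)
qed

text \<open>Changing the extension of \<open>w\<close> changes \<open>\<nabla>\<^sub>v (df W)\<close> by a tangential vector, and so does passing to
  the normal part. In a normal direction it therefore suffices to consider the extension that is
  constant in a chart, for which the Hessian of the charts is obtained.\<close>

lemma second_fundamental_form_inner:
  assumes p: "p \<in> carrier S" and v: "v \<in> tangent_space S p" and w: "w \<in> tangent_space S p"
    and \<nu>: "\<nu> \<in> tangent_space X (f p)" "\<And>z. z \<in> tangent_space S p \<Longrightarrow> g (f p) \<nu> (differential S X f p z) = 0"
    and d: "d \<in> X" "f p \<in> fst d"
  defines "c \<equiv> chart_at S p"
  shows "g (f p) (second_fundamental_form S X g f p v w) \<nu> =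
     metric_coord X g d (snd d (f p)) (chart_hessian X g c d f (snd c p) (v c) (w c)) (\<nu> d)"
proof -
  have sm: "smooth_map S X f" using f by (simp add: immersion_def)
  have c: "c \<in> S" "p \<in> fst c" using chart_at_mem[OF p] by (auto simp: c_def)
  define D where "D = frechet_derivative (in_charts c d f) (at (snd c p))"
  define m where "m = metric_coord X g d (snd d (f p))"
  define R where "R W = nabla_along S X g f (\<lambda>q. differential S X f q (W q)) p v" for W
  define W0 where "W0 q = tangent_of S c q (w c)" for q
  have lin: "linear D" unfolding D_def by (rule has_derivative_linear[OF in_charts_has_derivative[OF SA X sm c d]])
  have bm: "bilinear m" unfolding m_def by (rule metric_bilinear[OF gX d(1) chart_image_mem[OF d(2)]])
  have TX: "differential S X f p v \<in> tangent_space X (f p)" for v by (rule differential_mem[OF SA X sm p])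
  have comp: "differential S X f p v d = D (v c)" if "v \<in> tangent_space S p" for v
    unfolding D_def by (rule differential_component[OF SA X sm c d that])
  have W0: "smooth_field_near S p W0" "W0 p = w" "frechet_derivative (\<lambda>y. W0 (chart_inv c y) c) (at (snd c p)) = (\<lambda>v. 0)"
    unfolding W0_def[abs_def] using constant_field[OF SA c w] by simp_all
  have RT: "R W \<in> tangent_space X (f p)" if "smooth_field_near S p W" for W
    unfolding R_def by (rule nabla_along_of_differential_tangent[OF SA h X gX sm p v that])
  have Rd: "R W d = chart_hessian X g c d f (snd c p) (v c) (W p c)
      + D (frechet_derivative (\<lambda>y. W (chart_inv c y) c) (at (snd c p)) (v c))" if "smooth_field_near S p W" for W
    unfolding R_def D_def c_def by (rule nabla_along_of_differential(1)[OF SA h X gX sm p v that d])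
  have R0: "R W0 d = chart_hessian X g c d f (snd c p) (v c) (w c)"
    by (simp add: Rd[OF W0(1)] W0(2,3) linear_0[OF lin])
  have eq: "normal_part S X g f p (R W) = normal_part S X g f p (R W0)" if W: "smooth_field_near S p W" "W p = w" for W
  proof -
    define z where "z = tangent_of S c p (frechet_derivative (\<lambda>y. W (chart_inv c y) c) (at (snd c p)) (v c))"
    have z: "z \<in> tangent_space S p" unfolding z_def by (rule tangent_of_mem[OF SA c])
    have "R W = R W0 + differential S X f p z"
      by (rule tangent_eqI[OF X RT[OF W(1)] tangent_add[OF X RT[OF W0(1)] TX] d])
         (simp add: Rd[OF W(1)] W(2) R0 comp[OF z], simp add: z_def tangent_of_same[OF SA c])
    then show ?thesis using normal_part_translate[OF p RT[OF W0(1)] z] by simp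
  qed
  have sff: "second_fundamental_form S X g f p v w = normal_part S X g f p (R W0)"
    unfolding second_fundamental_form_def R_def[symmetric]
  proof (rule the_equality)
    show "\<forall>W. smooth_field_near S p W \<and> W p = w \<longrightarrow> normal_part S X g f p (R W0) = normal_part S X g f p (R W)"
      using eq by simp
    fix b assume "\<forall>W. smooth_field_near S p W \<and> W p = w \<longrightarrow> b = normal_part S X g f p (R W)"
    from this[rule_format, of W0] W0(1,2) show "b = normal_part S X g f p (R W0)" by simp
  qed
  note n = theI'[OF normal_part_spec[OF p RT[OF W0(1)]], folded normal_part_def]
  define nn where "nn = normal_part S X g f p (R W0)"
  obtain z where z: "z \<in> tangent_space S p" "R W0 = nn + differential S X f p z" and nT: "nn \<in> tangent_space X (f p)"
    using n unfolding nn_def by blast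
  have sy: "m a b = m b a" for a b
    using metric_coord_inner_form[OF X gX d(1) chart_image_mem[OF d(2)]] by (simp add: inner_form_def m_def)
  have "m (\<nu> d) (D (z c)) = 0"
    using \<nu>(2)[OF z(1)] unfolding metric_tangent[OF X gX d \<nu>(1) TX] comp[OF z(1)] m_def .
  moreover have "R W0 d = nn d + D (z c)" using fun_cong[OF z(2), of d] by (simp add: comp[OF z(1)])
  ultimately have "m (R W0 d) (\<nu> d) = m (nn d) (\<nu> d)"
    using sy[of "D (z c)" "\<nu> d"] by (simp add: bilinear_ladd[OF bm])
  then show ?thesis
    unfolding sff nn_def[symmetric] metric_tangent[OF X gX d nT \<nu>(1)] R0 m_def ..
qed

end

section \<open>The tension field of a conformal immersion\<close>

context
  fixes X :: "('x, 'd::euclidean_space) chart set" and g :: "('x, 'd) metric_tensor"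
    and S :: "('s, real^2) chart set" and h :: "('s, real^2) metric_tensor" and f :: "'s \<Rightarrow> 'x"
  assumes X: "smooth_atlas X" and gX: "riemannian_metric X g"
    and SA: "smooth_atlas S" and h: "riemannian_metric S h" and f: "immersion S X f"
begin

lemma tension_field_component:
  assumes p: "p \<in> carrier S"
  defines "c \<equiv> chart_at S p"
  assumes xy: "metric_coord S h c (snd c p) x x = 1" "metric_coord S h c (snd c p) y y = 1"
    "metric_coord S h c (snd c p) x y = 0"
  shows "d \<in> X \<Longrightarrow> f p \<in> fst d \<Longrightarrow> tension_field S h X g f p d =
      chart_hessian X g c d f (snd c p) x x + chart_hessian X g c d f (snd c p) y y
      - frechet_derivative (in_charts c d f) (at (snd c p))
          (levi_civita S h c (snd c p) x x + levi_civita S h c (snd c p) y y)"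
    and "\<not> (d \<in> X \<and> f p \<in> fst d) \<Longrightarrow> tension_field S h X g f p d = 0"
proof -
  have sm: "smooth_map S X f" using f by (simp add: immersion_def)
  have c: "c \<in> S" "p \<in> fst c" using chart_at_mem[OF p] by (auto simp: c_def)
  let ?h = "metric_coord S h c (snd c p)"
  have ih: "inner_form ?h" by (rule metric_coord_inner_form[OF SA h c(1) chart_image_mem[OF c(2)]])
  have b\<Gamma>: "bilinear (levi_civita S h c (snd c p))" by (rule levi_civita_bilinear[OF SA h c(1) chart_image_mem[OF c(2)]])
  define R where "R v w = nabla_differential S h X g f p v w" for v w
  define N where "N d a b = chart_hessian X g c d f (snd c p) a b
      - frechet_derivative (in_charts c d f) (at (snd c p)) (levi_civita S h c (snd c p) a b)" for d a b
  have T: "tangent_of S c p a \<in> tangent_space S p" for a by (rule tangent_of_mem[OF SA c])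
  have Rd: "R v w d = N d (v c) (w c)" if "v \<in> tangent_space S p" "w \<in> tangent_space S p" "d \<in> X" "f p \<in> fst d" for v w d
    unfolding R_def N_def c_def by (rule nabla_differential_component(1)[OF SA h X gX sm p that])
  have R0: "R v w d = 0" if "v \<in> tangent_space S p" "w \<in> tangent_space S p" "\<not> (d \<in> X \<and> f p \<in> fst d)" for v w d
    unfolding R_def by (rule nabla_differential_component(2)[OF SA h X gX sm p that])
  have lin: "linear (frechet_derivative (in_charts c d f) (at (snd c p)))" if "d \<in> X" "f p \<in> fst d" for d
    by (rule has_derivative_linear[OF in_charts_has_derivative[OF SA X sm c that]])
  have bN: "bilinear (N d)" if d: "d \<in> X" "f p \<in> fst d" for d
  proof -
    have "bilinear (\<lambda>a b. frechet_derivative (in_charts c d f) (at (snd c p)) (levi_civita S h c (snd c p) a b))"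
      unfolding bilinear_def
      by (intro conjI allI linearI)
         (simp_all only: bilinear_ladd[OF b\<Gamma>] bilinear_radd[OF b\<Gamma>] bilinear_lmul[OF b\<Gamma>] bilinear_rmul[OF b\<Gamma>]
           linear_add[OF lin[OF d]] linear_scale[OF lin[OF d]])
    then show ?thesis
      using chart_hessian_bilinear(2)[OF SA h X gX sm c d]
      unfolding bilinear_def N_def[abs_def] by (intro conjI allI linear_compose_sub) blast+
  qed
  define t where "t = R (tangent_of S c p x) (tangent_of S c p x) + R (tangent_of S c p y) (tangent_of S c p y)"
  have tension: "tension_field S h X g f p = t"
    unfolding tension_field_def R_def[symmetric]
  proof (rule the_equality)
    show "\<forall>e1\<in>tangent_space S p. \<forall>e2\<in>tangent_space S p.
        h p e1 e1 = 1 \<and> h p e2 e2 = 1 \<and> h p e1 e2 = 0 \<longrightarrow> t = R e1 e1 + R e2 e2"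
    proof (intro ballI impI ext)
      fix e1 e2 d assume e: "e1 \<in> tangent_space S p" "e2 \<in> tangent_space S p"
        and on: "h p e1 e1 = 1 \<and> h p e2 e2 = 1 \<and> h p e1 e2 = 0"
      have on': "?h (e1 c) (e1 c) = 1" "?h (e2 c) (e2 c) = 1" "?h (e1 c) (e2 c) = 0"
        using on metric_tangent[OF SA h c e(1) e(1)] metric_tangent[OF SA h c e(2) e(2)] metric_tangent[OF SA h c e(1) e(2)]
        by simp_all
      show "t d = (R e1 e1 + R e2 e2) d"
      proof (cases "d \<in> X \<and> f p \<in> fst d")
        case True
        then have d: "d \<in> X" "f p \<in> fst d" by auto
        show ?thesis
          using orthonormal_trace[OF ih bN[OF d] xy on']
          by (simp add: t_def Rd[OF T T d] Rd[OF e(1) e(1) d] Rd[OF e(2) e(2) d] tangent_of_same[OF SA c])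
      next
        case False
        then show ?thesis by (simp add: t_def R0[OF T T False] R0[OF e(1) e(1) False] R0[OF e(2) e(2) False])
      qed
    qed
    fix t' assume "\<forall>e1\<in>tangent_space S p. \<forall>e2\<in>tangent_space S p.
        h p e1 e1 = 1 \<and> h p e2 e2 = 1 \<and> h p e1 e2 = 0 \<longrightarrow> t' = R e1 e1 + R e2 e2"
    from this[rule_format, OF T T, of x y] show "t' = t"
      unfolding t_def metric_tangent[OF SA h c T T] tangent_of_same[OF SA c] using xy by simp
  qed
  show "tension_field S h X g f p d = chart_hessian X g c d f (snd c p) x x + chart_hessian X g c d f (snd c p) y y
      - frechet_derivative (in_charts c d f) (at (snd c p))
          (levi_civita S h c (snd c p) x x + levi_civita S h c (snd c p) y y)" if d: "d \<in> X" "f p \<in> fst d"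
    unfolding tension t_def plus_fun_apply Rd[OF T T d] tangent_of_same[OF SA c] N_def linear_add[OF lin[OF d]] by simp
  show "tension_field S h X g f p d = 0" if "\<not> (d \<in> X \<and> f p \<in> fst d)"
    unfolding tension t_def plus_fun_apply R0[OF T T that] by simp
qed

text \<open>Differentiating \<open>f\<^sup>*g = \<lambda> h\<close> gives \<open>T(a, b, k) + T(a, k, b) = d\<lambda>(a) h(b, k)\<close> for
  \<open>T(a, b, k) = g(\<nabla>df(a, b), df k)\<close>, which is symmetric in \<open>a\<close> and \<open>b\<close>. In dimension two this forces
  the trace of \<open>T\<close> over \<open>a, b\<close> to vanish: the contributions of \<open>d\<lambda>\<close> cancel.\<close>

lemma conformal_tension_normal:
  assumes p: "p \<in> carrier S" and conf: "conformal S h X g f"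
  defines "c \<equiv> chart_at S p"
  assumes d: "d \<in> X" "f p \<in> fst d"
    and xy: "metric_coord S h c (snd c p) x x = 1" "metric_coord S h c (snd c p) y y = 1"
    "metric_coord S h c (snd c p) x y = 0"
  shows "metric_coord X g d (snd d (f p)) (tension_field S h X g f p d)
     (frechet_derivative (in_charts c d f) (at (snd c p)) k) = 0"
proof -
  have sm: "smooth_map S X f" using f by (simp add: immersion_def)
  have c: "c \<in> S" "p \<in> fst c" using chart_at_mem[OF p] by (auto simp: c_def)
  obtain l where l: "\<And>q u v. q \<in> carrier S \<Longrightarrow> u \<in> tangent_space S q \<Longrightarrow> v \<in> tangent_space S q \<Longrightarrow>
      g (f q) (differential S X f q u) (differential S X f q v) = l q * h q u v"
    using conf unfolding conformal_def by blast
  define H where "H = metric_coord S h c"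
  define B where "B = induced_coord X g c d f"
  define y0 where "y0 = snd c p"
  define D where "D = frechet_derivative (in_charts c d f) (at y0)"
  define m where "m = metric_coord X g d (snd d (f p))"
  define II where "II = chart_hessian X g c d f y0"
  define \<Gamma> where "\<Gamma> = levi_civita S h c y0"
  have lin: "linear D" unfolding D_def y0_def by (rule has_derivative_linear[OF in_charts_has_derivative[OF SA X sm c d]])
  have im: "inner_form m" unfolding m_def by (rule metric_coord_inner_form[OF X gX d(1) chart_image_mem[OF d(2)]])
  then have bm: "bilinear m" and sm': "m a b = m b a" for a b by (auto simp: inner_form_def)
  have y0: "y0 \<in> chart_image c" unfolding y0_def by (rule chart_image_mem[OF c(2)])
  have iH: "inner_form (H y)" if "y \<in> chart_image c" for y
    unfolding H_def by (rule metric_coord_inner_form[OF SA h c(1) that])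
  have b\<Gamma>: "bilinear \<Gamma>" and s\<Gamma>: "\<Gamma> a b = \<Gamma> b a" for a b
    unfolding \<Gamma>_def by (rule levi_civita_bilinear[OF SA h c(1) y0], rule levi_civita_sym[OF SA h c(1) y0])
  obtain U where U: "open U" "y0 \<in> U" "U \<subseteq> chart_image c" "f ` (chart_inv c ` U) \<subseteq> fst d" "smooth_on U (in_charts c d f)"
    unfolding y0_def by (rule smooth_map_in_charts[OF SA X sm c d])
  have Bl: "B y a b = l (chart_inv c y) * H y a b" if y: "y \<in> U" for y a b
  proof -
    have yc: "y \<in> chart_image c" using y U(3) by blast
    let ?q = "chart_inv c y"
    have q: "?q \<in> fst c" "snd c ?q = y" by (rule chart_inv_mem[OF yc], rule chart_chart_inv[OF yc])
    have fq: "f ?q \<in> fst d" using y U(4) by blast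
    have T: "tangent_of S c ?q a \<in> tangent_space S ?q" for a by (rule tangent_of_mem[OF SA c(1) q(1)])
    have TX: "differential S X f ?q v \<in> tangent_space X (f ?q)" for v by (rule differential_mem[OF SA X sm carrier_mem[OF c(1) q(1)]])
    have "B y a b = g (f ?q) (differential S X f ?q (tangent_of S c ?q a)) (differential S X f ?q (tangent_of S c ?q b))"
      unfolding metric_tangent[OF X gX d(1) fq TX TX] differential_component[OF SA X sm c(1) q(1) d(1) fq T]
        tangent_of_same[OF SA c(1) q(1)] q(2) B_def induced_coord_def by simp
    also have "\<dots> = l ?q * h ?q (tangent_of S c ?q a) (tangent_of S c ?q b)" by (rule l[OF carrier_mem[OF c(1) q(1)] T T])
    also have "\<dots> = l ?q * H y a b" by (simp add: H_def metric_coord_def)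
    finally show ?thesis .
  qed
  \<comment> \<open>The conformal factor is an arbitrary function by definition; this quotient shows that it is
    differentiable.\<close>
  define \<Lambda> where "\<Lambda> z = B z x x / H z x x" for z
  have x0: "x \<noteq> 0" using xy(1) bilinear_lzero iH[OF y0] unfolding inner_form_def H_def y0_def by force
  have Hx: "H z x x > 0" if "z \<in> U" for z using iH U(3) that x0 unfolding inner_form_def by blast
  have B\<Lambda>: "B z a b = \<Lambda> z * H z a b" if "z \<in> U" for z a b
    using Bl[OF that] Hx[OF that] by (simp add: \<Lambda>_def)
  have dB: "((\<lambda>z. B z a b) has_derivative (\<lambda>v. m (II v a) (D b) + m (D a) (II v b))) (at y0)" for a b
    unfolding B_def m_def II_def D_def y0_def by (rule induced_has_derivative[OF SA h X gX sm c d])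
  have dH: "((\<lambda>z. H z a b) has_derivative (\<lambda>v. H y0 (\<Gamma> v a) b + H y0 a (\<Gamma> v b))) (at y0)" for a b
    unfolding H_def \<Gamma>_def
    by (rule has_derivative_eq_rhs[OF metric_coord_has_derivative[OF SA h c(1) y0]])
       (rule ext, rule levi_civita_metric[OF SA h c(1) y0])
  have "\<Lambda> differentiable (at y0)"
    unfolding \<Lambda>_def[abs_def]
    by (rule differentiable_divide[OF differentiableI[OF dB] differentiableI[OF dH]]) (use Hx[OF U(2)] in simp)
  then obtain \<Lambda>' where d\<Lambda>: "(\<Lambda> has_derivative \<Lambda>') (at y0)" by (auto simp: differentiable_def)
  define N where "N a b = II a b - D (\<Gamma> a b)" for a b
  define T where "T a b k = m (N a b) (D k)" for a b k
  have B0: "m (D a) (D b) = \<Lambda> y0 * H y0 a b" for a b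
    using B\<Lambda>[OF U(2), of a b] by (simp add: B_def induced_coord_def m_def D_def y0_def chart_inv_chart[OF SA c])
  have T: "T a b k + T a k b = \<Lambda>' a * H y0 b k" for a b k
  proof -
    have "((\<lambda>z. \<Lambda> z * H z b k) has_derivative (\<lambda>v. \<Lambda> y0 * (H y0 (\<Gamma> v b) k + H y0 b (\<Gamma> v k)) + \<Lambda>' v * H y0 b k)) (at y0)"
      by (rule has_derivative_mult[OF d\<Lambda> dH])
    then have "((\<lambda>z. B z b k) has_derivative (\<lambda>v. \<Lambda> y0 * (H y0 (\<Gamma> v b) k + H y0 b (\<Gamma> v k)) + \<Lambda>' v * H y0 b k)) (at y0)"
      by (rule has_derivative_transform_within_open[OF _ U(1,2)]) (rule B\<Lambda>[symmetric])
    from fun_cong[OF has_derivative_unique[OF dB this], of a]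
    have "m (II a b) (D k) + m (D b) (II a k) = m (D (\<Gamma> a b)) (D k) + m (D b) (D (\<Gamma> a k)) + \<Lambda>' a * H y0 b k"
      by (simp add: B0 algebra_simps)
    then show ?thesis
      using sm'[of "D b" "II a k"] sm'[of "D b" "D (\<Gamma> a k)"]
      by (simp add: T_def N_def bilinear_lsub[OF bm])
  qed
  have sT: "T a b k = T b a k" for a b k
    unfolding T_def N_def s\<Gamma>[of a b] II_def y0_def chart_hessian_bilinear(1)[OF SA h X gX sm c d, of a b] ..
  have on: "H y0 x x = 1" "H y0 y y = 1" "H y0 x y = 0" "H y0 y x = 0"
    using xy iH[OF y0] by (simp_all add: H_def y0_def inner_form_def)
  have Tx: "T x x x + T y y x = 0"
    using T[of x x x] T[of y y x] T[of x y y] sT[of y x y] on by simp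
  have Ty: "T x x y + T y y y = 0"
    using T[of y y y] T[of x x y] T[of y x x] sT[of x y x] on by simp
  have \<tau>: "tension_field S h X g f p d = N x x + N y y"
    unfolding tension_field_component(1)[OF p xy[unfolded c_def] d, folded c_def] N_def II_def D_def \<Gamma>_def y0_def
    using linear_add[OF lin, unfolded D_def y0_def] by simp
  obtain r s where k: "k = r *\<^sub>R x + s *\<^sub>R y" using orthonormal_expand[OF iH[OF y0] on(1-3)] by blast
  have "m (N x x + N y y) (D k) = r * (T x x x + T y y x) + s * (T x x y + T y y y)"
    by (simp add: k T_def linear_add[OF lin] linear_scale[OF lin] bilinear_ladd[OF bm] bilinear_radd[OF bm]
        bilinear_rmul[OF bm] algebra_simps)
  then show ?thesis unfolding \<tau> by (simp add: Tx Ty m_def D_def y0_def)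
qed

end

section \<open>Holomorphicity of the Gauss lift\<close>

context
  fixes X :: "('x, real^7) chart set" and \<phi> :: "('x, real^7) three_form"
    and g :: "('x, real^7) metric_tensor"
    and S :: "('s, real^2) chart set" and h :: "('s, real^2) metric_tensor" and f :: "'s \<Rightarrow> 'x"
  assumes g2: "g2_manifold X \<phi> g" and S: "oriented_surface S" and h: "riemannian_metric S h"
    and f: "immersion S X f"
begin

abbreviation (input) "\<eta> \<equiv> \<lambda>q. snd (gauss_lift S X \<phi> g f q)"

lemma adapted_plane:
  assumes p: "p \<in> carrier S"
  defines "c \<equiv> chart_at S p"
  assumes d: "d \<in> X" "f p \<in> fst d"
  defines "D \<equiv> frechet_derivative (in_charts c d f) (at (snd c p))"
    and "m \<equiv> metric_coord X g d (snd d (f p))" and "C \<equiv> cross_coord X \<phi> g d (snd d (f p))"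
  obtains u1 u2 where "det2 u1 u2 > 0" "m (D u1) (D u1) = 1" "m (D u2) (D u2) = 1" "m (D u1) (D u2) = 0"
    "\<eta> p d = C (D u1) (D u2)" "linear D" "\<And>a. D a = 0 \<Longrightarrow> a = 0"
    "\<And>a. a = m (D a) (D u1) *\<^sub>R u1 + m (D a) (D u2) *\<^sub>R u2"
proof -
  note X = g2_atlas[OF g2] and gX = g2_metric[OF g2] and SA = surface_atlas[OF g2 S f] and sm = surface_smooth[OF g2 S f]
  have c: "c \<in> S" "p \<in> fst c" using chart_at_mem[OF p] by (auto simp: c_def)
  have F0: "in_charts c d f (snd c p) = snd d (f p)" by (simp add: chart_inv_chart[OF SA c])
  have B: "induced_coord X g c d f (snd c p) a b = m (D a) (D b)" for a b
    by (simp only: induced_coord_def F0 m_def D_def)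
  have lin: "linear D" unfolding D_def by (rule has_derivative_linear[OF in_charts_has_derivative[OF SA X sm c d]])
  note iB = induced_inner_form(1)[OF SA X gX f c d]
  obtain u1 u2 where u: "det2 u1 u2 > 0" "induced_coord X g c d f (snd c p) u1 u1 = 1"
      "induced_coord X g c d f (snd c p) u2 u2 = 1" "induced_coord X g c d f (snd c p) u1 u2 = 0"
    by (rule positive_orthonormal_basis[OF iB])
  show ?thesis
  proof (rule that[OF u(1) _ _ _ _ lin])
    show "m (D u1) (D u1) = 1" "m (D u2) (D u2) = 1" "m (D u1) (D u2) = 0" using u(2-4) by (simp_all only: B)
    show "\<eta> p d = C (D u1) (D u2)"
      using gauss_lift_coord(3)[OF g2 S f c d u(1)] u(2-4) by (simp add: C_def D_def)
    show "D a = 0 \<Longrightarrow> a = 0" for a unfolding D_def by (rule induced_inner_form(2)[OF SA X gX f c d])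
    show "a = m (D a) (D u1) *\<^sub>R u1 + m (D a) (D u2) *\<^sub>R u2" for a
      using orthonormal_expand[OF iB u(2-4), of a] by (simp only: B)
  qed
qed

lemma gauss_lift_tangent:
  assumes p: "p \<in> carrier S"
  shows "\<eta> p \<in> tangent_space X (f p)" and "g (f p) (\<eta> p) (\<eta> p) = 1"
    and "v \<in> tangent_space S p \<Longrightarrow> g (f p) (\<eta> p) (differential S X f p v) = 0"
proof -
  note X = g2_atlas[OF g2] and gX = g2_metric[OF g2] and SA = surface_atlas[OF g2 S f] and sm = surface_smooth[OF g2 S f]
  define c where "c = chart_at S p"
  define d where "d = chart_at X (f p)"
  have c: "c \<in> S" "p \<in> fst c" using chart_at_mem[OF p] by (auto simp: c_def)
  have d: "d \<in> X" "f p \<in> fst d"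
    using chart_at_mem[OF smooth_map_carrier[OF SA sm p]] by (auto simp: d_def)
  show T: "\<eta> p \<in> tangent_space X (f p)" by (rule gauss_lift_coord(1)[OF g2 S f c d])
  show "g (f p) (\<eta> p) (\<eta> p) = 1" by (rule gauss_lift_coord(2)[OF g2 S f c d])
  define D where "D = frechet_derivative (in_charts c d f) (at (snd c p))"
  define m where "m = metric_coord X g d (snd d (f p))"
  define C where "C = cross_coord X \<phi> g d (snd d (f p))"
  interpret P: vector_cross_product m C unfolding m_def C_def by (rule cross_coord_properties(1)[OF g2 d])
  obtain u1 u2 where u: "m (D u1) (D u1) = 1" "m (D u2) (D u2) = 1" "m (D u1) (D u2) = 0"
    "\<eta> p d = C (D u1) (D u2)" and lin: "linear D" and ex: "\<And>a. a = m (D a) (D u1) *\<^sub>R u1 + m (D a) (D u2) *\<^sub>R u2"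
    using adapted_plane[OF p d] unfolding c_def[symmetric] D_def[symmetric] m_def[symmetric] C_def[symmetric] by metis
  show "g (f p) (\<eta> p) (differential S X f p v) = 0" if v: "v \<in> tangent_space S p"
  proof -
    have "m (\<eta> p d) (D a) = 0" for a
      by (subst ex[of a]) (simp add: u(4) linear_add[OF lin] linear_scale[OF lin] P.linG P.n_orth[OF u(1-3) refl])
    then show ?thesis
      unfolding metric_tangent[OF X gX d T differential_mem[OF SA X sm p]] differential_component[OF SA X sm c d v]
      by (simp add: D_def m_def)
  qed
qed

text \<open>The complex structure acts on the horizontal and on the vertical part separately, and a vector
  determines both of its parts.\<close>

lemma gauss_lift_complex_linear_iff:
  assumes p: "p \<in> carrier S" and v: "v \<in> tangent_space S p"
  shows "differential S (tangent_bundle X) (gauss_lift S X \<phi> g f) p v \<in> distribution X g (gauss_lift S X \<phi> g f p)"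
    and "differential S (tangent_bundle X) (gauss_lift S X \<phi> g f) p (rotate90 S h p v) =
          distribution_complex X \<phi> g (gauss_lift S X \<phi> g f p) (differential S (tangent_bundle X) (gauss_lift S X \<phi> g f) p v)
      \<longleftrightarrow> differential S X f p (rotate90 S h p v) = cross X \<phi> g (f p) (\<eta> p) (differential S X f p v)
        \<and> nabla_along S X g f \<eta> p (rotate90 S h p v) = cross X \<phi> g (f p) (\<eta> p) (nabla_along S X g f \<eta> p v)"
proof -
  note X = g2_atlas[OF g2] and gX = g2_metric[OF g2] and SA = surface_atlas[OF g2 S f] and sm = surface_smooth[OF g2 S f]
  have c: "chart_at S p \<in> S" "p \<in> fst (chart_at S p)" using chart_at_mem[OF p] by auto
  have fp: "f p \<in> carrier X" by (rule smooth_map_carrier[OF SA sm p])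
  define d where "d = chart_at X (f p)"
  have d: "d \<in> X" "f p \<in> fst d" using chart_at_mem[OF fp] by (auto simp: d_def)
  interpret P: vector_cross_product "metric_coord X g d (snd d (f p))" "cross_coord X \<phi> g d (snd d (f p))"
    by (rule cross_coord_properties(1)[OF g2 d])
  have GL: "(f p, \<eta> p) = gauss_lift S X \<phi> g f p" by (simp add: gauss_lift_def)
  note n = gauss_lift_tangent[OF p]
  have r: "rotate90 S h p v \<in> tangent_space S p" by (rule rotate90_component(1)[OF S h c v])
  have TX: "differential S X f p w \<in> tangent_space X (f p)" for w by (rule differential_mem[OF SA X sm p])
  have E1: "differential S X f p w \<in> E_space X g (f p, \<eta> p)" if "w \<in> tangent_space S p" for w
    using TX n(3)[OF that] by (simp add: E_space_def)
  have E2: "nabla_along S X g f \<eta> p w \<in> E_space X g (f p, \<eta> p)" if "w \<in> tangent_space S p" for w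
    using gauss_lift_derivative(2,3)[OF g2 S f p that] by (simp add: E_space_def)
  have Ec: "E_complex X \<phi> g (f p, \<eta> p) w = cross X \<phi> g (f p) (\<eta> p) w" for w by (simp add: E_complex_def)
  have EE: "E_complex X \<phi> g (f p, \<eta> p) w \<in> E_space X g (f p, \<eta> p)" if "w \<in> E_space X g (f p, \<eta> p)" for w
  proof -
    have w: "w \<in> tangent_space X (f p)" using that by (simp add: E_space_def)
    note cr = cross_coord_properties(3)[OF g2 d n(1) w]
    have "g (f p) (\<eta> p) (cross X \<phi> g (f p) (\<eta> p) w) = 0"
      using metric_tangent[OF X gX d n(1), of "cross X \<phi> g (f p) (\<eta> p) w"] cr P.orth_left by simp
    then show ?thesis using cr by (simp add: E_space_def Ec)
  qed
  show "differential S (tangent_bundle X) (gauss_lift S X \<phi> g f) p v \<in> distribution X g (gauss_lift S X \<phi> g f p)"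
    using connection_lift_distribution[OF X gX fp n(1,2) E1[OF v] E2[OF v]]
    unfolding gauss_lift_derivative(1)[OF g2 S f p v] GL .
  have dc: "distribution_complex X \<phi> g (f p, \<eta> p) (connection_lift X g (f p, \<eta> p) (differential S X f p v) (nabla_along S X g f \<eta> p v))
     = connection_lift X g (f p, \<eta> p) (cross X \<phi> g (f p) (\<eta> p) (differential S X f p v)) (cross X \<phi> g (f p) (\<eta> p) (nabla_along S X g f \<eta> p v))"
    by (rule distribution_complex_lift[OF X gX fp n(1,2) E1[OF v] E2[OF v], of \<phi>, unfolded Ec])
       (rule EE[unfolded Ec])
  have T2: "nabla_along S X g f \<eta> p w \<in> tangent_space X (f p)" if "w \<in> tangent_space S p" for w
    by (rule gauss_lift_derivative(2)[OF g2 S f p that])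
  have T3: "cross X \<phi> g (f p) (\<eta> p) w \<in> tangent_space X (f p)" if "w \<in> tangent_space X (f p)" for w
    using cross_coord_properties(3)[OF g2 d n(1) that] by blast
  show "differential S (tangent_bundle X) (gauss_lift S X \<phi> g f) p (rotate90 S h p v) =
          distribution_complex X \<phi> g (gauss_lift S X \<phi> g f p) (differential S (tangent_bundle X) (gauss_lift S X \<phi> g f) p v)
      \<longleftrightarrow> differential S X f p (rotate90 S h p v) = cross X \<phi> g (f p) (\<eta> p) (differential S X f p v)
        \<and> nabla_along S X g f \<eta> p (rotate90 S h p v) = cross X \<phi> g (f p) (\<eta> p) (nabla_along S X g f \<eta> p v)"
    unfolding gauss_lift_derivative(1)[OF g2 S f p v] gauss_lift_derivative(1)[OF g2 S f p r] dc[unfolded GL] GL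
    using connection_lift_inject[OF X gX fp n(1) TX T2[OF r] T3[OF TX] T3[OF T2[OF v]], unfolded GL] by metis
qed

text \<open>If the metrics are proportional, rescaling turns \<open>u1, u2\<close> into an orthonormal basis for \<open>h\<close>.\<close>

lemma rotation_conformal:
  assumes p: "p \<in> carrier S"
  defines "c \<equiv> chart_at S p"
  assumes d: "d \<in> X" "f p \<in> fst d"
  defines "D \<equiv> frechet_derivative (in_charts c d f) (at (snd c p))"
    and "m \<equiv> metric_coord X g d (snd d (f p))" and "H \<equiv> metric_coord S h c (snd c p)"
  assumes u: "det2 u1 u2 > 0" "m (D u1) (D u1) = 1" "m (D u2) (D u2) = 1" "m (D u1) (D u2) = 0"
    and l: "l > 0" "\<And>a b. m (D a) (D b) = l * H a b" and v: "v \<in> tangent_space S p"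
  shows "rotate90 S h p v c = m (D (v c)) (D u1) *\<^sub>R u2 - m (D (v c)) (D u2) *\<^sub>R u1"
proof -
  have SA: "smooth_atlas S" using surface_atlas[OF g2 S f] .
  have c: "c \<in> S" "p \<in> fst c" using chart_at_mem[OF p] by (auto simp: c_def)
  have iH: "inner_form H" unfolding H_def by (rule metric_coord_inner_form[OF SA h c(1) chart_image_mem[OF c(2)]])
  have bH: "bilinear H" using iH by (simp add: inner_form_def)
  define r where "r = sqrt l"
  have r: "r > 0" "r * r = l" using l(1) by (simp_all add: r_def)
  have on: "H (r *\<^sub>R u1) (r *\<^sub>R u1) = 1" "H (r *\<^sub>R u2) (r *\<^sub>R u2) = 1" "H (r *\<^sub>R u1) (r *\<^sub>R u2) = 0"
    using u(2-4) r by (simp_all add: bilinear_lmul[OF bH] bilinear_rmul[OF bH] l(2) flip: mult.assoc)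
  have pos: "det2 (r *\<^sub>R u1) (r *\<^sub>R u2) > 0"
  proof -
    have "det2 (r *\<^sub>R u1) (r *\<^sub>R u2) = l * det2 u1 u2" by (simp add: det2_def algebra_simps flip: r(2))
    then show ?thesis using l(1) u(1) by simp
  qed
  have "plane_rotation H (v c) (H (v c) (r *\<^sub>R u1) *\<^sub>R (r *\<^sub>R u2) - H (v c) (r *\<^sub>R u2) *\<^sub>R (r *\<^sub>R u1))"
    unfolding plane_rotation_iff[OF iH on pos] ..
  moreover have "H (v c) (r *\<^sub>R u1) *\<^sub>R (r *\<^sub>R u2) - H (v c) (r *\<^sub>R u2) *\<^sub>R (r *\<^sub>R u1)
      = m (D (v c)) (D u1) *\<^sub>R u2 - m (D (v c)) (D u2) *\<^sub>R u1"
    by (simp add: bilinear_rmul[OF bH] l(2) mult_ac flip: r(2))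
  ultimately show ?thesis using rotate90_component(2)[OF S h c v] unfolding H_def by simp
qed

text \<open>On the tangent plane of the surface \<open>\<eta> \<times>\<close> is the rotation of the induced metric, and two
  metrics on a plane have the same rotations if and only if they are proportional.\<close>

lemma horizontal_complex_linear_iff:
  assumes p: "p \<in> carrier S"
  shows "(\<forall>v\<in>tangent_space S p. differential S X f p (rotate90 S h p v) = cross X \<phi> g (f p) (\<eta> p) (differential S X f p v))
     \<longleftrightarrow> (\<exists>l>0. \<forall>u\<in>tangent_space S p. \<forall>v\<in>tangent_space S p.
            g (f p) (differential S X f p u) (differential S X f p v) = l * h p u v)" (is "?L \<longleftrightarrow> ?R")
proof -
  note X = g2_atlas[OF g2] and gX = g2_metric[OF g2] and SA = surface_atlas[OF g2 S f] and sm = surface_smooth[OF g2 S f]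
  define c where "c = chart_at S p"
  define d where "d = chart_at X (f p)"
  have c: "c \<in> S" "p \<in> fst c" using chart_at_mem[OF p] by (auto simp: c_def)
  have d: "d \<in> X" "f p \<in> fst d"
    using chart_at_mem[OF smooth_map_carrier[OF SA sm p]] by (auto simp: d_def)
  define D where "D = frechet_derivative (in_charts c d f) (at (snd c p))"
  define m where "m = metric_coord X g d (snd d (f p))"
  define C where "C = cross_coord X \<phi> g d (snd d (f p))"
  define H where "H = metric_coord S h c (snd c p)"
  interpret P: vector_cross_product m C unfolding m_def C_def by (rule cross_coord_properties(1)[OF g2 d])
  obtain u1 u2 where u: "det2 u1 u2 > 0" "m (D u1) (D u1) = 1" "m (D u2) (D u2) = 1" "m (D u1) (D u2) = 0"
    and n: "\<eta> p d = C (D u1) (D u2)" and lin: "linear D" and inj: "\<And>a. D a = 0 \<Longrightarrow> a = 0"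
    and ex: "\<And>a. a = m (D a) (D u1) *\<^sub>R u1 + m (D a) (D u2) *\<^sub>R u2"
    using adapted_plane[OF p d] unfolding c_def[symmetric] D_def[symmetric] m_def[symmetric] C_def[symmetric] by metis
  have iH: "inner_form H" unfolding H_def by (rule metric_coord_inner_form[OF SA h c(1) chart_image_mem[OF c(2)]])
  have bH: "bilinear H" and sH: "H a b = H b a" for a b using iH by (auto simp: inner_form_def)
  have T: "tangent_of S c p a \<in> tangent_space S p" for a by (rule tangent_of_mem[OF SA c])
  have TX: "differential S X f p v \<in> tangent_space X (f p)" for v by (rule differential_mem[OF SA X sm p])
  have comp: "differential S X f p v d = D (v c)" if "v \<in> tangent_space S p" for v
    unfolding D_def by (rule differential_component[OF SA X sm c d that])
  have rot: "rotate90 S h p v \<in> tangent_space S p" if "v \<in> tangent_space S p" for v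
    by (rule rotate90_component(1)[OF S h c that])
  have cr: "cross X \<phi> g (f p) (\<eta> p) w \<in> tangent_space X (f p)" "cross X \<phi> g (f p) (\<eta> p) w d = C (\<eta> p d) (w d)"
    if "w \<in> tangent_space X (f p)" for w
    using cross_coord_properties(3)[OF g2 d gauss_lift_tangent(1)[OF p] that] by (simp_all add: C_def)
  have L: "differential S X f p (rotate90 S h p v) = cross X \<phi> g (f p) (\<eta> p) (differential S X f p v)
      \<longleftrightarrow> D (rotate90 S h p v c) = C (\<eta> p d) (D (v c))" if v: "v \<in> tangent_space S p" for v
  proof
    assume "differential S X f p (rotate90 S h p v) = cross X \<phi> g (f p) (\<eta> p) (differential S X f p v)"
    from fun_cong[OF this, of d] show "D (rotate90 S h p v c) = C (\<eta> p d) (D (v c))"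
      by (simp only: comp[OF rot[OF v]] cr(2)[OF TX] comp[OF v])
  next
    assume "D (rotate90 S h p v c) = C (\<eta> p d) (D (v c))"
    then show "differential S X f p (rotate90 S h p v) = cross X \<phi> g (f p) (\<eta> p) (differential S X f p v)"
      by (intro tangent_eqI[OF X TX cr(1)[OF TX] d]) (simp only: comp[OF rot[OF v]] cr(2)[OF TX] comp[OF v])
  qed
  have gh: "g (f p) (differential S X f p v) (differential S X f p w) = m (D (v c)) (D (w c))" "h p v w = H (v c) (w c)"
    if "v \<in> tangent_space S p" "w \<in> tangent_space S p" for v w
    by (simp only: metric_tangent[OF X gX d TX TX] comp[OF that(1)] comp[OF that(2)] m_def)
       (simp only: metric_tangent[OF SA h c that] H_def)
  note na = P.n_a[OF u(2-4) n] and nb = P.n_b[OF u(2-4) n]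
  show ?thesis
  proof
    assume ?L
    define v where "v = tangent_of S c p u1"
    have v: "v \<in> tangent_space S p" "v c = u1" unfolding v_def by (rule T, rule tangent_of_same[OF SA c])
    have "D (rotate90 S h p v c) = D u2"
      using \<open>?L\<close> L[OF v(1)] v na by simp
    then have "D (rotate90 S h p v c - u2) = 0" by (simp add: linear_diff[OF lin])
    from inj[OF this] have j: "rotate90 S h p v c = u2" by simp
    obtain x y where xy: "det2 x y > 0" "H x x = 1" "H y y = 1" "H x y = 0"
      by (rule positive_orthonormal_basis[OF iH])
    have "plane_rotation H u1 (H u1 x *\<^sub>R y - H u1 y *\<^sub>R x)" unfolding plane_rotation_iff[OF iH xy(2-4,1)] ..
    moreover from rotate90_component(2)[OF S h c v(1), folded H_def, unfolded v(2), OF this]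
    have "H u1 x *\<^sub>R y - H u1 y *\<^sub>R x = u2" using j by simp
    ultimately have pr: "H u1 u2 = 0" "H u2 u2 = H u1 u1" by (simp_all add: plane_rotation_def)
    have "u1 \<noteq> 0" using u(2) linear_0[OF lin] P.linG(3)[of 0 0 0] by auto
    then have pos: "H u1 u1 > 0" using iH by (simp add: inner_form_def)
    have "m (D a) (D b) = 1 / H u1 u1 * H a b" for a b
    proof -
      define p q r s where "p = m (D a) (D u1)" and "q = m (D a) (D u2)" and "r = m (D b) (D u1)" and "s = m (D b) (D u2)"
      have a: "a = p *\<^sub>R u1 + q *\<^sub>R u2" and b: "b = r *\<^sub>R u1 + s *\<^sub>R u2"
        unfolding p_def q_def r_def s_def by (rule ex)+
      have "H a b = (p * r + q * s) * H u1 u1"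
        unfolding a b by (simp add: bilinear_ladd[OF bH] bilinear_radd[OF bH] bilinear_lmul[OF bH] bilinear_rmul[OF bH]
            pr sH[of u2 u1] algebra_simps)
      moreover have "m (D a) (D b) = p * r + q * s"
        unfolding a b by (simp add: linear_add[OF lin] linear_scale[OF lin] P.linG u P.sG[of "D u2" "D u1"])
      ultimately show ?thesis using pos by simp
    qed
    then show ?R using pos by (intro exI[of _ "1 / H u1 u1"]) (simp add: gh)
  next
    assume ?R
    then obtain l where l: "l > 0" and gl: "\<And>u v. u \<in> tangent_space S p \<Longrightarrow> v \<in> tangent_space S p \<Longrightarrow>
        g (f p) (differential S X f p u) (differential S X f p v) = l * h p u v" by blast
    have ml: "m (D a) (D b) = l * H a b" for a b
      using gl[OF T T, of a b] unfolding gh[OF T T] tangent_of_same[OF SA c] .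
    show ?L
    proof
      fix v assume v: "v \<in> tangent_space S p"
      have r: "rotate90 S h p v c = m (D (v c)) (D u1) *\<^sub>R u2 - m (D (v c)) (D u2) *\<^sub>R u1"
        using rotation_conformal[OF p d, folded c_def, folded D_def m_def H_def, OF u l ml v] .
      have "C (\<eta> p d) (D (v c)) = C (\<eta> p d) (D (m (D (v c)) (D u1) *\<^sub>R u1 + m (D (v c)) (D u2) *\<^sub>R u2))"
        using ex[of "v c"] by simp
      also have "\<dots> = D (rotate90 S h p v c)"
        by (simp add: r linear_add[OF lin] linear_diff[OF lin] linear_scale[OF lin] P.linX na nb)
      finally show "differential S X f p (rotate90 S h p v) = cross X \<phi> g (f p) (\<eta> p) (differential S X f p v)"
        unfolding L[OF v] ..
    qed
  qed
qed

text \<open>For a conformal immersion the tension field is normal, so that it vanishes if and only if the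
  trace of the Hessian of the charts is tangential, and this is complex linearity of \<open>\<nabla>\<eta>\<close>.\<close>

lemma vertical_complex_linear_iff:
  assumes p: "p \<in> carrier S" and conf: "conformal S h X g f"
    and perp: "\<forall>v\<in>tangent_space S p. \<forall>w\<in>tangent_space S p.
           g (f p) (second_fundamental_form S X g f p v w) (\<eta> p) = 0"
    and d: "d \<in> X" "f p \<in> fst d"
  shows "(\<forall>v\<in>tangent_space S p. nabla_along S X g f \<eta> p (rotate90 S h p v) d
           = cross X \<phi> g (f p) (\<eta> p) (nabla_along S X g f \<eta> p v) d)
     \<longleftrightarrow> tension_field S h X g f p d = 0" (is "?L \<longleftrightarrow> ?R")
proof -
  note X = g2_atlas[OF g2] and gX = g2_metric[OF g2] and SA = surface_atlas[OF g2 S f] and sm = surface_smooth[OF g2 S f]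
  define c where "c = chart_at S p"
  have c: "c \<in> S" "p \<in> fst c" using chart_at_mem[OF p] by (auto simp: c_def)
  have F0: "in_charts c d f (snd c p) = snd d (f p)" by (simp add: chart_inv_chart[OF SA c])
  define D where "D = frechet_derivative (in_charts c d f) (at (snd c p))"
  define m where "m = metric_coord X g d (snd d (f p))"
  define C where "C = cross_coord X \<phi> g d (snd d (f p))"
  define H where "H = metric_coord S h c (snd c p)"
  define II where "II = chart_hessian X g c d f (snd c p)"
  define \<Gamma> where "\<Gamma> = levi_civita S h c (snd c p)"
  interpret P: vector_cross_product m C unfolding m_def C_def by (rule cross_coord_properties(1)[OF g2 d])
  obtain u1 u2 where u: "det2 u1 u2 > 0" "m (D u1) (D u1) = 1" "m (D u2) (D u2) = 1" "m (D u1) (D u2) = 0"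
    and n: "\<eta> p d = C (D u1) (D u2)" and lin: "linear D"
    and ex: "\<And>a. a = m (D a) (D u1) *\<^sub>R u1 + m (D a) (D u2) *\<^sub>R u2"
    using adapted_plane[OF p d] unfolding c_def[symmetric] D_def[symmetric] m_def[symmetric] C_def[symmetric] by metis
  have bH: "bilinear H" unfolding H_def by (rule metric_bilinear[OF h c(1) chart_image_mem[OF c(2)]])
  have b\<Gamma>: "bilinear \<Gamma>" unfolding \<Gamma>_def by (rule levi_civita_bilinear[OF SA h c(1) chart_image_mem[OF c(2)]])
  have sII: "II a b = II b a" and bII: "bilinear II" for a b
    unfolding II_def by (rule chart_hessian_bilinear(1)[OF SA h X gX sm c d], rule chart_hessian_bilinear(2)[OF SA h X gX sm c d])
  have T: "tangent_of S c p a \<in> tangent_space S p" for a by (rule tangent_of_mem[OF SA c])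
  note Tc = tangent_of_same[OF SA c]
  have TX: "differential S X f p v \<in> tangent_space X (f p)" for v by (rule differential_mem[OF SA X sm p])
  have comp: "differential S X f p v d = D (v c)" if "v \<in> tangent_space S p" for v
    unfolding D_def by (rule differential_component[OF SA X sm c d that])
  note nT = gauss_lift_tangent[OF p]
  have B: "induced_coord X g c d f (snd c p) a b = m (D a) (D b)" for a b
    by (simp only: induced_coord_def F0 m_def D_def)
  note GD = gauss_derivative[OF g2 S f p _ d, folded c_def, folded D_def II_def C_def m_def, unfolded B, OF _ u]
  define L where "L a = frechet_derivative (\<lambda>y. \<eta> (chart_inv c y) d) (at (snd c p)) a
     + levi_civita X g d (snd d (f p)) (D a) (\<eta> p d)" for a
  have nab: "nabla_along S X g f \<eta> p v d = L (v c)" if v: "v \<in> tangent_space S p" for v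
    using d comp[OF v] by (simp add: nabla_along_def L_def c_def[symmetric])
  have lL: "linear L"
  proof -
    have "linear (\<lambda>a. levi_civita X g d (snd d (f p)) (D a) (\<eta> p d))"
      using linear_compose[OF lin bilinear_linear_left[OF levi_civita_bilinear[OF X gX d(1) chart_image_mem[OF d(2)]], of "\<eta> p d"]]
      by (simp add: comp_def)
    then show ?thesis
      unfolding L_def[abs_def] by (intro linear_compose_add linear_frechet_derivative GD(1)[OF T])
  qed
  obtain l where l: "l > 0" and gl: "\<And>u v. u \<in> tangent_space S p \<Longrightarrow> v \<in> tangent_space S p \<Longrightarrow>
        g (f p) (differential S X f p u) (differential S X f p v) = l * h p u v"
    using conf p unfolding conformal_def by blast
  have ml: "m (D a) (D b) = l * H a b" for a b
    using gl[OF T T, of a b]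
    unfolding metric_tangent[OF X gX d TX TX] comp[OF T] metric_tangent[OF SA h c T T] Tc m_def[symmetric] H_def[symmetric] .
  have rot: "rotate90 S h p v c = m (D (v c)) (D u1) *\<^sub>R u2 - m (D (v c)) (D u2) *\<^sub>R u1" if v: "v \<in> tangent_space S p" for v
    using rotation_conformal[OF p d, folded c_def, folded D_def m_def H_def, OF u l ml v] .
  have rT: "rotate90 S h p v \<in> tangent_space S p" if "v \<in> tangent_space S p" for v
    by (rule rotate90_component(1)[OF S h c that])
  have cr: "cross X \<phi> g (f p) (\<eta> p) (nabla_along S X g f \<eta> p v) d = C (\<eta> p d) (L (v c))"
    if v: "v \<in> tangent_space S p" for v
    using cross_coord_properties(3)[OF g2 d nT(1) gauss_lift_derivative(2)[OF g2 S f p v]]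
    by (simp add: C_def nab[OF v])
  have Ln: "m (\<eta> p d) (L a) = 0" for a
    using GD(3)[OF T[of a]] by (simp add: nab[OF T] Tc)
  have LII: "\<exists>r. L a = C (II a u1) (D u2) + C (D u1) (II a u2) + r *\<^sub>R \<eta> p d" for a
    using GD(2)[OF T[of a]] by (simp add: nab[OF T] Tc)
  have nn: "m (\<eta> p d) (\<eta> p d) = 1" by (rule P.n_unit[OF u(2-4) n])
  have nII: "m (\<eta> p d) (II a b) = 0" for a b
  proof -
    have "g (f p) (second_fundamental_form S X g f p (tangent_of S c p a) (tangent_of S c p b)) (\<eta> p)
        = m (II a b) (\<eta> p d)"
      using second_fundamental_form_inner[OF X gX SA h f p T T nT(1) nT(3) d, of a b]
      by (simp add: m_def II_def Tc flip: c_def)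
    then show ?thesis
      using bspec[OF bspec[OF perp T[of a]] T[of b]] P.sG[of "\<eta> p d" "II a b"] by (simp only:)
  qed
  have "?L \<longleftrightarrow> (\<forall>a. L (m (D a) (D u1) *\<^sub>R u2 - m (D a) (D u2) *\<^sub>R u1) = C (\<eta> p d) (L a))"
  proof
    assume A: ?L
    show "\<forall>a. L (m (D a) (D u1) *\<^sub>R u2 - m (D a) (D u2) *\<^sub>R u1) = C (\<eta> p d) (L a)"
    proof
      fix a
      show "L (m (D a) (D u1) *\<^sub>R u2 - m (D a) (D u2) *\<^sub>R u1) = C (\<eta> p d) (L a)"
        using bspec[OF A T[of a]] unfolding nab[OF rT[OF T]] cr[OF T] rot[OF T] Tc .
    qed
  next
    assume A: "\<forall>a. L (m (D a) (D u1) *\<^sub>R u2 - m (D a) (D u2) *\<^sub>R u1) = C (\<eta> p d) (L a)"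
    show ?L
    proof
      fix v assume v: "v \<in> tangent_space S p"
      show "nabla_along S X g f \<eta> p (rotate90 S h p v) d = cross X \<phi> g (f p) (\<eta> p) (nabla_along S X g f \<eta> p v) d"
        unfolding nab[OF rT[OF v]] cr[OF v] rot[OF v] using A by blast
    qed
  qed
  \<comment> \<open>The equation for \<open>u2\<close> follows from the one for \<open>u1\<close>, as \<open>\<eta> \<times>\<close> squares to \<open>-1\<close> on the complement of \<open>\<eta>\<close>.\<close>
  also have "\<dots> \<longleftrightarrow> L u2 = C (\<eta> p d) (L u1)"
  proof
    assume "\<forall>a. L (m (D a) (D u1) *\<^sub>R u2 - m (D a) (D u2) *\<^sub>R u1) = C (\<eta> p d) (L a)"
    from this[rule_format, of u1] show "L u2 = C (\<eta> p d) (L u1)" by (simp add: u)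
  next
    assume 1: "L u2 = C (\<eta> p d) (L u1)"
    then have 2: "C (\<eta> p d) (L u2) = - L u1" using P.double[of "\<eta> p d" "L u1"] by (simp add: Ln nn)
    show "\<forall>a. L (m (D a) (D u1) *\<^sub>R u2 - m (D a) (D u2) *\<^sub>R u1) = C (\<eta> p d) (L a)"
    proof
      fix a
      have "C (\<eta> p d) (L a) = C (\<eta> p d) (L (m (D a) (D u1) *\<^sub>R u1 + m (D a) (D u2) *\<^sub>R u2))"
        using ex[of a] by simp
      also have "\<dots> = m (D a) (D u1) *\<^sub>R L u2 - m (D a) (D u2) *\<^sub>R L u1"
        by (simp add: linear_add[OF lL] linear_scale[OF lL] P.linX 2 flip: 1)
      finally show "L (m (D a) (D u1) *\<^sub>R u2 - m (D a) (D u2) *\<^sub>R u1) = C (\<eta> p d) (L a)"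
        by (simp add: linear_diff[OF lL] linear_scale[OF lL])
    qed
  qed
  also have "\<dots> \<longleftrightarrow> II u1 u1 + II u2 u2 = m (D u1) (II u1 u1 + II u2 u2) *\<^sub>R D u1 + m (D u2) (II u1 u1 + II u2 u2) *\<^sub>R D u2"
  proof -
    obtain r1 where 1: "L u1 = C (II u1 u1) (D u2) + C (D u1) (II u1 u2) + r1 *\<^sub>R \<eta> p d" using LII by blast
    obtain r2 where 2: "L u2 = C (II u1 u2) (D u2) + C (D u1) (II u2 u2) + r2 *\<^sub>R \<eta> p d" using LII[of u2] sII[of u2 u1] by auto
    show ?thesis by (rule P.derivative_complex_linear_iff[OF u(2-4) n nII nII nII 1 Ln 2 Ln])
  qed
  also have "\<dots> \<longleftrightarrow> ?R"
  proof -
    define r where "r = sqrt l"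
    have r: "r > 0" "r * r = l" using l by (simp_all add: r_def)
    have on: "H (r *\<^sub>R u1) (r *\<^sub>R u1) = 1" "H (r *\<^sub>R u2) (r *\<^sub>R u2) = 1" "H (r *\<^sub>R u1) (r *\<^sub>R u2) = 0"
      using u(2-4) r by (simp_all add: bilinear_lmul[OF bH] bilinear_rmul[OF bH] ml flip: mult.assoc)
    define z where "z = \<Gamma> u1 u1 + \<Gamma> u2 u2"
    define Q where "Q = II u1 u1 + II u2 u2"
    have \<tau>: "tension_field S h X g f p d = l *\<^sub>R (Q - D z)"
      using tension_field_component(1)[OF X gX SA h f p on[unfolded H_def c_def] d, folded c_def, folded D_def II_def \<Gamma>_def]
      by (simp add: Q_def z_def bilinear_lmul[OF bII] bilinear_rmul[OF bII] bilinear_lmul[OF b\<Gamma>] bilinear_rmul[OF b\<Gamma>]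
          linear_add[OF lin] linear_scale[OF lin] r scaleR_diff_right scaleR_add_right)
    have o: "m (Q - D z) (D k) = 0" for k
      using conformal_tension_normal[OF X gX SA h f p conf d on[unfolded H_def c_def], folded c_def, folded D_def m_def] l
      by (simp add: \<tau> P.linG)
    have Dex: "D a = m (D u1) (D a) *\<^sub>R D u1 + m (D u2) (D a) *\<^sub>R D u2" for a
    proof -
      have "D a = D (m (D a) (D u1) *\<^sub>R u1 + m (D a) (D u2) *\<^sub>R u2)" using ex[of a] by simp
      then show ?thesis using P.sG[of "D a"] by (simp add: linear_add[OF lin] linear_scale[OF lin])
    qed
    have "Q = m (D u1) Q *\<^sub>R D u1 + m (D u2) Q *\<^sub>R D u2 \<longleftrightarrow> Q - D z = 0"
    proof
      assume "Q = m (D u1) Q *\<^sub>R D u1 + m (D u2) Q *\<^sub>R D u2"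
      then have "Q - D z = D (m (D u1) Q *\<^sub>R u1 + m (D u2) Q *\<^sub>R u2 - z)"
        by (simp add: linear_add[OF lin] linear_diff[OF lin] linear_scale[OF lin])
      then have "m (Q - D z) (Q - D z) = 0" using o by metis
      then show "Q - D z = 0" using P.G unfolding inner_form_def by (metis less_irrefl)
    next
      assume "Q - D z = 0"
      then have "Q = D z" by simp
      then show "Q = m (D u1) Q *\<^sub>R D u1 + m (D u2) Q *\<^sub>R D u2" using Dex[of z] by simp
    qed
    then show ?thesis using l by (simp add: \<tau> flip: Q_def)
  qed
  finally show ?thesis .
qed

end

theorem theorem5p3:
  fixes X :: "('x, real^7) chart set" and \<phi> :: "('x, real^7) three_form"
    and g :: "('x, real^7) metric_tensor"
    and S :: "('s, real^2) chart set" and h :: "('s, real^2) metric_tensor"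
    and f :: "'s \<Rightarrow> 'x"
  assumes "g2_manifold X \<phi> g"
    and "oriented_surface S" and "riemannian_metric S h"
    and "immersion S X f"
    and "\<forall>p\<in>carrier S. \<forall>v\<in>tangent_space S p. \<forall>w\<in>tangent_space S p.
           g (f p) (second_fundamental_form S X g f p v w) (snd (gauss_lift S X \<phi> g f p)) = 0"
  shows "holomorphic_into_distribution S h X \<phi> g (gauss_lift S X \<phi> g f) \<longleftrightarrow>
         conformal S h X g f \<and> harmonic S h X g f"
proof -
  note X = g2_atlas[OF assms(1)] and SA = surface_atlas[OF assms(1,2,4)] and sm = surface_smooth[OF assms(1,2,4)]
  define n where "n = (\<lambda>q. snd (gauss_lift S X \<phi> g f q))"
  define hor where "hor p \<longleftrightarrow> (\<forall>v\<in>tangent_space S p.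
      differential S X f p (rotate90 S h p v) = cross X \<phi> g (f p) (n p) (differential S X f p v))" for p
  define ver where "ver p \<longleftrightarrow> (\<forall>v\<in>tangent_space S p.
      nabla_along S X g f n p (rotate90 S h p v) = cross X \<phi> g (f p) (n p) (nabla_along S X g f n p v))" for p
  have "holomorphic_into_distribution S h X \<phi> g (gauss_lift S X \<phi> g f) \<longleftrightarrow> (\<forall>p\<in>carrier S. hor p \<and> ver p)"
    unfolding holomorphic_into_distribution_def hor_def ver_def n_def
    using gauss_lift_complex_linear_iff[OF assms(1-4)] by (simp add: ball_conj_distrib cong: ball_cong)
  also have "\<dots> \<longleftrightarrow> (\<forall>p\<in>carrier S. hor p) \<and> (\<forall>p\<in>carrier S. ver p)" by blast
  also have "(\<forall>p\<in>carrier S. hor p) \<longleftrightarrow> conformal S h X g f"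
  proof -
    have "(\<forall>p\<in>carrier S. hor p) \<longleftrightarrow> (\<forall>p\<in>carrier S. \<exists>l>0. \<forall>u\<in>tangent_space S p. \<forall>v\<in>tangent_space S p.
        g (f p) (differential S X f p u) (differential S X f p v) = l * h p u v)"
      unfolding hor_def n_def using horizontal_complex_linear_iff[OF assms(1-4)] by (simp cong: ball_cong)
    then show ?thesis unfolding conformal_def by (simp only: bchoice_iff)
  qed
  also have "conformal S h X g f \<and> (\<forall>p\<in>carrier S. ver p) \<longleftrightarrow> conformal S h X g f \<and> harmonic S h X g f"
  proof (rule conj_cong[OF refl])
    assume conf: "conformal S h X g f"
    have "ver p \<longleftrightarrow> tension_field S h X g f p = 0" if p: "p \<in> carrier S" for p
    proof -
      note V = vertical_complex_linear_iff[OF assms(1-4) p conf bspec[OF assms(5) p], folded n_def]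
      have c: "chart_at S p \<in> S" "p \<in> fst (chart_at S p)" using chart_at_mem[OF p] by auto
      define d where "d = chart_at X (f p)"
      have d: "d \<in> X" "f p \<in> fst d"
        using chart_at_mem[OF smooth_map_carrier[OF SA sm p]] by (auto simp: d_def)
      obtain x y where xy: "metric_coord S h (chart_at S p) (snd (chart_at S p) p) x x = 1"
        "metric_coord S h (chart_at S p) (snd (chart_at S p) p) y y = 1"
        "metric_coord S h (chart_at S p) (snd (chart_at S p) p) x y = 0"
        using positive_orthonormal_basis[OF metric_coord_inner_form[OF SA assms(3) c(1) chart_image_mem[OF c(2)]]] by metis
      show ?thesis
      proof
        assume v: "ver p"
        show "tension_field S h X g f p = 0"
        proof
          fix e
          show "tension_field S h X g f p e = 0 e"
          proof (cases "e \<in> X \<and> f p \<in> fst e")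
            case True
            then show ?thesis using V[of e] v unfolding ver_def by (simp add: n_def)
          next
            case False
            then show ?thesis
              using tension_field_component(2)[OF X g2_metric[OF assms(1)] SA assms(3,4) p xy False] by simp
          qed
        qed
      next
        assume "tension_field S h X g f p = 0"
        then have comp: "\<forall>v\<in>tangent_space S p. nabla_along S X g f n p (rotate90 S h p v) d
           = cross X \<phi> g (f p) (n p) (nabla_along S X g f n p v) d"
          using V[OF d] by (simp add: n_def)
        show "ver p"
          unfolding ver_def
        proof
          fix v assume v: "v \<in> tangent_space S p"
          have T: "nabla_along S X g f n p w \<in> tangent_space X (f p)" if "w \<in> tangent_space S p" for w
            unfolding n_def by (rule gauss_lift_derivative(2)[OF assms(1,2,4) p that])
          have nT: "n p \<in> tangent_space X (f p)"
            unfolding n_def by (rule gauss_lift_tangent(1)[OF assms(1-4) p])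
          show "nabla_along S X g f n p (rotate90 S h p v) = cross X \<phi> g (f p) (n p) (nabla_along S X g f n p v)"
          proof -
            have r: "rotate90 S h p v \<in> tangent_space S p" by (rule rotate90_component(1)[OF assms(2,3) c v])
            have cr: "cross X \<phi> g (f p) (n p) (nabla_along S X g f n p v) \<in> tangent_space X (f p)"
              using cross_coord_properties(3)[OF assms(1) d nT T[OF v]] by blast
            show ?thesis by (rule tangent_eqI[OF X T[OF r] cr d bspec[OF comp v]])
          qed
        qed
      qed
    qed
    then show "(\<forall>p\<in>carrier S. ver p) \<longleftrightarrow> harmonic S h X g f" by (simp add: harmonic_def)
  qed
  finally show ?thesis .
qed

end
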